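(* Let $x_1=w_1\varepsilon^{\mu_1}$, $x_2=w_2\varepsilon^{\mu_2}\in\widetilde W$. Choose $(v_1,v_2)\in\mathrm{LP}(x_1)\times\mathrm{LP}(x_2)$ such that $d(v_1\Rightarrow w_2v_2)$ is minimal among all such pairs. Then $$x_1\ast x_2=w_1v_1v_2^{-1}\varepsilon^{v_2v_1^{-1}\mu_1+\mu_2-v_2\,\mathrm{wt}(v_1\Rightarrow w_2v_2)},$$ $\ell(x_1\ast x_2)=\ell(x_1)+\ell(x_2)-d(v_1\Rightarrow w_2v_2)$, and $v_2\in\mathrm{LP}(x_1\ast x_2)$.
   Context: Let $\Phi$ be a reduced crystallographic finite root system with fixed basis $\Delta$, positive roots $\Phi^+$, negative roots $\Phi^-=-\Phi^+$, Weyl group $W$ and $2\rho=\sum_{\beta\in\Phi^+}\beta$. For $\alpha\in\Phi$, $\alpha^\vee$ is its coroot and $s_\alpha$ its reflection; $\ell$ on $W$ is the Coxeter length. Let $X_*$ be an abelian group containing $\mathbb Z\Phi^\vee$, with a bilinear pairing $\langle\cdot,\cdot\rangle:X_*\times\mathbb Z\Phi\to\mathbb Z$ extending the coroot–root pairing; $W$ acts by $s_\alpha(\mu)=\mu-\langle\mu,\alpha\rangle\alpha^\vee$. $\Phi^+(\alpha)=1$ if $\alpha\in\Phi^+$, $0$ otherwise. $\widetilde W=W\ltimes X_*$ with elements $w\varepsilon^\mu$, $\varepsilon^\mu w=w\varepsilon^{w^{-1}\mu}$. Affine roots $\Phi\times\mathbb Z$ with action $(w\varepsilon^\mu)(\alpha,k)=(w\alpha,k-\langle\mu,\alpha\rangle)$;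 positive affine roots $\{(\alpha,k):k\ge\Phi^+(-\alpha)\}$; $\ell(x)$ is the number of positive affine roots $a$ with $xa$ not positive; $r_{(\alpha,k)}=s_\alpha\varepsilon^{k\alpha^\vee}$. Bruhat order: generated by $x<xr_a$ whenever $\ell(x)<\ell(xr_a)$. Demazure product: for $x_1,x_2\in\widetilde W$, the set $\{x_1'x_2':x_1'\le x_1,x_2'\le x_2\}$ has a unique Bruhat-maximal element, denoted $x_1\ast x_2$. $\ell(x,\alpha)=\langle\mu,\alpha\rangle+\Phi^+(\alpha)-\Phi^+(w\alpha)$ for $x=w\varepsilon^\mu$; $\mathrm{LP}(x)=\{v\in W:\ell(x,v\alpha)\ge0\ \forall\alpha\in\Phi^+\}$. $\mathrm{QB}(W)$: vertex set $W$, edge $u\to us_\alpha$ ($\alpha\in\Phi^+$) if $\ell(us_\alpha)=\ell(u)+1$ (weight $0$) or $\ell(us_\alpha)=\ell(u)+1-\langle\alpha^\vee,2\rho\rangle$ (weight $\alpha^\vee$); $d(u\Rightarrow u')$ is the shortest path length and all shortest paths have a common weight $\mathrm{wt}(u\Rightarrow u')$. *)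

theory Defs
  imports "HOL-Analysis.Analysis"
begin

definition refl :: "'a::euclidean_space \<Rightarrow> 'a \<Rightarrow> 'a" where
  "refl \<alpha> v = v - (2 * (v \<bullet> \<alpha>) / (\<alpha> \<bullet> \<alpha>)) *\<^sub>R \<alpha>"

definition coroot :: "'a::euclidean_space \<Rightarrow> 'a" where
  "coroot \<alpha> = (2 / (\<alpha> \<bullet> \<alpha>)) *\<^sub>R \<alpha>"

definition zspan :: "'a::euclidean_space set \<Rightarrow> 'a set" where
  "zspan S = {(\<Sum>a\<in>F. of_int (c a) *\<^sub>R a) | F c. finite F \<and> F \<subseteq> S}"

definition root_system :: "'a::euclidean_space set \<Rightarrow> bool" where
  "root_system \<Phi> \<longleftrightarrow> finite \<Phi> \<and> 0 \<notin> \<Phi>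
     \<and> (\<forall>\<alpha>\<in>\<Phi>. \<forall>\<beta>\<in>\<Phi>. refl \<alpha> \<beta> \<in> \<Phi>)
     \<and> (\<forall>\<alpha>\<in>\<Phi>. \<forall>\<beta>\<in>\<Phi>. coroot \<alpha> \<bullet> \<beta> \<in> \<int>)
     \<and> (\<forall>\<alpha>\<in>\<Phi>. \<forall>c::real. c *\<^sub>R \<alpha> \<in> \<Phi> \<longrightarrow> c = 1 \<or> c = -1)"

definition root_basis :: "'a::euclidean_space set \<Rightarrow> 'a set \<Rightarrow> bool" where
  "root_basis \<Phi> \<Delta> \<longleftrightarrow> \<Delta> \<subseteq> \<Phi> \<and> independent \<Delta>
     \<and> (\<forall>\<beta>\<in>\<Phi>. \<exists>c::'a \<Rightarrow> int. \<beta> = (\<Sum>\<delta>\<in>\<Delta>. of_int (c \<delta>) *\<^sub>R \<delta>)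
            \<and> ((\<forall>\<delta>\<in>\<Delta>. c \<delta> \<ge> 0) \<or> (\<forall>\<delta>\<in>\<Delta>. c \<delta> \<le> 0)))"

definition pos_roots :: "'a::euclidean_space set \<Rightarrow> 'a set \<Rightarrow> 'a set" where
  "pos_roots \<Phi> \<Delta> = {\<beta>\<in>\<Phi>. \<exists>c::'a \<Rightarrow> int. \<beta> = (\<Sum>\<delta>\<in>\<Delta>. of_int (c \<delta>) *\<^sub>R \<delta>)
            \<and> (\<forall>\<delta>\<in>\<Delta>. c \<delta> \<ge> 0)}"

definition posind :: "'a::euclidean_space set \<Rightarrow> 'a set \<Rightarrow> 'a \<Rightarrow> int" where
  "posind \<Phi> \<Delta> \<alpha> = (if \<alpha> \<in> pos_roots \<Phi> \<Delta> then 1 else 0)"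

definition rho2 :: "'a::euclidean_space set \<Rightarrow> 'a set \<Rightarrow> 'a" where
  "rho2 \<Phi> \<Delta> = (\<Sum>\<beta>\<in>pos_roots \<Phi> \<Delta>. \<beta>)"

fun refl_prod :: "'a::euclidean_space list \<Rightarrow> 'a \<Rightarrow> 'a" where
  "refl_prod [] = id"
| "refl_prod (a # as) = refl a \<circ> refl_prod as"

definition weyl :: "'a::euclidean_space set \<Rightarrow> ('a \<Rightarrow> 'a) set" where
  "weyl \<Phi> = {refl_prod as | as. set as \<subseteq> \<Phi>}"

definition wlen :: "'a::euclidean_space set \<Rightarrow> ('a \<Rightarrow> 'a) \<Rightarrow> nat" where
  "wlen \<Delta> w = (LEAST n. \<exists>as. set as \<subseteq> \<Delta> \<and> length as = n \<and> w = refl_prod as)"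

text \<open>\<open>X\<^sub>*\<close> is an abelian group (a type \<open>'x\<close>) containing \<open>\<int>\<Phi>\<^sup>\<vee>\<close> via the
  injective additive map \<open>emb\<close> (defined on the coroot lattice inside the ambient space),
  with a bilinear pairing \<open>pr : X\<^sub>* \<times> \<int>\<Phi> \<rightarrow> \<int>\<close> extending the coroot-root pairing.\<close>
definition cochar_data :: "'a::euclidean_space set \<Rightarrow> ('a \<Rightarrow> 'x::ab_group_add) \<Rightarrow> ('x \<Rightarrow> 'a \<Rightarrow> int) \<Rightarrow> bool" where
  "cochar_data \<Phi> emb pr \<longleftrightarrow>
     (\<forall>a\<in>zspan (coroot ` \<Phi>). \<forall>b\<in>zspan (coroot ` \<Phi>). emb (a + b) = emb a + emb b)
   \<and> inj_on emb (zspan (coroot ` \<Phi>))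
   \<and> (\<forall>\<mu> \<nu> \<alpha>. pr (\<mu> + \<nu>) \<alpha> = pr \<mu> \<alpha> + pr \<nu> \<alpha>)
   \<and> (\<forall>\<mu>. \<forall>a\<in>zspan \<Phi>. \<forall>b\<in>zspan \<Phi>. pr \<mu> (a + b) = pr \<mu> a + pr \<mu> b)
   \<and> (\<forall>c\<in>zspan (coroot ` \<Phi>). \<forall>\<beta>\<in>zspan \<Phi>. of_int (pr (emb c) \<beta>) = c \<bullet> \<beta>)"

definition xrefl :: "('a::euclidean_space \<Rightarrow> 'x::ab_group_add) \<Rightarrow> ('x \<Rightarrow> 'a \<Rightarrow> int) \<Rightarrow> 'a \<Rightarrow> 'x \<Rightarrow> 'x" where
  "xrefl emb pr \<alpha> \<mu> = \<mu> - emb (of_int (pr \<mu> \<alpha>) *\<^sub>R coroot \<alpha>)"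

fun xact_list :: "('a::euclidean_space \<Rightarrow> 'x::ab_group_add) \<Rightarrow> ('x \<Rightarrow> 'a \<Rightarrow> int) \<Rightarrow> 'a list \<Rightarrow> 'x \<Rightarrow> 'x" where
  "xact_list emb pr [] \<mu> = \<mu>"
| "xact_list emb pr (a # as) \<mu> = xrefl emb pr a (xact_list emb pr as \<mu>)"

definition wact :: "'a::euclidean_space set \<Rightarrow> ('a \<Rightarrow> 'x::ab_group_add) \<Rightarrow> ('x \<Rightarrow> 'a \<Rightarrow> int)
                    \<Rightarrow> ('a \<Rightarrow> 'a) \<Rightarrow> 'x \<Rightarrow> 'x" where
  "wact \<Phi> emb pr w \<mu> = (THE \<nu>. \<exists>as. set as \<subseteq> \<Phi> \<and> w = refl_prod as \<and> \<nu> = xact_list emb pr as \<mu>)"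

section \<open>Extended affine Weyl group \<open>W \<ltimes> X\<^sub>*\<close>; the pair \<open>(w,\<mu>)\<close> stands for \<open>w\<epsilon>\<^sup>\<mu>\<close>\<close>

definition affW :: "'a::euclidean_space set \<Rightarrow> (('a \<Rightarrow> 'a) \<times> 'x) set" where
  "affW \<Phi> = weyl \<Phi> \<times> UNIV"

definition amult :: "'a::euclidean_space set \<Rightarrow> ('a \<Rightarrow> 'x::ab_group_add) \<Rightarrow> ('x \<Rightarrow> 'a \<Rightarrow> int)
     \<Rightarrow> ('a \<Rightarrow> 'a) \<times> 'x \<Rightarrow> ('a \<Rightarrow> 'a) \<times> 'x \<Rightarrow> ('a \<Rightarrow> 'a) \<times> 'x" where
  "amult \<Phi> emb pr x y = (case x of (w1, \<mu>1) \<Rightarrow> case y of (w2, \<mu>2) \<Rightarrow>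
       (w1 \<circ> w2, wact \<Phi> emb pr (inv w2) \<mu>1 + \<mu>2))"

text \<open>Action on affine roots \<open>\<Phi> \<times> \<int>\<close>.\<close>
definition aact :: "('x \<Rightarrow> 'a \<Rightarrow> int) \<Rightarrow> ('a \<Rightarrow> 'a) \<times> 'x \<Rightarrow> 'a \<times> int \<Rightarrow> 'a \<times> int" where
  "aact pr x a = (case x of (w, \<mu>) \<Rightarrow> case a of (\<alpha>, k) \<Rightarrow> (w \<alpha>, k - pr \<mu> \<alpha>))"

definition pos_aff :: "'a::euclidean_space set \<Rightarrow> 'a set \<Rightarrow> 'a \<times> int \<Rightarrow> bool" where
  "pos_aff \<Phi> \<Delta> a = (case a of (\<alpha>, k) \<Rightarrow> \<alpha> \<in> \<Phi> \<and> k \<ge> posind \<Phi> \<Delta> (- \<alpha>))"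

definition alen :: "'a::euclidean_space set \<Rightarrow> 'a set \<Rightarrow> ('x \<Rightarrow> 'a \<Rightarrow> int) \<Rightarrow> ('a \<Rightarrow> 'a) \<times> 'x \<Rightarrow> nat" where
  "alen \<Phi> \<Delta> pr x = card {a. pos_aff \<Phi> \<Delta> a \<and> \<not> pos_aff \<Phi> \<Delta> (aact pr x a)}"

definition aref :: "('a::euclidean_space \<Rightarrow> 'x::ab_group_add) \<Rightarrow> 'a \<times> int \<Rightarrow> ('a \<Rightarrow> 'a) \<times> 'x" where
  "aref emb a = (case a of (\<alpha>, k) \<Rightarrow> (refl \<alpha>, emb (of_int k *\<^sub>R coroot \<alpha>)))"

definition bruhat_step :: "'a::euclidean_space set \<Rightarrow> 'a set \<Rightarrow> ('a \<Rightarrow> 'x::ab_group_add) \<Rightarrow> ('x \<Rightarrow> 'a \<Rightarrow> int)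
     \<Rightarrow> ('a \<Rightarrow> 'a) \<times> 'x \<Rightarrow> ('a \<Rightarrow> 'a) \<times> 'x \<Rightarrow> bool" where
  "bruhat_step \<Phi> \<Delta> emb pr x y \<longleftrightarrow> x \<in> affW \<Phi>
     \<and> (\<exists>a \<in> \<Phi> \<times> UNIV. y = amult \<Phi> emb pr x (aref emb a))
     \<and> alen \<Phi> \<Delta> pr x < alen \<Phi> \<Delta> pr y"

definition bruhat_le :: "'a::euclidean_space set \<Rightarrow> 'a set \<Rightarrow> ('a \<Rightarrow> 'x::ab_group_add) \<Rightarrow> ('x \<Rightarrow> 'a \<Rightarrow> int)
     \<Rightarrow> ('a \<Rightarrow> 'a) \<times> 'x \<Rightarrow> ('a \<Rightarrow> 'a) \<times> 'x \<Rightarrow> bool" where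
  "bruhat_le \<Phi> \<Delta> emb pr = (bruhat_step \<Phi> \<Delta> emb pr)\<^sup>*\<^sup>*"

definition demazure :: "'a::euclidean_space set \<Rightarrow> 'a set \<Rightarrow> ('a \<Rightarrow> 'x::ab_group_add) \<Rightarrow> ('x \<Rightarrow> 'a \<Rightarrow> int)
     \<Rightarrow> ('a \<Rightarrow> 'a) \<times> 'x \<Rightarrow> ('a \<Rightarrow> 'a) \<times> 'x \<Rightarrow> ('a \<Rightarrow> 'a) \<times> 'x" where
  "demazure \<Phi> \<Delta> emb pr x1 x2 =
    (let S = {amult \<Phi> emb pr y1 y2 | y1 y2. bruhat_le \<Phi> \<Delta> emb pr y1 x1 \<and> bruhat_le \<Phi> \<Delta> emb pr y2 x2}
     in THE z. z \<in> S \<and> (\<forall>y\<in>S. bruhat_le \<Phi> \<Delta> emb pr z y \<longrightarrow> y = z))"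

definition lxa :: "'a::euclidean_space set \<Rightarrow> 'a set \<Rightarrow> ('x \<Rightarrow> 'a \<Rightarrow> int) \<Rightarrow> ('a \<Rightarrow> 'a) \<times> 'x \<Rightarrow> 'a \<Rightarrow> int" where
  "lxa \<Phi> \<Delta> pr x \<alpha> = (case x of (w, \<mu>) \<Rightarrow> pr \<mu> \<alpha> + posind \<Phi> \<Delta> \<alpha> - posind \<Phi> \<Delta> (w \<alpha>))"

definition LP :: "'a::euclidean_space set \<Rightarrow> 'a set \<Rightarrow> ('x \<Rightarrow> 'a \<Rightarrow> int) \<Rightarrow> ('a \<Rightarrow> 'a) \<times> 'x \<Rightarrow> ('a \<Rightarrow> 'a) set" where
  "LP \<Phi> \<Delta> pr x = {v \<in> weyl \<Phi>. \<forall>\<alpha>\<in>pos_roots \<Phi> \<Delta>. lxa \<Phi> \<Delta> pr x (v \<alpha>) \<ge> 0}"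

definition qb_bruhat_edge :: "'a::euclidean_space set \<Rightarrow> 'a set \<Rightarrow> ('a \<Rightarrow> 'a) \<Rightarrow> 'a \<Rightarrow> bool" where
  "qb_bruhat_edge \<Phi> \<Delta> u \<alpha> \<longleftrightarrow> \<alpha> \<in> pos_roots \<Phi> \<Delta> \<and> wlen \<Delta> (u \<circ> refl \<alpha>) = wlen \<Delta> u + 1"

definition qb_quantum_edge :: "'a::euclidean_space set \<Rightarrow> 'a set \<Rightarrow> ('a \<Rightarrow> 'a) \<Rightarrow> 'a \<Rightarrow> bool" where
  "qb_quantum_edge \<Phi> \<Delta> u \<alpha> \<longleftrightarrow> \<alpha> \<in> pos_roots \<Phi> \<Delta> \<and>
     real (wlen \<Delta> (u \<circ> refl \<alpha>)) = real (wlen \<Delta> u) + 1 - coroot \<alpha> \<bullet> rho2 \<Phi> \<Delta>"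

fun qb_path :: "'a::euclidean_space set \<Rightarrow> 'a set \<Rightarrow> ('a \<Rightarrow> 'a) \<Rightarrow> 'a list \<Rightarrow> ('a \<Rightarrow> 'a) \<Rightarrow> bool" where
  "qb_path \<Phi> \<Delta> u [] u' \<longleftrightarrow> u = u'"
| "qb_path \<Phi> \<Delta> u (a # as) u' \<longleftrightarrow>
     (qb_bruhat_edge \<Phi> \<Delta> u a \<or> qb_quantum_edge \<Phi> \<Delta> u a) \<and> qb_path \<Phi> \<Delta> (u \<circ> refl a) as u'"

text \<open>Weight of a path (in the coroot lattice; embedded into \<open>X\<^sub>*\<close> by \<open>emb\<close>).\<close>
fun qb_pathwt :: "'a::euclidean_space set \<Rightarrow> 'a set \<Rightarrow> ('a \<Rightarrow> 'a) \<Rightarrow> 'a list \<Rightarrow> 'a" where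
  "qb_pathwt \<Phi> \<Delta> u [] = 0"
| "qb_pathwt \<Phi> \<Delta> u (a # as) =
     (if qb_quantum_edge \<Phi> \<Delta> u a then coroot a else 0) + qb_pathwt \<Phi> \<Delta> (u \<circ> refl a) as"

definition qb_dist :: "'a::euclidean_space set \<Rightarrow> 'a set \<Rightarrow> ('a \<Rightarrow> 'a) \<Rightarrow> ('a \<Rightarrow> 'a) \<Rightarrow> nat" where
  "qb_dist \<Phi> \<Delta> u u' = (LEAST n. \<exists>as. qb_path \<Phi> \<Delta> u as u' \<and> length as = n)"

definition qb_wt :: "'a::euclidean_space set \<Rightarrow> 'a set \<Rightarrow> ('a \<Rightarrow> 'x::ab_group_add) \<Rightarrow> ('a \<Rightarrow> 'a) \<Rightarrow> ('a \<Rightarrow> 'a) \<Rightarrow> 'x" where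
  "qb_wt \<Phi> \<Delta> emb u u' = (THE \<nu>. \<exists>as. qb_path \<Phi> \<Delta> u as u' \<and> length as = qb_dist \<Phi> \<Delta> u u'
                              \<and> \<nu> = emb (qb_pathwt \<Phi> \<Delta> u as))"

end

theory Submission
  imports Defs
begin

text \<open>
  Let \<open>S(x\<^sub>1, x\<^sub>2)\<close> be the set of products \<open>y\<^sub>1 y\<^sub>2\<close> with \<open>y\<^sub>i \<le> x\<^sub>i\<close>. If \<open>s\<close> is a simple affine reflection and
  \<open>x\<^sub>2 < s x\<^sub>2\<close>, the lifting property gives \<open>S(x\<^sub>1, s x\<^sub>2) = S(max(x\<^sub>1, x\<^sub>1 s), x\<^sub>2)\<close>. Induction on
  \<open>\<ell>(x\<^sub>2)\<close> yields a greatest element \<open>m\<close> of \<open>S(x\<^sub>1, x\<^sub>2)\<close>; tracking length positive elements along this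
  induction, where left multiplication by \<open>s\<close> transports paths of the quantum Bruhat graph without
  lengthening them, gives \<open>\<ell>(m) \<le> \<ell>(x\<^sub>1) + \<ell>(x\<^sub>2) - d(v\<^sub>1 \<Rightarrow> w\<^sub>2 v\<^sub>2)\<close> for some pair \<open>(v\<^sub>1, v\<^sub>2)\<close>.

  Conversely, let \<open>(v\<^sub>1, v\<^sub>2)\<close> be a pair of minimal distance and fix a shortest path from \<open>v\<^sub>1\<close> to \<open>w\<^sub>2 v\<^sub>2\<close>
  of weight \<open>\<omega>\<close>. The element \<open>x\<^sub>1 \<cdot> v\<^sub>1 \<epsilon>\<^sup>-\<^sup>\<omega> (w\<^sub>2 v\<^sub>2)\<^sup>-\<^sup>1 \<cdot> x\<^sub>2\<close> has length at least
  \<open>\<ell>(x\<^sub>1) + \<ell>(x\<^sub>2) - d\<close>, and every edge of the path is an affine reflection. By minimality the first edge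
  lowers \<open>x\<^sub>1\<close> by exactly one, so the element lies in \<open>S(x\<^sub>1, x\<^sub>2)\<close> by induction on \<open>d\<close>, and hence equals \<open>m\<close>.
  In particular all shortest paths have the same weight.
\<close>

text \<open>The two halves are not independent. Passing from \<open>x1\<close> to
  \<open>y = x1 r_a\<close> along the first edge is useful only if the remaining path is again
  minimal, now among all pairs for \<open>y\<close>. Minimality for \<open>x1\<close> does not give
  this by itself; the upper bound on the length of the greatest element does, since a path for
  \<open>y\<close> shorter by more than one edge would produce an element of
  \<open>S(x1, x2)\<close> that is too long. So the upper bound comes first, and for some pair
  \<open>(v1, v2)\<close> that need not be the given one.

  Lengths are compared through the numbers \<open>directed_len v x\<close>, the sum of \<ell>(x,
  v\<beta>) over positive \<beta>. They never exceed \<ell>(x) and reach it exactly for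
  \<open>v\<close> in LP(x), so length positivity becomes one equation. When \<open>v\<close> is
  multiplied by a reflection they change by terms in \<open>edge_excess\<close>, which takes its
  least value on edges; Bruhat and quantum edges are covered by one formula.

  Positivity of finite and affine roots is the sign of a linear functional, \<open>ht\<close> and
  \<open>aff\<close>, so that combinatorial steps become sign computations.\<close>

lemma zspan_superset:
  assumes "a \<in> S" shows "a \<in> zspan S"
  unfolding zspan_def using assms
  by (auto intro!: exI[of _ "{a}"] exI[of _ "\<lambda>_. 1"])

lemma zspan_scale:
  assumes "x \<in> zspan S" shows "of_int n *\<^sub>R x \<in> zspan S"
proof -
  obtain F c where F: "finite F" "F \<subseteq> S" "x = (\<Sum>a\<in>F. of_int (c a) *\<^sub>R a)"
    using assms unfolding zspan_def by blast
  have "of_int n *\<^sub>R x = (\<Sum>a\<in>F. of_int (n * c a) *\<^sub>R a)"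
    by (simp add: F(3) scaleR_sum_right)
  with F(1,2) show ?thesis unfolding zspan_def
    by (intro CollectI exI[of _ F] exI[of _ "\<lambda>a. n * c a"]) simp
qed

lemma zspan_add:
  assumes "x \<in> zspan S" "y \<in> zspan S" shows "x + y \<in> zspan S"
proof -
  obtain F c where F: "finite F" "F \<subseteq> S" "x = (\<Sum>a\<in>F. of_int (c a) *\<^sub>R a)"
    using assms(1) unfolding zspan_def by blast
  obtain G d where G: "finite G" "G \<subseteq> S" "y = (\<Sum>a\<in>G. of_int (d a) *\<^sub>R a)"
    using assms(2) unfolding zspan_def by blast
  define c' where "c' a = (if a \<in> F then c a else 0)" for a
  define d' where "d' a = (if a \<in> G then d a else 0)" for a
  have "x = (\<Sum>a\<in>F \<union> G. of_int (c' a) *\<^sub>R a)"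
    unfolding F(3) by (rule sum.mono_neutral_cong_left) (auto simp: F G c'_def)
  moreover have "y = (\<Sum>a\<in>F \<union> G. of_int (d' a) *\<^sub>R a)"
    unfolding G(3) by (rule sum.mono_neutral_cong_left) (auto simp: F G d'_def)
  ultimately have "x + y = (\<Sum>a\<in>F \<union> G. of_int (c' a + d' a) *\<^sub>R a)"
    by (simp add: sum.distrib scaleR_add_left)
  with F G show ?thesis unfolding zspan_def
    by (intro CollectI exI[of _ "F \<union> G"] exI[of _ "\<lambda>a. c' a + d' a"]) auto
qed

lemma zspan_zero: "0 \<in> zspan S"
  unfolding zspan_def by (auto intro!: exI[of _ "{}"])

lemma zspan_minus: "x \<in> zspan S \<Longrightarrow> - x \<in> zspan S"
  using zspan_scale[of x S "-1"] by simp

lemma zspan_subset_span: "zspan S \<subseteq> span S"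
proof
  fix x assume "x \<in> zspan S"
  then obtain F c where F: "F \<subseteq> S" "x = (\<Sum>a\<in>F. of_int (c a) *\<^sub>R a)"
    unfolding zspan_def by blast
  show "x \<in> span S" unfolding F(2)
    by (rule span_sum, rule span_scale, rule span_base) (use F(1) in blast)
qed

section \<open>Reflections, coroots and words in reflections\<close>

lemma refl_coroot: "refl \<alpha> v = v - (coroot \<alpha> \<bullet> v) *\<^sub>R \<alpha>"
  by (simp add: refl_def coroot_def inner_commute)

lemma linear_refl: "linear (refl \<alpha>)"
  by (rule linearI) (simp_all add: refl_coroot inner_add_right algebra_simps)

lemma coroot_inner_self: "\<alpha> \<noteq> 0 \<Longrightarrow> coroot \<alpha> \<bullet> \<alpha> = 2"
  by (simp add: coroot_def)

lemma refl_self: "\<alpha> \<noteq> 0 \<Longrightarrow> refl \<alpha> \<alpha> = - \<alpha>"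
  by (simp add: refl_coroot coroot_inner_self scaleR_2)

lemma refl_zero: "refl 0 v = v"
  by (simp add: refl_def)

lemma refl_refl: "refl \<alpha> (refl \<alpha> v) = v"
proof (cases "\<alpha> = 0")
  case False
  then show ?thesis
    by (simp add: refl_coroot inner_diff_right coroot_inner_self)
qed (simp add: refl_zero)

lemma refl_comp_refl: "refl \<alpha> \<circ> refl \<alpha> = id"
  by (rule ext) (simp add: refl_refl)

lemma inner_refl_refl: "refl \<alpha> u \<bullet> refl \<alpha> v = u \<bullet> v"
proof (cases "\<alpha> = 0")
  case False
  then show ?thesis
    by (simp add: refl_def inner_diff_left inner_diff_right inner_commute field_simps)
qed (simp add: refl_zero)

lemma refl_minus_root: "refl (- \<alpha>) = refl \<alpha>"
  by (rule ext) (simp add: refl_def)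

lemma coroot_minus: "coroot (- \<alpha>) = - coroot \<alpha>"
  by (simp add: coroot_def)

lemma refl_prod_append: "refl_prod (as @ bs) = refl_prod as \<circ> refl_prod bs"
  by (induction as) (auto simp: comp_assoc)

lemma refl_prod_rev: "refl_prod (rev as) \<circ> refl_prod as = id"
proof (induction as)
  case (Cons a as)
  have "refl_prod (rev (a # as)) \<circ> refl_prod (a # as)
      = refl_prod (rev as) \<circ> (refl a \<circ> refl a) \<circ> refl_prod as"
    by (simp only: refl_prod_append comp_assoc rev.simps refl_prod.simps comp_id)
  with Cons show ?case by (simp only: refl_comp_refl comp_id)
qed simp

lemma refl_prod_rev': "refl_prod as \<circ> refl_prod (rev as) = id"
  using refl_prod_rev[of "rev as"] by simp

lemma inv_refl_prod: "inv (refl_prod as) = refl_prod (rev as)"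
  by (rule inv_unique_comp) (simp_all add: refl_prod_rev refl_prod_rev')

section \<open>Roots and the finite Weyl group\<close>

locale based_roots =
  fixes \<Phi> \<Delta> :: "'a::euclidean_space set"
  assumes rs: "root_system \<Phi>" and rb: "root_basis \<Phi> \<Delta>"
begin

abbreviation "P \<equiv> pos_roots \<Phi> \<Delta>"
abbreviation "W \<equiv> weyl \<Phi>"
abbreviation "pind \<equiv> posind \<Phi> \<Delta>"

lemma fin_roots: "finite \<Phi>" and root_nz: "0 \<notin> \<Phi>"
  and refl_root: "\<alpha> \<in> \<Phi> \<Longrightarrow> \<beta> \<in> \<Phi> \<Longrightarrow> refl \<alpha> \<beta> \<in> \<Phi>"
  and coroot_int: "\<alpha> \<in> \<Phi> \<Longrightarrow> \<beta> \<in> \<Phi> \<Longrightarrow> coroot \<alpha> \<bullet> \<beta> \<in> \<int>"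
  and root_multiple: "\<alpha> \<in> \<Phi> \<Longrightarrow> c *\<^sub>R \<alpha> \<in> \<Phi> \<Longrightarrow> c = 1 \<or> c = -1"
  using rs unfolding root_system_def by blast+

lemma minus_root: "\<alpha> \<in> \<Phi> \<Longrightarrow> - \<alpha> \<in> \<Phi>"
  using refl_root[of \<alpha> \<alpha>] refl_self[of \<alpha>] root_nz by metis

lemma simple_root: "\<delta> \<in> \<Delta> \<Longrightarrow> \<delta> \<in> \<Phi>"
  and indep_simple: "independent \<Delta>"
  using rb unfolding root_basis_def by auto

lemma fin_simple: "finite \<Delta>"
  using rb fin_roots finite_subset unfolding root_basis_def by blast

lemma weyl_refl_prodE:
  assumes "w \<in> W" obtains as where "set as \<subseteq> \<Phi>" "w = refl_prod as"
  using assms unfolding weyl_def by blast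

lemma weylI: "set as \<subseteq> \<Phi> \<Longrightarrow> refl_prod as \<in> W"
  unfolding weyl_def by blast

lemma id_weyl: "id \<in> W"
  using weylI[of "[]"] by simp

lemma refl_weyl: "\<alpha> \<in> \<Phi> \<Longrightarrow> refl \<alpha> \<in> W"
  using weylI[of "[\<alpha>]"] by simp

lemma comp_weyl: "u \<in> W \<Longrightarrow> w \<in> W \<Longrightarrow> u \<circ> w \<in> W"
  by (elim weyl_refl_prodE) (simp add: weylI flip: refl_prod_append)

lemma inv_weyl: "w \<in> W \<Longrightarrow> inv w \<in> W"
  by (elim weyl_refl_prodE) (simp add: weylI inv_refl_prod)

lemma weyl_inv_comp: assumes "w \<in> W" shows "inv w \<circ> w = id" "w \<circ> inv w = id"
  using assms by (auto elim!: weyl_refl_prodE simp: inv_refl_prod refl_prod_rev refl_prod_rev')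

lemma weyl_inv_app: assumes "w \<in> W" shows "inv w (w x) = x" "w (inv w x) = x"
  using weyl_inv_comp[OF assms] by (metis comp_apply id_apply)+

lemma bij_weyl: "w \<in> W \<Longrightarrow> bij w"
  using weyl_inv_comp o_bij by blast

lemma inv_comp_weyl: "u \<in> W \<Longrightarrow> w \<in> W \<Longrightarrow> inv (u \<circ> w) = inv w \<circ> inv u"
  by (simp add: bij_weyl o_inv_distrib)

lemma inv_inv_weyl: "w \<in> W \<Longrightarrow> inv (inv w) = w"
  by (simp add: bij_weyl inv_inv_eq)

lemma inv_refl: "inv (refl \<alpha>) = refl \<alpha>"
  by (rule inv_unique_comp) (simp_all add: refl_comp_refl)

lemma linear_weyl: assumes "w \<in> W" shows "linear w"
proof -
  have "linear (refl_prod as)" for as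
  proof (induction as)
    case Nil show ?case by (simp add: linear_id[unfolded id_def] id_def)
  next
    case (Cons a as)
    then show ?case unfolding refl_prod.simps by (intro linear_compose linear_refl)
  qed
  with assms show ?thesis by (auto elim!: weyl_refl_prodE)
qed

lemma weyl_minus: "w \<in> W \<Longrightarrow> w (- x) = - w x"
  by (simp add: linear_weyl linear_neg)

lemma inner_weyl: assumes "w \<in> W" shows "w x \<bullet> w y = x \<bullet> y"
proof -
  have "refl_prod as x \<bullet> refl_prod as y = x \<bullet> y" for as
    by (induction as) (auto simp: inner_refl_refl)
  with assms show ?thesis by (auto elim!: weyl_refl_prodE)
qed

lemma weyl_root: assumes "w \<in> W" "\<beta> \<in> \<Phi>" shows "w \<beta> \<in> \<Phi>"
proof -
  have "set as \<subseteq> \<Phi> \<Longrightarrow> refl_prod as \<beta> \<in> \<Phi>" for as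
    by (induction as) (auto simp: refl_root assms)
  with assms show ?thesis by (auto elim!: weyl_refl_prodE)
qed

lemma weyl_eq_iff: "w \<in> W \<Longrightarrow> w x = w y \<longleftrightarrow> x = y"
  using bij_weyl bij_is_inj inj_eq by metis

lemma coroot_weyl: assumes "w \<in> W" shows "coroot (w \<beta>) = w (coroot \<beta>)"
  by (simp add: coroot_def inner_weyl assms linear_cmul[OF linear_weyl])

lemma refl_weyl_conj: assumes "w \<in> W" shows "refl (w \<beta>) \<circ> w = w \<circ> refl \<beta>"
  by (rule ext) (simp add: refl_coroot coroot_weyl inner_weyl assms
      linear_diff[OF linear_weyl] linear_cmul[OF linear_weyl])

lemma refl_weyl_app: assumes "w \<in> W" shows "refl (w \<beta>) (w x) = w (refl \<beta> x)"
  using refl_weyl_conj[OF assms] by (metis comp_apply)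

text \<open>Some linear extension of the height function from the root lattice to the ambient space.
  It turns positivity of a root into the sign of a real number.\<close>

definition ht :: "'a \<Rightarrow> real" where
  "ht = (SOME g. linear g \<and> (\<forall>\<delta>\<in>\<Delta>. g \<delta> = 1))"

lemma linear_ht: "linear ht" and ht_simple: "\<delta> \<in> \<Delta> \<Longrightarrow> ht \<delta> = 1"
proof -
  obtain g :: "'a \<Rightarrow> real" where "linear g \<and> (\<forall>\<delta>\<in>\<Delta>. g \<delta> = 1)"
    using linear_independent_extend[OF indep_simple, of "\<lambda>_. 1"] by auto
  then have "linear ht \<and> (\<forall>\<delta>\<in>\<Delta>. ht \<delta> = 1)"
    unfolding ht_def by (rule someI[where P = "\<lambda>g. linear g \<and> (\<forall>\<delta>\<in>\<Delta>. g \<delta> = 1)"])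
  then show "linear ht" "\<delta> \<in> \<Delta> \<Longrightarrow> ht \<delta> = 1" by auto
qed

lemma ht_minus: "ht (- x) = - ht x" and ht_add: "ht (x + y) = ht x + ht y"
  and ht_diff: "ht (x - y) = ht x - ht y" and ht_scale: "ht (c *\<^sub>R x) = c * ht x"
  using linear_neg[OF linear_ht] linear_add[OF linear_ht] linear_diff[OF linear_ht]
    linear_cmul[OF linear_ht] by auto

lemma ht_expansion: "ht (\<Sum>\<delta>\<in>\<Delta>. of_int (c \<delta>) *\<^sub>R \<delta>) = of_int (\<Sum>\<delta>\<in>\<Delta>. c \<delta>)"
  by (simp add: linear_sum[OF linear_ht] ht_scale ht_simple)

lemma root_expansion:
  assumes "\<beta> \<in> \<Phi>"
  obtains c :: "'a \<Rightarrow> int" where "\<beta> = (\<Sum>\<delta>\<in>\<Delta>. of_int (c \<delta>) *\<^sub>R \<delta>)"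
    "(\<forall>\<delta>\<in>\<Delta>. c \<delta> \<ge> 0) \<or> (\<forall>\<delta>\<in>\<Delta>. c \<delta> \<le> 0)"
  using rb assms unfolding root_basis_def by blast

lemma expansion_unique:
  assumes "(\<Sum>\<delta>\<in>\<Delta>. of_int (c \<delta>) *\<^sub>R \<delta>) = (\<Sum>\<delta>\<in>\<Delta>. of_int (d \<delta>) *\<^sub>R \<delta>)" "\<delta> \<in> \<Delta>"
  shows "c \<delta> = (d \<delta> :: int)"
proof -
  have "(\<Sum>\<delta>\<in>\<Delta>. (of_int (c \<delta>) - of_int (d \<delta>)) *\<^sub>R \<delta>) = 0"
    using assms(1) by (simp add: scaleR_diff_left sum_subtractf)
  then have "real_of_int (c \<delta>) - of_int (d \<delta>) = 0"
    by (rule independentD[OF indep_simple fin_simple subset_refl _ assms(2)])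
  then show ?thesis by simp
qed

lemma pos_expansion_ht:
  assumes "\<beta> = (\<Sum>\<delta>\<in>\<Delta>. of_int (c \<delta>) *\<^sub>R \<delta>)" "\<beta> \<noteq> 0" "\<forall>\<delta>\<in>\<Delta>. (c \<delta> :: int) \<ge> 0"
  shows "ht \<beta> > 0"
proof -
  have "\<exists>\<delta>\<in>\<Delta>. c \<delta> \<noteq> 0" using assms by (metis (no_types, lifting) sum.neutral of_int_0 scaleR_zero_left)
  then have "(\<Sum>\<delta>\<in>\<Delta>. c \<delta>) \<noteq> 0"
    using assms(3) fin_simple by (simp add: sum_nonneg_eq_0_iff)
  moreover have "(\<Sum>\<delta>\<in>\<Delta>. c \<delta>) \<ge> 0" using assms(3) by (simp add: sum_nonneg)
  ultimately show ?thesis unfolding assms(1) ht_expansion by linarith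
qed

lemma pos_root_iff: "\<beta> \<in> P \<longleftrightarrow> \<beta> \<in> \<Phi> \<and> ht \<beta> > 0"
proof
  assume "\<beta> \<in> P"
  then obtain c where c: "\<beta> \<in> \<Phi>" "\<beta> = (\<Sum>\<delta>\<in>\<Delta>. of_int (c \<delta>) *\<^sub>R \<delta>)" "\<forall>\<delta>\<in>\<Delta>. (c \<delta> :: int) \<ge> 0"
    unfolding pos_roots_def by blast
  have "\<beta> \<noteq> 0" using c(1) root_nz by auto
  from pos_expansion_ht[OF c(2) this c(3)] c(1) show "\<beta> \<in> \<Phi> \<and> ht \<beta> > 0" by blast
next
  assume b: "\<beta> \<in> \<Phi> \<and> ht \<beta> > 0"
  obtain c where c: "\<beta> = (\<Sum>\<delta>\<in>\<Delta>. of_int (c \<delta>) *\<^sub>R \<delta>)"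
    "(\<forall>\<delta>\<in>\<Delta>. c \<delta> \<ge> 0) \<or> (\<forall>\<delta>\<in>\<Delta>. c \<delta> \<le> 0)" using root_expansion b by blast
  have "\<not> (\<forall>\<delta>\<in>\<Delta>. c \<delta> \<le> 0)"
  proof
    assume "\<forall>\<delta>\<in>\<Delta>. c \<delta> \<le> 0"
    then have "sum c \<Delta> \<le> 0" by (simp add: sum_nonpos)
    moreover have "ht \<beta> = of_int (sum c \<Delta>)" by (subst c(1)) (rule ht_expansion)
    ultimately show False using b by simp
  qed
  with b c show "\<beta> \<in> P" unfolding pos_roots_def by blast
qed

lemma ht_root: assumes "\<beta> \<in> \<Phi>" shows "\<exists>n::int. n \<noteq> 0 \<and> ht \<beta> = of_int n"
proof -
  obtain c where c: "\<beta> = (\<Sum>\<delta>\<in>\<Delta>. of_int (c \<delta>) *\<^sub>R \<delta>)"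
    "(\<forall>\<delta>\<in>\<Delta>. c \<delta> \<ge> 0) \<or> (\<forall>\<delta>\<in>\<Delta>. c \<delta> \<le> 0)" using root_expansion assms by blast
  have nz: "\<beta> \<noteq> 0" using assms root_nz by auto
  have "ht \<beta> \<noteq> 0" using c(2)
  proof
    assume "\<forall>\<delta>\<in>\<Delta>. c \<delta> \<ge> 0" then show ?thesis using pos_expansion_ht[OF c(1) nz] by simp
  next
    assume n: "\<forall>\<delta>\<in>\<Delta>. c \<delta> \<le> 0"
    have "- \<beta> = (\<Sum>\<delta>\<in>\<Delta>. of_int (- c \<delta>) *\<^sub>R \<delta>)" by (simp add: c(1) sum_negf)
    from pos_expansion_ht[OF this] n nz have "ht (- \<beta>) > 0" by simp
    then show ?thesis by (simp add: ht_minus)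
  qed
  then show ?thesis unfolding c(1) ht_expansion by (intro exI[of _ "sum c \<Delta>"]) (metis of_int_0)
qed

lemma ht_root_nz: "\<beta> \<in> \<Phi> \<Longrightarrow> ht \<beta> \<noteq> 0"
  using ht_root[of \<beta>] by auto

lemma pos_is_root: "\<beta> \<in> P \<Longrightarrow> \<beta> \<in> \<Phi>" by (simp add: pos_root_iff)

lemma minus_pos_iff: "\<beta> \<in> \<Phi> \<Longrightarrow> - \<beta> \<in> P \<longleftrightarrow> \<beta> \<notin> P"
  using ht_root_nz[of \<beta>] by (auto simp: pos_root_iff minus_root ht_minus)

lemma fin_pos: "finite P"
  by (rule finite_subset[OF _ fin_roots]) (auto simp: pos_is_root)

lemma pind_minus: "\<beta> \<in> \<Phi> \<Longrightarrow> pind (- \<beta>) = 1 - pind \<beta>"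
  by (auto simp: posind_def minus_pos_iff)

lemma pind_01: "pind \<beta> = 0 \<or> pind \<beta> = 1" by (simp add: posind_def)

lemma simple_pos: "\<delta> \<in> \<Delta> \<Longrightarrow> \<delta> \<in> P"
  by (simp add: pos_root_iff simple_root ht_simple)

text \<open>Reducedness gives \<beta> a positive coefficient at some simple root other than
  \<delta>. The reflection changes only the coefficient at \<delta>, and one positive coefficient
  decides the sign of a root.\<close>

lemma refl_simple_pos:
  assumes d: "\<delta> \<in> \<Delta>" and b: "\<beta> \<in> P" and ne: "\<beta> \<noteq> \<delta>"
  shows "refl \<delta> \<beta> \<in> P"
proof -
  have bR: "\<beta> \<in> \<Phi>" using b pos_is_root by blast
  obtain c where c: "\<beta> = (\<Sum>\<delta>\<in>\<Delta>. of_int (c \<delta>) *\<^sub>R \<delta>)" "\<forall>\<delta>\<in>\<Delta>. (c \<delta>::int) \<ge> 0"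
    using b unfolding pos_roots_def by blast
  have "\<exists>\<epsilon>\<in>\<Delta> - {\<delta>}. c \<epsilon> > 0"
  proof (rule ccontr)
    assume "\<not> ?thesis"
    then have "\<forall>\<epsilon>\<in>\<Delta> - {\<delta>}. c \<epsilon> = 0" using c(2) by force
    then have eq: "\<beta> = of_int (c \<delta>) *\<^sub>R \<delta>"
      unfolding c(1) using sum.remove[OF fin_simple d, of "\<lambda>\<delta>. of_int (c \<delta>) *\<^sub>R \<delta>"] by simp
    with eq have "c \<delta> = 1 \<or> c \<delta> = -1" using root_multiple[OF simple_root[OF d]] bR
      by (metis of_int_eq_1_iff of_int_eq_iff of_int_minus of_int_1)
    with c(2) d have "c \<delta> = 1" by fastforce
    with eq ne show False by simp
  qed
  then obtain \<epsilon> where e: "\<epsilon> \<in> \<Delta>" "\<epsilon> \<noteq> \<delta>" "c \<epsilon> > 0" by blast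
  obtain n where n: "coroot \<delta> \<bullet> \<beta> = of_int n"
    using coroot_int[OF simple_root[OF d] bR] Ints_cases by blast
  have rR: "refl \<delta> \<beta> \<in> \<Phi>" using refl_root simple_root d bR by blast
  define c' where "c' = c(\<delta> := c \<delta> - n)"
  have "refl \<delta> \<beta> = (\<Sum>\<delta>\<in>\<Delta>. of_int (c' \<delta>) *\<^sub>R \<delta>)"
  proof -
    have "(\<Sum>\<delta>\<in>\<Delta>. of_int (c' \<delta>) *\<^sub>R \<delta>) = of_int (c \<delta> - n) *\<^sub>R \<delta> + (\<Sum>\<delta>\<in>\<Delta>-{\<delta>}. of_int (c \<delta>) *\<^sub>R \<delta>)"
      using sum.remove[OF fin_simple d, of "\<lambda>\<delta>. of_int (c' \<delta>) *\<^sub>R \<delta>"] by (simp add: c'_def)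
    moreover have "\<beta> = of_int (c \<delta>) *\<^sub>R \<delta> + (\<Sum>\<delta>\<in>\<Delta>-{\<delta>}. of_int (c \<delta>) *\<^sub>R \<delta>)"
      using sum.remove[OF fin_simple d, of "\<lambda>\<delta>. of_int (c \<delta>) *\<^sub>R \<delta>"] c(1) by simp
    ultimately show ?thesis unfolding refl_coroot n by (simp add: scaleR_diff_left)
  qed
  moreover obtain d' where d': "refl \<delta> \<beta> = (\<Sum>\<delta>\<in>\<Delta>. of_int (d' \<delta>) *\<^sub>R \<delta>)"
    "(\<forall>\<delta>\<in>\<Delta>. (d' \<delta>::int) \<ge> 0) \<or> (\<forall>\<delta>\<in>\<Delta>. d' \<delta> \<le> 0)" using root_expansion rR by blast
  ultimately have "d' \<epsilon> = c \<epsilon>" using expansion_unique[of d' c' \<epsilon>] e by (simp add: c'_def)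
  then have "\<forall>\<delta>\<in>\<Delta>. d' \<delta> \<ge> 0" using d'(2) e by fastforce
  with d'(1) rR show ?thesis unfolding pos_roots_def by blast
qed

text \<open>Otherwise \<beta> \<bullet> \<beta>, a nonnegative combination of the numbers \<delta>
  \<bullet> \<beta>, would not be positive.\<close>

lemma exists_simple_inner_pos:
  assumes "\<beta> \<in> P" shows "\<exists>\<delta>\<in>\<Delta>. coroot \<delta> \<bullet> \<beta> > 0"
proof (rule ccontr)
  assume neg: "\<not> ?thesis"
  obtain c where c: "\<beta> = (\<Sum>\<delta>\<in>\<Delta>. of_int (c \<delta>) *\<^sub>R \<delta>)" "\<forall>\<delta>\<in>\<Delta>. (c \<delta>::int) \<ge> 0"
    using assms unfolding pos_roots_def by blast
  have "\<delta> \<bullet> \<beta> \<le> 0" if "\<delta> \<in> \<Delta>" for \<delta>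
  proof (rule ccontr)
    assume "\<not> \<delta> \<bullet> \<beta> \<le> 0"
    moreover have "\<delta> \<noteq> 0" using that simple_root root_nz by blast
    ultimately have "coroot \<delta> \<bullet> \<beta> > 0" by (simp add: coroot_def)
    with neg that show False by blast
  qed
  then have "(\<Sum>\<delta>\<in>\<Delta>. of_int (c \<delta>) * (\<delta> \<bullet> \<beta>)) \<le> 0"
    using c(2) by (intro sum_nonpos) (simp add: mult_nonneg_nonpos)
  moreover have "\<beta> \<bullet> \<beta> = (\<Sum>\<delta>\<in>\<Delta>. of_int (c \<delta>) * (\<delta> \<bullet> \<beta>))"
    using arg_cong[OF c(1), of "\<lambda>x. x \<bullet> \<beta>"] by (simp only: inner_sum_left inner_scaleR_left)
  moreover have "\<beta> \<noteq> 0" using assms pos_is_root root_nz by blast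
  ultimately show False by (metis inner_gt_zero_iff not_less)
qed

text \<open>Induction on the height: a simple reflection lowers \<beta> to a smaller positive root,
  and conjugating by it turns a word for the smaller reflection into one for
  \<open>refl \<beta>\<close>.\<close>

lemma refl_simple_word:
  assumes "\<beta> \<in> P" shows "\<exists>as. set as \<subseteq> \<Delta> \<and> refl \<beta> = refl_prod as"
  using assms
proof (induction "nat \<lfloor>ht \<beta>\<rfloor>" arbitrary: \<beta> rule: less_induct)
  case less
  show ?case
  proof (cases "\<beta> \<in> \<Delta>")
    case True then show ?thesis by (intro exI[of _ "[\<beta>]"]) auto
  next
    case False
    obtain \<delta> where d: "\<delta> \<in> \<Delta>" "coroot \<delta> \<bullet> \<beta> > 0" using exists_simple_inner_pos less.prems by blast
    obtain n where n: "coroot \<delta> \<bullet> \<beta> = of_int n"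
      using coroot_int[OF simple_root[OF d(1)] pos_is_root[OF less.prems]] Ints_cases by blast
    let ?g = "refl \<delta> \<beta>"
    have g: "?g \<in> P" using refl_simple_pos d less.prems False by blast
    have "ht ?g = ht \<beta> - of_int n" by (simp add: refl_coroot n ht_diff ht_scale ht_simple d)
    moreover have "n > 0" using d n by simp
    moreover have "ht ?g > 0" using g pos_root_iff by blast
    ultimately have "nat \<lfloor>ht ?g\<rfloor> < nat \<lfloor>ht \<beta>\<rfloor>" by linarith
    from less.hyps[OF this g] obtain as where as: "set as \<subseteq> \<Delta>" "refl ?g = refl_prod as" by blast
    have "refl \<beta> \<circ> refl \<delta> = refl \<delta> \<circ> refl ?g"
      using refl_weyl_conj[OF refl_weyl[OF simple_root[OF d(1)]], of ?g] by (simp add: refl_refl)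
    then have "refl \<beta> = refl \<delta> \<circ> refl ?g \<circ> refl \<delta>"
      by (metis comp_assoc comp_id refl_comp_refl)
    also have "\<dots> = refl_prod ([\<delta>] @ as @ [\<delta>])" by (simp add: as refl_prod_append comp_assoc)
    finally show ?thesis using d as by (intro exI[of _ "[\<delta>] @ as @ [\<delta>]"]) auto
  qed
qed

lemma weyl_simple_word:
  assumes "w \<in> W" shows "\<exists>as. set as \<subseteq> \<Delta> \<and> w = refl_prod as"
proof -
  have "set as \<subseteq> \<Phi> \<Longrightarrow> \<exists>bs. set bs \<subseteq> \<Delta> \<and> refl_prod as = refl_prod bs" for as
  proof (induction as)
    case Nil then show ?case by (intro exI[of _ "[]"]) auto
  next
    case (Cons a as)
    then obtain bs where bs: "set bs \<subseteq> \<Delta>" "refl_prod as = refl_prod bs" by auto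
    have "a \<in> P \<or> - a \<in> P" using Cons.prems minus_pos_iff[of a] by auto
    then obtain cs where cs: "set cs \<subseteq> \<Delta>" "refl a = refl_prod cs"
      using refl_simple_word[of a] refl_simple_word[of "-a"] refl_minus_root[of a] by auto
    show ?case using bs cs by (intro exI[of _ "cs @ bs"]) (auto simp: refl_prod_append)
  qed
  with assms show ?thesis by (auto elim!: weyl_refl_prodE)
qed


section \<open>Inversion sets and the integers attached to them\<close>

lemma refl_root_self: "\<alpha> \<in> \<Phi> \<Longrightarrow> refl \<alpha> \<alpha> = - \<alpha>"
  using refl_self[of \<alpha>] root_nz by blast

text \<open>The floor is exact on roots; integer values keep the later sums within linear integer
  arithmetic.\<close>

definition cpair :: "'a \<Rightarrow> 'a \<Rightarrow> int" where "cpair \<alpha> \<beta> = \<lfloor>coroot \<alpha> \<bullet> \<beta>\<rfloor>"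

definition root_sign :: "'a \<Rightarrow> int" where "root_sign \<beta> = 2 * pind \<beta> - 1"

text \<open>This is the Coxeter length (\<open>wlen_inversions\<close>), in a form that can be
  summed root by root.\<close>

definition inversions :: "('a \<Rightarrow> 'a) \<Rightarrow> int" where "inversions w = (\<Sum>\<beta>\<in>P. 1 - pind (w \<beta>))"

definition inversion_roots :: "'a \<Rightarrow> 'a set" where "inversion_roots \<eta> = {\<beta>\<in>P. refl \<eta> \<beta> \<notin> P}"

text \<open>The integer by which quantum edges are defined: the pairing of the coroot of \<eta> with
  2\<rho>, see \<open>rho_height_rho2\<close>.\<close>

definition rho_height :: "'a \<Rightarrow> int" where "rho_height \<eta> = (\<Sum>\<beta>\<in>P. cpair \<eta> \<beta>)"

text \<open>At least \<open>1\<close> on every \<open>u \<in> W\<close> and positive \<open>\<beta>\<close>, with equality exactly on the edges of the quantum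
  Bruhat graph; this treats Bruhat and quantum edges uniformly.\<close>

definition edge_excess :: "('a \<Rightarrow> 'a) \<Rightarrow> 'a \<Rightarrow> int" where
  "edge_excess u \<beta> = inversions (u \<circ> refl \<beta>) - inversions u + pind (- u \<beta>) * rho_height \<beta>"

lemma of_int_cpair: "\<alpha> \<in> \<Phi> \<Longrightarrow> \<beta> \<in> \<Phi> \<Longrightarrow> of_int (cpair \<alpha> \<beta>) = coroot \<alpha> \<bullet> \<beta>"
  unfolding cpair_def using coroot_int of_int_floor by (metis Ints_cases floor_of_int)

lemma refl_cpair: "\<alpha> \<in> \<Phi> \<Longrightarrow> \<beta> \<in> \<Phi> \<Longrightarrow> refl \<alpha> \<beta> = \<beta> - of_int (cpair \<alpha> \<beta>) *\<^sub>R \<alpha>"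
  by (simp add: refl_coroot of_int_cpair)

lemma cpair_self: "\<alpha> \<in> \<Phi> \<Longrightarrow> cpair \<alpha> \<alpha> = 2"
  using root_nz coroot_inner_self[of \<alpha>] unfolding cpair_def by fastforce

lemma cpair_minus_right: "\<alpha> \<in> \<Phi> \<Longrightarrow> \<beta> \<in> \<Phi> \<Longrightarrow> cpair \<alpha> (- \<beta>) = - cpair \<alpha> \<beta>"
  using of_int_cpair[of \<alpha> \<beta>] of_int_cpair[of \<alpha> "-\<beta>"] minus_root by (simp flip: of_int_minus)

lemma cpair_minus_left: "\<alpha> \<in> \<Phi> \<Longrightarrow> \<beta> \<in> \<Phi> \<Longrightarrow> cpair (- \<alpha>) \<beta> = - cpair \<alpha> \<beta>"
  using of_int_cpair[of \<alpha> \<beta>] of_int_cpair[of "-\<alpha>" \<beta>] minus_root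
  by (simp add: coroot_minus flip: of_int_minus)

lemma cpair_weyl: "w \<in> W \<Longrightarrow> cpair (w \<alpha>) (w \<beta>) = cpair \<alpha> \<beta>"
  by (simp add: cpair_def coroot_weyl inner_weyl)

lemma root_sign_minus: "\<beta> \<in> \<Phi> \<Longrightarrow> root_sign (- \<beta>) = - root_sign \<beta>"
  by (simp add: root_sign_def pind_minus)

lemma root_sign_pos: "\<beta> \<in> P \<Longrightarrow> root_sign \<beta> = 1"
  by (simp add: root_sign_def posind_def)

lemma root_sign_neg: "\<beta> \<notin> P \<Longrightarrow> root_sign \<beta> = -1"
  by (simp add: root_sign_def posind_def)

lemma roots_split: "\<Phi> = P \<union> uminus ` P" "P \<inter> uminus ` P = {}"
proof -
  show "\<Phi> = P \<union> uminus ` P"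
  proof (intro equalityI subsetI)
    fix x assume "x \<in> \<Phi>"
    then show "x \<in> P \<union> uminus ` P"
      using minus_pos_iff[of x] by (metis UnI1 UnI2 image_eqI minus_minus)
  qed (auto simp: pos_is_root minus_root)
  show "P \<inter> uminus ` P = {}" using minus_pos_iff pos_is_root by auto
qed

lemma sum_roots:
  fixes h :: "'a \<Rightarrow> 'b::comm_monoid_add"
  shows "(\<Sum>\<gamma>\<in>\<Phi>. h \<gamma>) = (\<Sum>\<beta>\<in>P. h \<beta> + h (- \<beta>))"
proof -
  have "(\<Sum>\<gamma>\<in>\<Phi>. h \<gamma>) = (\<Sum>\<beta>\<in>P. h \<beta>) + (\<Sum>\<beta>\<in>uminus ` P. h \<beta>)"
    by (subst roots_split(1), rule sum.union_disjoint) (auto simp: fin_pos roots_split(2))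
  also have "(\<Sum>\<beta>\<in>uminus ` P. h \<beta>) = (\<Sum>\<beta>\<in>P. h (- \<beta>))"
    by (simp add: sum.reindex)
  finally show ?thesis by (simp add: sum.distrib)
qed

lemma sum_roots_weyl:
  assumes "w \<in> W" shows "(\<Sum>\<gamma>\<in>\<Phi>. h (w \<gamma>)) = (\<Sum>\<gamma>\<in>\<Phi>. h \<gamma>)"
  by (rule sum.reindex_bij_witness[where i = "inv w" and j = w])
     (auto simp: assms weyl_inv_app weyl_root inv_weyl)

section \<open>Inversions and the quantum Bruhat graph\<close>

text \<open>For an even function the sum over positive roots is half the sum over all roots, and W
  permutes the latter.\<close>

lemma sum_pos_even:
  fixes h :: "'a \<Rightarrow> int"
  assumes w: "w \<in> W" and even: "\<And>\<gamma>. \<gamma> \<in> \<Phi> \<Longrightarrow> h (- \<gamma>) = h \<gamma>"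
  shows "(\<Sum>\<beta>\<in>P. h (w \<beta>)) = (\<Sum>\<beta>\<in>P. h \<beta>)"
proof -
  have "2 * (\<Sum>\<beta>\<in>P. h (w \<beta>)) = (\<Sum>\<beta>\<in>P. h (w \<beta>) + h (w (- \<beta>)))"
    unfolding sum_distrib_left
    by (rule sum.cong) (simp_all add: w even weyl_minus weyl_root pos_is_root)
  also have "\<dots> = (\<Sum>\<beta>\<in>P. h \<beta> + h (- \<beta>))"
    using sum_roots_weyl[OF w, of h] by (simp add: sum_roots)
  also have "\<dots> = 2 * (\<Sum>\<beta>\<in>P. h \<beta>)"
    unfolding sum_distrib_left by (rule sum.cong) (simp_all add: even pos_is_root)
  finally show ?thesis by simp
qed

text \<open>Multiplying an odd function by a sign that is odd too makes it even, so that the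
  invariance of even sums applies.\<close>

lemma sum_pos_odd:
  fixes g :: "'a \<Rightarrow> int"
  assumes t: "t \<in> W" and odd: "\<And>\<gamma>. \<gamma> \<in> \<Phi> \<Longrightarrow> g (- \<gamma>) = - g \<gamma>"
  shows "(\<Sum>\<beta>\<in>P. g (t \<beta>)) = (\<Sum>\<beta>\<in>P. root_sign (inv t \<beta>) * g \<beta>)"
proof -
  have "(\<Sum>\<beta>\<in>P. g (t \<beta>)) = (\<Sum>\<beta>\<in>P. root_sign (inv t (t \<beta>)) * g (t \<beta>))"
    by (rule sum.cong) (simp_all add: t weyl_inv_app root_sign_pos)
  also have "\<dots> = (\<Sum>\<beta>\<in>P. root_sign (inv t \<beta>) * g \<beta>)"
    by (rule sum_pos_even[OF t, of "\<lambda>\<beta>. root_sign (inv t \<beta>) * g \<beta>"])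
       (simp add: odd weyl_minus inv_weyl t root_sign_minus weyl_root)
  finally show ?thesis .
qed

text \<open>The sign in \<open>sum_pos_odd\<close> is -1 exactly on
  \<open>inversion_roots \<eta>\<close>. This formula yields both the change of
  \<open>inversions\<close> and the value of \<open>rho_height\<close>.\<close>

lemma sum_pos_refl:
  fixes g :: "'a \<Rightarrow> int"
  assumes u: "u \<in> W" and eta: "\<eta> \<in> \<Phi>" and odd: "\<And>\<gamma>. \<gamma> \<in> \<Phi> \<Longrightarrow> g (- \<gamma>) = - g \<gamma>"
  shows "(\<Sum>\<beta>\<in>P. g (u (refl \<eta> \<beta>))) = (\<Sum>\<beta>\<in>P. g (u \<beta>)) - 2 * (\<Sum>\<beta>\<in>inversion_roots \<eta>. g (u \<beta>))"
proof -
  have "(\<Sum>\<beta>\<in>P. g (u (refl \<eta> \<beta>))) = (\<Sum>\<beta>\<in>P. root_sign (refl \<eta> \<beta>) * g (u \<beta>))"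
    using sum_pos_odd[OF refl_weyl[OF eta], of "\<lambda>\<beta>. g (u \<beta>)"]
    by (simp add: u weyl_minus odd weyl_root inv_refl)
  also have "\<dots> = (\<Sum>\<beta>\<in>P. g (u \<beta>) - 2 * (if refl \<eta> \<beta> \<notin> P then g (u \<beta>) else 0))"
    by (rule sum.cong) (auto simp: root_sign_pos root_sign_neg)
  also have "\<dots> = (\<Sum>\<beta>\<in>P. g (u \<beta>)) - 2 * (\<Sum>\<beta>\<in>P. if refl \<eta> \<beta> \<notin> P then g (u \<beta>) else 0)"
    by (simp add: sum_subtractf sum_distrib_left)
  also have "(\<Sum>\<beta>\<in>P. if refl \<eta> \<beta> \<notin> P then g (u \<beta>) else 0) = (\<Sum>\<beta>\<in>inversion_roots \<eta>. g (u \<beta>))"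
    unfolding inversion_roots_def by (rule sum.inter_filter[symmetric, OF fin_pos])
  finally show ?thesis .
qed

lemma inversions_root_sign: "2 * inversions w = (\<Sum>\<beta>\<in>P. 1 - root_sign (w \<beta>))"
  unfolding inversions_def sum_distrib_left by (rule sum.cong) (simp_all add: root_sign_def)

lemma inversions_refl:
  assumes "u \<in> W" "\<eta> \<in> \<Phi>"
  shows "inversions (u \<circ> refl \<eta>) = inversions u + (\<Sum>\<beta>\<in>inversion_roots \<eta>. root_sign (u \<beta>))"
proof -
  have "2 * inversions (u \<circ> refl \<eta>) = (\<Sum>\<beta>\<in>P. 1) - (\<Sum>\<beta>\<in>P. root_sign (u (refl \<eta> \<beta>)))"
    unfolding inversions_root_sign by (simp add: sum_subtractf)
  also have "\<dots> = (\<Sum>\<beta>\<in>P. 1) - (\<Sum>\<beta>\<in>P. root_sign (u \<beta>)) + 2 * (\<Sum>\<beta>\<in>inversion_roots \<eta>. root_sign (u \<beta>))"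
    using sum_pos_refl[OF assms, of root_sign] by (simp add: root_sign_minus)
  also have "\<dots> = 2 * inversions u + 2 * (\<Sum>\<beta>\<in>inversion_roots \<eta>. root_sign (u \<beta>))"
    unfolding inversions_root_sign by (simp add: sum_subtractf)
  finally show ?thesis by simp
qed

lemma fin_inversion_roots: "finite (inversion_roots \<eta>)" unfolding inversion_roots_def using fin_pos by simp

lemma inversion_roots_self: "\<eta> \<in> P \<Longrightarrow> \<eta> \<in> inversion_roots \<eta>"
  unfolding inversion_roots_def using pos_is_root[of \<eta>] minus_pos_iff[of \<eta>] by (simp add: refl_root_self)

text \<open>Subtracting a multiple of the positive root \<eta> can make the height negative only if
  the multiple is positive.\<close>

lemma inversion_roots_cpair_pos:
  assumes "\<eta> \<in> P" "\<beta> \<in> inversion_roots \<eta>" shows "cpair \<eta> \<beta> > 0"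
proof -
  have b: "\<beta> \<in> P" "refl \<eta> \<beta> \<notin> P" using assms(2) unfolding inversion_roots_def by auto
  have "refl \<eta> \<beta> \<in> \<Phi>" using refl_root pos_is_root assms b by blast
  then have "ht (refl \<eta> \<beta>) \<le> 0" using b(2) pos_root_iff by force
  then have "ht \<beta> \<le> of_int (cpair \<eta> \<beta>) * ht \<eta>"
    using assms b by (simp add: refl_cpair pos_is_root ht_diff ht_scale)
  moreover have "ht \<beta> > 0" "ht \<eta> > 0" using b assms pos_root_iff by auto
  ultimately have "of_int (cpair \<eta> \<beta>) * ht \<eta> > 0" by linarith
  then show ?thesis using \<open>ht \<eta> > 0\<close> by (simp add: zero_less_mult_iff)
qed

text \<open>The reflection in \<eta> negates \<open>cpair \<eta>\<close>, so
  \<open>sum_pos_refl\<close> compares \<open>rho_height \<eta>\<close> with its own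
  negative.\<close>

lemma rho_height_inversion_roots: assumes "\<eta> \<in> P" shows "rho_height \<eta> = (\<Sum>\<beta>\<in>inversion_roots \<eta>. cpair \<eta> \<beta>)"
proof -
  have e: "\<eta> \<in> \<Phi>" using assms pos_is_root by auto
  have "(\<Sum>\<beta>\<in>P. cpair \<eta> (refl \<eta> \<beta>)) = rho_height \<eta> - 2 * (\<Sum>\<beta>\<in>inversion_roots \<eta>. cpair \<eta> \<beta>)"
    using sum_pos_refl[OF id_weyl e, of "cpair \<eta>"] e by (simp add: cpair_minus_right rho_height_def)
  moreover have "(\<Sum>\<beta>\<in>P. cpair \<eta> (refl \<eta> \<beta>)) = (\<Sum>\<beta>\<in>P. - cpair \<eta> \<beta>)"
  proof (rule sum.cong)
    fix \<beta> assume "\<beta> \<in> P"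
    then have b: "\<beta> \<in> \<Phi>" using pos_is_root by auto
    have "cpair \<eta> (refl \<eta> \<beta>) = cpair (refl \<eta> \<eta>) (refl \<eta> (refl \<eta> \<beta>))"
      by (simp add: cpair_weyl refl_weyl e)
    also have "\<dots> = cpair (- \<eta>) \<beta>" using e by (simp add: refl_refl refl_root_self)
    finally show "cpair \<eta> (refl \<eta> \<beta>) = - cpair \<eta> \<beta>" by (simp add: cpair_minus_left e b)
  qed simp
  ultimately show ?thesis unfolding rho_height_def by (simp add: sum_negf)
qed

text \<open>Every summand of \<open>rho_height \<eta>\<close> over the inversions is at least 1, and
  \<eta> itself contributes 2. The strictness is what bounds \<open>edge_excess\<close> below by 1
  when \<open>u \<beta>\<close> is negative.\<close>

lemma card_inversion_roots_less_rho_height: assumes "\<eta> \<in> P" shows "int (card (inversion_roots \<eta>)) < rho_height \<eta>"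
proof -
  have "int (card (inversion_roots \<eta>)) = (\<Sum>\<beta>\<in>inversion_roots \<eta>. 1)" by simp
  also have "\<dots> < (\<Sum>\<beta>\<in>inversion_roots \<eta>. cpair \<eta> \<beta>)"
  proof (rule sum_strict_mono_ex1[OF fin_inversion_roots])
    show "\<forall>x\<in>inversion_roots \<eta>. 1 \<le> cpair \<eta> x" using inversion_roots_cpair_pos[OF assms] by force
    show "\<exists>a\<in>inversion_roots \<eta>. 1 < cpair \<eta> a"
      using inversion_roots_self[OF assms] cpair_self[OF pos_is_root[OF assms]] by (intro bexI[of _ \<eta>]) auto
  qed
  finally show ?thesis by (simp add: rho_height_inversion_roots assms)
qed

lemma rho_height_ge_2: assumes "\<eta> \<in> P" shows "rho_height \<eta> \<ge> 2"
proof -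
  have "card (inversion_roots \<eta>) > 0" using inversion_roots_self[OF assms] fin_inversion_roots card_gt_0_iff by blast
  then show ?thesis using card_inversion_roots_less_rho_height[OF assms] by linarith
qed

lemma inversions_refl_bound:
  assumes "u \<in> W" "\<eta> \<in> P" shows "inversions (u \<circ> refl \<eta>) > inversions u - rho_height \<eta>"
proof -
  have "(\<Sum>\<beta>\<in>inversion_roots \<eta>. root_sign (u \<beta>)) \<ge> (\<Sum>\<beta>\<in>inversion_roots \<eta>. -1)"
    by (rule sum_mono) (simp add: root_sign_def posind_def)
  then show ?thesis using card_inversion_roots_less_rho_height[OF assms(2)] inversions_refl[OF assms(1) pos_is_root[OF assms(2)]]
    by simp
qed

text \<open>The involution sending \<beta> to \<open>- refl \<eta> \<beta>\<close> pairs up the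
  inversions of the reflection. The \<open>u\<close>-images of a pair add up to a positive multiple
  of \<open>u \<eta>\<close>, so at least one is positive and the signs of a pair have nonnegative
  sum; the fixed root \<eta> makes the total positive.\<close>

lemma inversions_refl_less:
  assumes u: "u \<in> W" and eta: "\<eta> \<in> P" and pos: "u \<eta> \<in> P"
  shows "inversions u < inversions (u \<circ> refl \<eta>)"
proof -
  have eR: "\<eta> \<in> \<Phi>" using eta pos_is_root by auto
  let ?f = "\<lambda>\<beta>. - refl \<eta> \<beta>"
  have ff: "?f (?f \<beta>) = \<beta>" for \<beta> using linear_neg[OF linear_refl, of \<eta>] by (simp add: refl_refl)
  have fI: "?f \<beta> \<in> inversion_roots \<eta>" if "\<beta> \<in> inversion_roots \<eta>" for \<beta>
  proof -
    have b: "\<beta> \<in> P" "refl \<eta> \<beta> \<notin> P" "\<beta> \<in> \<Phi>" using that pos_is_root unfolding inversion_roots_def by auto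
    then have "refl \<eta> \<beta> \<in> \<Phi>" using refl_root eR by blast
    then have "?f \<beta> \<in> P" using b minus_pos_iff by blast
    moreover have "refl \<eta> (?f \<beta>) = - \<beta>" using ff[of \<beta>] by (metis minus_minus)
    moreover have "- \<beta> \<notin> P" using b minus_pos_iff by blast
    ultimately show ?thesis unfolding inversion_roots_def by simp
  qed
  have "(\<Sum>\<beta>\<in>inversion_roots \<eta>. root_sign (u (?f \<beta>))) = (\<Sum>\<beta>\<in>inversion_roots \<eta>. root_sign (u \<beta>))"
    by (rule sum.reindex_bij_witness[where i = ?f and j = ?f]) (auto simp: fI ff)
  then have "2 * (\<Sum>\<beta>\<in>inversion_roots \<eta>. root_sign (u \<beta>)) = (\<Sum>\<beta>\<in>inversion_roots \<eta>. root_sign (u \<beta>) + root_sign (u (?f \<beta>)))"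
    by (simp add: sum.distrib)
  also have "\<dots> > 0"
  proof (rule sum_pos2[OF fin_inversion_roots inversion_roots_self[OF eta]])
    have "\<eta> \<noteq> 0" using eR root_nz by auto
    then show "0 < root_sign (u \<eta>) + root_sign (u (?f \<eta>))" using pos by (simp add: refl_self root_sign_pos)
  next
    fix \<beta> assume bI: "\<beta> \<in> inversion_roots \<eta>"
    then have b: "\<beta> \<in> \<Phi>" using pos_is_root unfolding inversion_roots_def by auto
    have "u \<beta> + u (?f \<beta>) = u (of_int (cpair \<eta> \<beta>) *\<^sub>R \<eta>)"
      using linear_add[OF linear_weyl[OF u], of \<beta> "?f \<beta>"] by (simp add: refl_cpair eR b)
    also have "\<dots> = of_int (cpair \<eta> \<beta>) *\<^sub>R u \<eta>" by (simp add: linear_cmul[OF linear_weyl[OF u]])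
    finally have "ht (u \<beta>) + ht (u (?f \<beta>)) = of_int (cpair \<eta> \<beta>) * ht (u \<eta>)"
      by (metis ht_add ht_scale)
    moreover have "of_int (cpair \<eta> \<beta>) * ht (u \<eta>) > 0"
      using inversion_roots_cpair_pos[OF eta bI] pos pos_root_iff by simp
    ultimately have "ht (u \<beta>) > 0 \<or> ht (u (?f \<beta>)) > 0" by linarith
    moreover have "u \<beta> \<in> \<Phi>" "u (?f \<beta>) \<in> \<Phi>"
      using weyl_root[OF u] b refl_root[OF eR b] minus_root by auto
    ultimately have "u \<beta> \<in> P \<or> u (?f \<beta>) \<in> P" using pos_root_iff by blast
    then show "0 \<le> root_sign (u \<beta>) + root_sign (u (?f \<beta>))"
      by (cases "u \<beta> \<in> P"; cases "u (?f \<beta>) \<in> P") (auto simp: root_sign_pos root_sign_neg)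
  qed
  finally show ?thesis using inversions_refl[OF u eR] by simp
qed

lemma edge_excess_ge_1:
  assumes "u \<in> W" "\<beta> \<in> P" shows "edge_excess u \<beta> \<ge> 1"
proof (cases "u \<beta> \<in> P")
  case True
  then show ?thesis using inversions_refl_less[OF assms] minus_pos_iff[of "u \<beta>"] pos_is_root
    unfolding edge_excess_def posind_def by simp
next
  case False
  moreover have "u \<beta> \<in> \<Phi>" using weyl_root assms pos_is_root by blast
  ultimately have "- u \<beta> \<in> P" using minus_pos_iff by blast
  then show ?thesis using inversions_refl_bound[OF assms]
    unfolding edge_excess_def posind_def by simp
qed

lemma inversion_roots_simple: "\<delta> \<in> \<Delta> \<Longrightarrow> inversion_roots \<delta> = {\<delta>}"
  using inversion_roots_self[OF simple_pos, of \<delta>] refl_simple_pos unfolding inversion_roots_def by blast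

lemma inversions_refl_simple:
  "u \<in> W \<Longrightarrow> \<delta> \<in> \<Delta> \<Longrightarrow> inversions (u \<circ> refl \<delta>) = inversions u + root_sign (u \<delta>)"
  by (simp add: inversions_refl simple_root inversion_roots_simple)

lemma rho_height_simple: "\<delta> \<in> \<Delta> \<Longrightarrow> rho_height \<delta> = 2"
  by (simp add: rho_height_inversion_roots simple_pos inversion_roots_simple cpair_self simple_root)

text \<open>The exchange condition. When \<eta> is moved through the word from the right, the letter
  that turns it negative must equal its current image, and this letter can be struck out.\<close>

lemma word_exchange:
  assumes "set bs \<subseteq> \<Delta>" "\<eta> \<in> P" "refl_prod bs \<eta> \<notin> P"
  shows "\<exists>cs. set cs \<subseteq> \<Delta> \<and> Suc (length cs) = length bs \<and> refl_prod cs = refl_prod bs \<circ> refl \<eta>"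
  using assms
proof (induction bs)
  case Nil then show ?case by simp
next
  case (Cons b bs)
  let ?w = "refl_prod bs"
  have w: "?w \<in> W" using Cons.prems(1) simple_root by (intro weylI) auto
  show ?case
  proof (cases "?w \<eta> \<in> P")
    case False
    then obtain cs where "set cs \<subseteq> \<Delta>" "Suc (length cs) = length bs" "refl_prod cs = ?w \<circ> refl \<eta>"
      using Cons.IH[OF _ Cons.prems(2) False] Cons.prems(1) by force
    then show ?thesis using Cons.prems(1)
      by (intro exI[of _ "b # cs"]) (simp add: comp_assoc)
  next
    case True
    then have "?w \<eta> = b" using refl_simple_pos[of b "?w \<eta>"] Cons.prems by auto
    then have "refl b \<circ> ?w = ?w \<circ> refl \<eta>" using refl_weyl_conj[OF w, of \<eta>] by simp
    then have "refl b \<circ> ?w \<circ> refl \<eta> = ?w" by (metis comp_assoc comp_id refl_comp_refl)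
    then have "refl_prod bs = refl_prod (b # bs) \<circ> refl \<eta>" by (simp only: refl_prod.simps)
    then show ?thesis using Cons.prems(1) by (intro exI[of _ bs]) (simp del: refl_prod.simps)
  qed
qed

text \<open>Letters are added at the right end. If the number of inversions goes up, the short word
  is extended; if it goes down, the exchange condition shortens it.\<close>

lemma simple_word_inversions:
  assumes "set as \<subseteq> \<Delta>"
  shows "\<exists>bs. set bs \<subseteq> \<Delta> \<and> refl_prod bs = refl_prod as \<and> int (length bs) = inversions (refl_prod as)"
    and "inversions (refl_prod as) \<le> int (length as)"
proof -
  have "(\<exists>bs. set bs \<subseteq> \<Delta> \<and> refl_prod bs = refl_prod as \<and> int (length bs) = inversions (refl_prod as))
    \<and> inversions (refl_prod as) \<le> int (length as)"
    using assms
  proof (induction as rule: rev_induct)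
    case Nil
    have "inversions (refl_prod []) = 0" unfolding inversions_def by (simp add: posind_def)
    then show ?case by (intro conjI exI[of _ "[]"]) (simp_all del: refl_prod.simps)
  next
    case (snoc a as)
    then obtain bs where bs: "set bs \<subseteq> \<Delta>" "refl_prod bs = refl_prod as"
      "int (length bs) = inversions (refl_prod as)" and le: "inversions (refl_prod as) \<le> int (length as)" by auto
    have a: "a \<in> \<Delta>" using snoc.prems by simp
    have w: "refl_prod as \<in> W" using snoc.prems simple_root by (intro weylI) auto
    have eq: "refl_prod (as @ [a]) = refl_prod as \<circ> refl a" by (simp add: refl_prod_append)
    have inv: "inversions (refl_prod (as @ [a])) = inversions (refl_prod as) + root_sign (refl_prod as a)"
      unfolding eq using inversions_refl_simple[OF w a] .
    show ?case
    proof (cases "refl_prod as a \<in> P")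
      case True
      moreover have "refl_prod (bs @ [a]) = refl_prod (as @ [a])" by (simp only: refl_prod_append bs(2))
      ultimately show ?thesis using inv bs a le root_sign_pos[OF True]
        by (intro conjI exI[of _ "bs @ [a]"]) (simp_all del: refl_prod.simps)
    next
      case False
      then obtain cs where cs: "set cs \<subseteq> \<Delta>" "Suc (length cs) = length bs" "refl_prod cs = refl_prod bs \<circ> refl a"
        using word_exchange[OF bs(1) simple_pos[OF a]] bs(2) by auto
      have "refl_prod cs = refl_prod (as @ [a])" by (simp only: eq cs(3) bs(2))
      moreover have "int (length cs) = inversions (refl_prod (as @ [a]))"
        using inv bs(3) cs(2) root_sign_neg[OF False] by linarith
      moreover have "inversions (refl_prod (as @ [a])) \<le> int (length (as @ [a]))"
        using inv le root_sign_neg[OF False] by simp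
      ultimately show ?thesis using cs(1) by blast
    qed
  qed
  then show "\<exists>bs. set bs \<subseteq> \<Delta> \<and> refl_prod bs = refl_prod as \<and> int (length bs) = inversions (refl_prod as)"
    "inversions (refl_prod as) \<le> int (length as)" by blast+
qed

lemma wlen_inversions: assumes "w \<in> W" shows "int (wlen \<Delta> w) = inversions w"
proof -
  obtain as where as: "set as \<subseteq> \<Delta>" "w = refl_prod as" using weyl_simple_word[OF assms] by blast
  obtain bs where bs: "set bs \<subseteq> \<Delta>" "refl_prod bs = w" "int (length bs) = inversions w"
    using simple_word_inversions(1)[OF as(1)] as(2) by auto
  have "wlen \<Delta> w = length bs" unfolding wlen_def
  proof (rule Least_equality)
    show "\<exists>as. set as \<subseteq> \<Delta> \<and> length as = length bs \<and> w = refl_prod as" using bs by blast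
  next
    fix n assume "\<exists>as. set as \<subseteq> \<Delta> \<and> length as = n \<and> w = refl_prod as"
    then show "length bs \<le> n" using simple_word_inversions(2) bs(3) by fastforce
  qed
  then show ?thesis using bs by simp
qed

lemma rho_height_rho2: assumes "\<eta> \<in> \<Phi>" shows "coroot \<eta> \<bullet> rho2 \<Phi> \<Delta> = of_int (rho_height \<eta>)"
  unfolding rho2_def rho_height_def inner_sum_right of_int_sum
  by (rule sum.cong) (simp_all add: of_int_cpair assms pos_is_root)

text \<open>The sign of \<open>u \<beta>\<close> decides whether \<open>inversions\<close> rises or
  falls. Since \<open>rho_height \<beta>\<close> is at least 2, a quantum edge must fall and a
  Bruhat edge must rise, so one equation with the weight term switched by that sign describes
  both.\<close>

lemma qb_edge_iff:
  assumes u: "u \<in> W" and b: "\<beta> \<in> P"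
  shows "qb_bruhat_edge \<Phi> \<Delta> u \<beta> \<or> qb_quantum_edge \<Phi> \<Delta> u \<beta> \<longleftrightarrow> edge_excess u \<beta> = 1"
    and "qb_quantum_edge \<Phi> \<Delta> u \<beta> \<Longrightarrow> u \<beta> \<notin> P"
    and "qb_bruhat_edge \<Phi> \<Delta> u \<beta> \<Longrightarrow> u \<beta> \<in> P"
proof -
  have bR: "\<beta> \<in> \<Phi>" using b pos_is_root by auto
  have us: "u \<circ> refl \<beta> \<in> W" using comp_weyl u refl_weyl bR by blast
  have ubR: "u \<beta> \<in> \<Phi>" using weyl_root u bR by blast
  have B: "qb_bruhat_edge \<Phi> \<Delta> u \<beta> \<longleftrightarrow> inversions (u \<circ> refl \<beta>) = inversions u + 1"
    unfolding qb_bruhat_edge_def using b wlen_inversions[OF u] wlen_inversions[OF us] by auto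
  have "qb_quantum_edge \<Phi> \<Delta> u \<beta> \<longleftrightarrow>
    real_of_int (int (wlen \<Delta> (u \<circ> refl \<beta>))) = real_of_int (int (wlen \<Delta> u) + 1 - rho_height \<beta>)"
    unfolding qb_quantum_edge_def using b by (simp add: rho_height_rho2 bR)
  then have Q: "qb_quantum_edge \<Phi> \<Delta> u \<beta> \<longleftrightarrow> inversions (u \<circ> refl \<beta>) = inversions u + 1 - rho_height \<beta>"
    unfolding wlen_inversions[OF u] wlen_inversions[OF us] by linarith
  have h: "rho_height \<beta> \<ge> 2" using rho_height_ge_2 b by blast
  have pos: "inversions u < inversions (u \<circ> refl \<beta>)" if "u \<beta> \<in> P" using inversions_refl_less u b that by blast
  have neg: "inversions (u \<circ> refl \<beta>) < inversions u" if "u \<beta> \<notin> P"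
  proof -
    have "(u \<circ> refl \<beta>) \<beta> = - u \<beta>" using refl_root_self[OF bR] weyl_minus[OF u] by simp
    also have "\<dots> \<in> P" using that minus_pos_iff ubR by blast
    finally have "inversions (u \<circ> refl \<beta>) < inversions ((u \<circ> refl \<beta>) \<circ> refl \<beta>)"
      using inversions_refl_less us b by blast
    then show ?thesis by (simp add: comp_assoc refl_comp_refl)
  qed
  have p1: "pind (- u \<beta>) = 0" if "u \<beta> \<in> P" using that minus_pos_iff ubR by (simp add: posind_def)
  have p2: "pind (- u \<beta>) = 1" if "u \<beta> \<notin> P" using that minus_pos_iff ubR by (simp add: posind_def)
  show "qb_quantum_edge \<Phi> \<Delta> u \<beta> \<Longrightarrow> u \<beta> \<notin> P" using Q pos h by fastforce
  show "qb_bruhat_edge \<Phi> \<Delta> u \<beta> \<Longrightarrow> u \<beta> \<in> P" using B neg by fastforce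
  show "qb_bruhat_edge \<Phi> \<Delta> u \<beta> \<or> qb_quantum_edge \<Phi> \<Delta> u \<beta> \<longleftrightarrow> edge_excess u \<beta> = 1"
    unfolding edge_excess_def using B Q pos neg p1 p2 h by (cases "u \<beta> \<in> P") auto
qed

lemma qb_path_Cons_iff:
  assumes "u \<in> W"
  shows "qb_path \<Phi> \<Delta> u (\<beta> # as) u' \<longleftrightarrow> \<beta> \<in> P \<and> edge_excess u \<beta> = 1 \<and> qb_path \<Phi> \<Delta> (u \<circ> refl \<beta>) as u'"
  using qb_edge_iff(1)[OF assms, of \<beta>]
  by (auto simp: qb_bruhat_edge_def qb_quantum_edge_def)

lemma qb_pathwt_Cons:
  assumes "u \<in> W" "\<beta> \<in> P" "edge_excess u \<beta> = 1"
  shows "qb_pathwt \<Phi> \<Delta> u (\<beta> # as) = of_int (pind (- u \<beta>)) *\<^sub>R coroot \<beta> + qb_pathwt \<Phi> \<Delta> (u \<circ> refl \<beta>) as"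
proof -
  have "u \<beta> \<in> \<Phi>" using weyl_root assms pos_is_root by blast
  then show ?thesis using qb_edge_iff[OF assms(1,2)] assms(3) minus_pos_iff by (auto simp: posind_def)
qed

lemma qb_path_weyl: "u \<in> W \<Longrightarrow> qb_path \<Phi> \<Delta> u as u' \<Longrightarrow> u' \<in> W"
proof (induction as arbitrary: u)
  case (Cons a as)
  then show ?case using qb_path_Cons_iff[OF Cons.prems(1)] comp_weyl refl_weyl pos_is_root by blast
qed auto

text \<open>Either one inversion is gained, or one is lost and the weight term 2 compensates. Simple
  reflections are therefore edges in both directions, which makes the graph strongly
  connected.\<close>

lemma edge_excess_simple: assumes "u \<in> W" "\<delta> \<in> \<Delta>" shows "edge_excess u \<delta> = 1"
proof -
  have "u \<delta> \<in> \<Phi>" using assms simple_root weyl_root by blast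
  then show ?thesis using assms
    by (simp add: edge_excess_def inversions_refl_simple rho_height_simple pind_minus root_sign_def)
qed

lemma qb_path_exists:
  assumes "u \<in> W" "u' \<in> W" shows "\<exists>as. qb_path \<Phi> \<Delta> u as u'"
proof -
  have "inv u \<circ> u' \<in> W" using assms inv_weyl comp_weyl by blast
  then obtain as where as: "set as \<subseteq> \<Delta>" "inv u \<circ> u' = refl_prod as"
    using weyl_simple_word by blast
  have "qb_path \<Phi> \<Delta> u as (u \<circ> refl_prod as)" using assms(1) as(1)
  proof (induction as arbitrary: u)
    case (Cons a as)
    have "u \<circ> refl a \<in> W" using Cons comp_weyl refl_weyl simple_root by simp
    moreover have "set as \<subseteq> \<Delta>" using Cons.prems by simp
    ultimately have "qb_path \<Phi> \<Delta> (u \<circ> refl a) as (u \<circ> refl a \<circ> refl_prod as)" by (rule Cons.IH)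
    then show ?case using Cons.prems
      by (simp only: qb_path_Cons_iff edge_excess_simple simple_pos refl_prod.simps comp_assoc list.set insert_subset simp_thms)
  qed simp
  moreover have "u \<circ> refl_prod as = u'"
    unfolding as(2)[symmetric] by (simp add: comp_assoc[symmetric] weyl_inv_comp assms)
  ultimately show ?thesis by auto
qed

text \<open>The finite part of a simple affine root \<open>(\<alpha>, k)\<close>: there \<open>k = pind (- \<alpha>)\<close>, and the condition
  says that the length functional \<open>\<ell>(r\<^sub>a, \<cdot>)\<close> vanishes off \<open>\<plusminus>\<alpha>\<close>.\<close>

definition affine_simple :: "'a \<Rightarrow> bool" where
  "affine_simple \<alpha> \<longleftrightarrow> \<alpha> \<in> \<Phi> \<and> (\<forall>\<gamma>\<in>\<Phi>. \<gamma> \<noteq> \<alpha> \<longrightarrow> \<gamma> \<noteq> - \<alpha> \<longrightarrow> pind (- \<alpha>) * cpair \<alpha> \<gamma> + pind \<gamma> = pind (refl \<alpha> \<gamma>))"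

section \<open>Left multiplication by simple affine reflections on the quantum Bruhat graph\<close>

lemma rho_height_minus: "\<eta> \<in> \<Phi> \<Longrightarrow> rho_height (- \<eta>) = - rho_height \<eta>"
  unfolding rho_height_def by (simp add: cpair_minus_left pos_is_root sum_negf[symmetric])

text \<open>The defining condition of \<open>affine_simple\<close> evaluates the change at every
  positive \<beta> whose image under \<open>u\<close> is not \<plusminus>\<alpha>. The only
  exception is \<beta> = \<open>inv u \<alpha>\<close>, which accounts for the additional 1.\<close>

lemma affine_simple_inversions_pos:
  assumes a: "affine_simple \<alpha>" and u: "u \<in> W" and t: "inv u \<alpha> \<in> P"
  shows "inversions (refl \<alpha> \<circ> u) = inversions u + 1 - pind (- \<alpha>) * rho_height (inv u \<alpha>)"
proof -
  have aR: "\<alpha> \<in> \<Phi>" using a affine_simple_def by blast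
  let ?t = "inv u \<alpha>" and ?k = "pind (- \<alpha>)"
  have ut: "u ?t = \<alpha>" using weyl_inv_app u by blast
  have "inversions (refl \<alpha> \<circ> u) - inversions u = (\<Sum>\<beta>\<in>P. pind (u \<beta>) - pind (refl \<alpha> (u \<beta>)))"
    unfolding inversions_def by (simp add: sum_subtractf[symmetric])
  also have "\<dots> = (\<Sum>\<beta>\<in>P. (if \<beta> = ?t then 1 else 0) - ?k * cpair ?t \<beta>)"
  proof (rule sum.cong)
    fix \<beta> assume b: "\<beta> \<in> P"
    have cp: "cpair ?t \<beta> = cpair \<alpha> (u \<beta>)" using cpair_weyl[OF u, of ?t \<beta>] ut by simp
    show "pind (u \<beta>) - pind (refl \<alpha> (u \<beta>)) = (if \<beta> = ?t then 1 else 0) - ?k * cpair ?t \<beta>"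
    proof (cases "\<beta> = ?t")
      case True
      have "u \<beta> = \<alpha>" using True ut by simp
      then show ?thesis unfolding cp using True pind_minus[OF aR] cpair_self[OF aR] refl_root_self[OF aR]
        by simp
    next
      case False
      have "u \<beta> \<in> \<Phi>" using weyl_root u b pos_is_root by blast
      moreover have "u \<beta> \<noteq> \<alpha>" using False ut weyl_eq_iff[OF u] by metis
      moreover have "u \<beta> \<noteq> - \<alpha>"
      proof
        assume "u \<beta> = - \<alpha>"
        then have "u \<beta> = u (- ?t)" using ut weyl_minus[OF u] by simp
        then have "\<beta> = - ?t" using weyl_eq_iff[OF u] by blast
        then show False using b t minus_pos_iff pos_is_root by blast
      qed
      ultimately have "?k * cpair \<alpha> (u \<beta>) + pind (u \<beta>) = pind (refl \<alpha> (u \<beta>))"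
        using a unfolding affine_simple_def by blast
      then show ?thesis using False cp by simp
    qed
  qed simp
  also have "\<dots> = 1 - ?k * rho_height ?t"
    unfolding rho_height_def sum_subtractf sum_distrib_left using t fin_pos by simp
  finally show ?thesis by simp
qed

lemma affine_simple_inversions:
  assumes a: "affine_simple \<alpha>" and u: "u \<in> W"
  shows "inversions (refl \<alpha> \<circ> u) = inversions u + root_sign (inv u \<alpha>) - pind (- \<alpha>) * rho_height (inv u \<alpha>)"
proof (cases "inv u \<alpha> \<in> P")
  case True
  then show ?thesis using affine_simple_inversions_pos[OF assms True] root_sign_pos[OF True] by simp
next
  case False
  have aR: "\<alpha> \<in> \<Phi>" using a affine_simple_def by blast
  let ?t = "inv u \<alpha>" and ?u = "refl \<alpha> \<circ> u"
  have tR: "?t \<in> \<Phi>" using weyl_root inv_weyl u aR by blast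
  have uW: "?u \<in> W" using comp_weyl refl_weyl aR u by blast
  have "inv ?u \<alpha> = inv u (refl \<alpha> \<alpha>)" using inv_comp_weyl[OF refl_weyl[OF aR] u] by (simp add: inv_refl)
  also have "\<dots> = - ?t" by (simp add: refl_root_self aR weyl_minus inv_weyl u)
  finally have e: "inv ?u \<alpha> = - ?t" .
  then have "inv ?u \<alpha> \<in> P" using False minus_pos_iff tR by simp
  from affine_simple_inversions_pos[OF a uW this] show ?thesis
    unfolding e by (simp add: rho_height_minus tR root_sign_neg False comp_assoc[symmetric] refl_comp_refl)
qed

lemma refl_comp_weyl: "u \<in> W \<Longrightarrow> u \<circ> refl (inv u \<alpha>) = refl \<alpha> \<circ> u"
  using refl_weyl_conj[of u "inv u \<alpha>"] by (simp add: weyl_inv_app)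

text \<open>Left multiplication by the reflection in \<alpha> is right multiplication by the one in
  \<open>inv u \<alpha>\<close>, and \<open>u\<close> maps that root back to \<alpha>; so the weight
  term of the excess cancels the correction in the inversion formula.\<close>

lemma affine_simple_edge:
  assumes a: "affine_simple \<alpha>" and u: "u \<in> W" and t: "inv u \<alpha> \<in> P"
  shows "edge_excess u (inv u \<alpha>) = 1"
  unfolding edge_excess_def refl_comp_weyl[OF u] affine_simple_inversions_pos[OF assms] by (simp add: weyl_inv_app u)

lemma rho_height_refl:
  assumes "\<beta> \<in> \<Phi>" "\<tau> \<in> \<Phi>" shows "rho_height (refl \<beta> \<tau>) = rho_height \<tau> - cpair \<tau> \<beta> * rho_height \<beta>"
proof -
  have "coroot (refl \<beta> \<tau>) = refl \<beta> (coroot \<tau>)" using coroot_weyl[OF refl_weyl[OF assms(1)]] .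
  also have "\<dots> = coroot \<tau> - of_int (cpair \<tau> \<beta>) *\<^sub>R coroot \<beta>"
    unfolding of_int_cpair[OF assms(2,1)] by (simp add: refl_def coroot_def)
  finally have "real_of_int (rho_height (refl \<beta> \<tau>)) = of_int (rho_height \<tau> - cpair \<tau> \<beta> * rho_height \<beta>)"
    using rho_height_rho2[OF refl_root[OF assms]] rho_height_rho2[OF assms(1)] rho_height_rho2[OF assms(2)]
    by (simp add: inner_diff_left)
  then show ?thesis by linarith
qed

lemma inv_comp_refl_app: "v \<in> W \<Longrightarrow> \<beta> \<in> \<Phi> \<Longrightarrow> inv (v \<circ> refl \<beta>) x = refl \<beta> (inv v x)"
  by (simp add: inv_comp_weyl refl_weyl inv_refl)

text \<open>Since the excess is at least \<open>1\<close>, an edge \<open>v \<rightarrow> v s\<^sub>\<beta>\<close> other than \<open>v \<rightarrow> s\<^sub>\<alpha> v\<close> must keep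
  \<open>s\<^sub>\<beta> v\<^sup>-\<^sup>1 \<alpha>\<close> positive, and is then carried to an edge by \<open>s\<^sub>\<alpha>\<close>.\<close>

lemma affine_simple_diamond:
  assumes a: "affine_simple \<alpha>" and v: "v \<in> W" and t: "inv v \<alpha> \<in> P" and b: "\<beta> \<in> P" "\<beta> \<noteq> inv v \<alpha>"
  shows "edge_excess (refl \<alpha> \<circ> v) \<beta> = edge_excess v \<beta> + root_sign (refl \<beta> (inv v \<alpha>)) - 1"
proof -
  let ?t = "inv v \<alpha>" and ?k = "pind (- \<alpha>)"
  have aR: "\<alpha> \<in> \<Phi>" using a affine_simple_def by blast
  have bR: "\<beta> \<in> \<Phi>" and tR: "?t \<in> \<Phi>" using b t pos_is_root by auto
  have vt: "v ?t = \<alpha>" using weyl_inv_app v by blast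
  have vb: "v \<circ> refl \<beta> \<in> W" using comp_weyl v refl_weyl bR by blast
  have 1: "inversions (refl \<alpha> \<circ> (v \<circ> refl \<beta>)) = inversions (v \<circ> refl \<beta>) + root_sign (refl \<beta> ?t) - ?k * (rho_height ?t - cpair ?t \<beta> * rho_height \<beta>)"
    unfolding affine_simple_inversions[OF a vb] inv_comp_refl_app[OF v bR] rho_height_refl[OF bR tR] ..
  have 2: "inversions (refl \<alpha> \<circ> v) = inversions v + 1 - ?k * rho_height ?t" by (rule affine_simple_inversions_pos[OF a v t])
  have "v \<beta> \<in> \<Phi>" using weyl_root v bR by blast
  moreover have "v \<beta> \<noteq> \<alpha>" using b vt weyl_eq_iff[OF v] by metis
  moreover have "v \<beta> \<noteq> - \<alpha>"
  proof
    assume "v \<beta> = - \<alpha>"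
    then have "v \<beta> = v (- ?t)" using vt weyl_minus[OF v] by simp
    then have "\<beta> = - ?t" using weyl_eq_iff[OF v] by blast
    then show False using b t minus_pos_iff pos_is_root by blast
  qed
  ultimately have "?k * cpair \<alpha> (v \<beta>) + pind (v \<beta>) = pind (refl \<alpha> (v \<beta>))"
    using a unfolding affine_simple_def by blast
  moreover have "cpair ?t \<beta> = cpair \<alpha> (v \<beta>)" using cpair_weyl[OF v, of ?t \<beta>] vt by simp
  moreover have "refl \<alpha> (v \<beta>) \<in> \<Phi>" using refl_root aR \<open>v \<beta> \<in> \<Phi>\<close> by blast
  ultimately have 3: "pind (- refl \<alpha> (v \<beta>)) = pind (- v \<beta>) - ?k * cpair ?t \<beta>"
    using pind_minus[of "v \<beta>"] pind_minus[of "refl \<alpha> (v \<beta>)"] \<open>v \<beta> \<in> \<Phi>\<close> by simp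
  show ?thesis unfolding edge_excess_def comp_assoc 1 2 by (simp add: 3 algebra_simps)
qed

lemma qb_path_append:
  "qb_path \<Phi> \<Delta> x xs y \<Longrightarrow> qb_path \<Phi> \<Delta> y ys z \<Longrightarrow> qb_path \<Phi> \<Delta> x (xs @ ys) z"
  by (induction xs arbitrary: x) auto

lemma qb_path_snoc_affine_simple:
  assumes "affine_simple \<alpha>" "v \<in> W" "qb_path \<Phi> \<Delta> v as u" "inv u \<alpha> \<in> P"
  shows "qb_path \<Phi> \<Delta> v (as @ [inv u \<alpha>]) (refl \<alpha> \<circ> u)"
proof -
  have u: "u \<in> W" using assms qb_path_weyl by blast
  have "qb_path \<Phi> \<Delta> u [inv u \<alpha>] (refl \<alpha> \<circ> u)"
    using affine_simple_edge[OF assms(1) u assms(4)] assms(4) refl_comp_weyl[OF u]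
    by (simp add: qb_path_Cons_iff u del: qb_path.simps(2))
  with assms(3) show ?thesis by (rule qb_path_append)
qed

text \<open>The path is followed from \<open>v\<close> and from
  \<open>refl \<alpha> \<circ> v\<close> in parallel. As long as it avoids the edge between these
  two vertices, the diamond keeps \<open>inv v \<alpha>\<close> positive and copies each edge. Once
  the path takes that edge, the two walks meet and one edge is saved; it is spent again only if the
  edge from \<open>u\<close> to \<open>refl \<alpha> \<circ> u\<close> has to be appended. If
  \<open>inv u \<alpha>\<close> is negative they must meet.\<close>

lemma affine_simple_path:
  assumes a: "affine_simple \<alpha>" and v: "v \<in> W" and t: "inv v \<alpha> \<in> P" and p: "qb_path \<Phi> \<Delta> v as u"
  shows "inv u \<alpha> \<notin> P \<Longrightarrow> \<exists>bs. qb_path \<Phi> \<Delta> (refl \<alpha> \<circ> v) bs u \<and> length bs < length as"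
    and "inv u \<alpha> \<in> P \<Longrightarrow> \<exists>bs. qb_path \<Phi> \<Delta> (refl \<alpha> \<circ> v) bs (refl \<alpha> \<circ> u) \<and> length bs \<le> length as"
proof -
  have aR: "\<alpha> \<in> \<Phi>" using a affine_simple_def by blast
  have "(inv u \<alpha> \<notin> P \<longrightarrow> (\<exists>bs. qb_path \<Phi> \<Delta> (refl \<alpha> \<circ> v) bs u \<and> length bs < length as)) \<and>
        (inv u \<alpha> \<in> P \<longrightarrow> (\<exists>bs. qb_path \<Phi> \<Delta> (refl \<alpha> \<circ> v) bs (refl \<alpha> \<circ> u) \<and> length bs \<le> length as))"
    using v t p
  proof (induction as arbitrary: v)
    case Nil
    then show ?case by (auto intro!: exI[of _ "[]"])
  next
    case (Cons \<beta> as)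
    let ?t = "inv v \<alpha>" and ?v = "v \<circ> refl \<beta>"
    have e: "\<beta> \<in> P" "edge_excess v \<beta> = 1" "qb_path \<Phi> \<Delta> ?v as u"
      using qb_path_Cons_iff Cons.prems by blast+
    have bR: "\<beta> \<in> \<Phi>" using e pos_is_root by auto
    have v': "?v \<in> W" using comp_weyl refl_weyl bR Cons.prems by blast
    have u: "u \<in> W" using qb_path_weyl v' e by blast
    have sv: "refl \<alpha> \<circ> v \<in> W" using comp_weyl refl_weyl aR Cons.prems by blast
    show ?case
    proof (cases "\<beta> = ?t")
      case True
      then have eq: "?v = refl \<alpha> \<circ> v" using refl_comp_weyl Cons.prems by blast
      have "\<exists>bs. qb_path \<Phi> \<Delta> (refl \<alpha> \<circ> v) bs (refl \<alpha> \<circ> u) \<and> length bs \<le> Suc (length as)" if "inv u \<alpha> \<in> P"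
      proof -
        have "qb_path \<Phi> \<Delta> (refl \<alpha> \<circ> v) (as @ [inv u \<alpha>]) (refl \<alpha> \<circ> u)"
          using qb_path_snoc_affine_simple[OF a sv _ that] e(3) eq by simp
        then show ?thesis by (intro exI[of _ "as @ [inv u \<alpha>]"]) auto
      qed
      then show ?thesis using e(3) unfolding eq by (metis length_Cons lessI)
    next
      case False
      have d: "edge_excess (refl \<alpha> \<circ> v) \<beta> = root_sign (refl \<beta> ?t)"
        using affine_simple_diamond[OF a Cons.prems(1,2) e(1) False] e(2) by simp
      with edge_excess_ge_1[OF sv e(1)] have "refl \<beta> ?t \<in> P" using root_sign_neg[of "refl \<beta> ?t"] by linarith
      then have "inv ?v \<alpha> \<in> P" "edge_excess (refl \<alpha> \<circ> v) \<beta> = 1"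
        using inv_comp_refl_app[OF Cons.prems(1) bR] d root_sign_pos by auto
      moreover have "qb_path \<Phi> \<Delta> (refl \<alpha> \<circ> v) (\<beta> # bs) y \<longleftrightarrow> qb_path \<Phi> \<Delta> (refl \<alpha> \<circ> ?v) bs y" for bs y
        using qb_path_Cons_iff[OF sv] e(1) calculation(2) by (simp add: comp_assoc del: qb_path.simps)
      ultimately show ?thesis using Cons.IH[OF v' _ e(3)]
        by (metis (no_types, lifting) length_Cons Suc_less_eq Suc_le_mono)
    qed
  qed
  then show "inv u \<alpha> \<notin> P \<Longrightarrow> \<exists>bs. qb_path \<Phi> \<Delta> (refl \<alpha> \<circ> v) bs u \<and> length bs < length as"
    "inv u \<alpha> \<in> P \<Longrightarrow> \<exists>bs. qb_path \<Phi> \<Delta> (refl \<alpha> \<circ> v) bs (refl \<alpha> \<circ> u) \<and> length bs \<le> length as" by blast+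
qed

end

section \<open>The action on cocharacters\<close>

locale cochar_roots = based_roots \<Phi> \<Delta> for \<Phi> \<Delta> :: "'a::euclidean_space set" +
  fixes emb :: "'a \<Rightarrow> 'x::ab_group_add" and pr :: "'x \<Rightarrow> 'a \<Rightarrow> int"
  assumes cd: "cochar_data \<Phi> emb pr"
begin

abbreviation "Q \<equiv> zspan (coroot ` \<Phi>)"
abbreviation "act \<equiv> wact \<Phi> emb pr"
abbreviation "mul \<equiv> amult \<Phi> emb pr"
abbreviation "AW \<equiv> affW \<Phi> :: (('a \<Rightarrow> 'a) \<times> 'x) set"
abbreviation "apos \<equiv> pos_aff \<Phi> \<Delta>"
abbreviation "len \<equiv> alen \<Phi> \<Delta> pr"
abbreviation "ref \<equiv> aref emb"
abbreviation "lx \<equiv> lxa \<Phi> \<Delta> pr"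
abbreviation "lp \<equiv> LP \<Phi> \<Delta> pr"
abbreviation "bstep \<equiv> bruhat_step \<Phi> \<Delta> emb pr"
abbreviation "ble \<equiv> bruhat_le \<Phi> \<Delta> emb pr"
abbreviation (input) "aroots \<equiv> \<Phi> \<times> (UNIV :: int set)"

lemma emb_add: "a \<in> Q \<Longrightarrow> b \<in> Q \<Longrightarrow> emb (a + b) = emb a + emb b"
  and pr_add_left: "pr (\<mu> + \<nu>) \<alpha> = pr \<mu> \<alpha> + pr \<nu> \<alpha>"
  and pr_add_right: "x \<in> zspan \<Phi> \<Longrightarrow> y \<in> zspan \<Phi> \<Longrightarrow> pr \<mu> (x + y) = pr \<mu> x + pr \<mu> y"
  and pr_emb: "c \<in> Q \<Longrightarrow> \<beta> \<in> zspan \<Phi> \<Longrightarrow> of_int (pr (emb c) \<beta>) = c \<bullet> \<beta>"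
  using cd unfolding cochar_data_def by blast+

lemma emb_zero: "emb 0 = 0"
  using emb_add[OF zspan_zero zspan_zero] by simp

lemma emb_minus: assumes "a \<in> Q" shows "emb (- a) = - emb a"
  using emb_add[OF assms zspan_minus[OF assms]] emb_zero by (simp add: eq_neg_iff_add_eq_0 add.commute)

lemma emb_diff: "a \<in> Q \<Longrightarrow> b \<in> Q \<Longrightarrow> emb (a - b) = emb a - emb b"
  using emb_add[OF _ zspan_minus, of a b] by (simp add: emb_minus)

lemma pr_zero_left: "pr 0 \<alpha> = 0"
  using pr_add_left[of 0 0 \<alpha>] by simp

lemma pr_minus_left: "pr (- \<mu>) \<alpha> = - pr \<mu> \<alpha>"
  using pr_add_left[of \<mu> "- \<mu>" \<alpha>] by (simp add: pr_zero_left)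

lemma pr_diff_left: "pr (\<mu> - \<nu>) \<alpha> = pr \<mu> \<alpha> - pr \<nu> \<alpha>"
  using pr_add_left[of \<mu> "- \<nu>" \<alpha>] by (simp add: pr_minus_left)

lemma pr_zero_right: "pr \<mu> 0 = 0"
  using pr_add_right[OF zspan_zero zspan_zero, of \<mu>] by simp

lemma pr_minus_right: "x \<in> zspan \<Phi> \<Longrightarrow> pr \<mu> (- x) = - pr \<mu> x"
  using pr_add_right[OF _ zspan_minus, of x x \<mu>] by (simp add: pr_zero_right)

lemma pr_diff_right: "x \<in> zspan \<Phi> \<Longrightarrow> y \<in> zspan \<Phi> \<Longrightarrow> pr \<mu> (x - y) = pr \<mu> x - pr \<mu> y"
  using pr_add_right[OF _ zspan_minus, of x y \<mu>] by (simp add: pr_minus_right)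

lemma pr_scale_right: assumes "x \<in> zspan \<Phi>" shows "pr \<mu> (of_int n *\<^sub>R x) = n * pr \<mu> x"
proof -
  have nat: "pr \<mu> (of_int (int m) *\<^sub>R x) = int m * pr \<mu> x" for m
  proof (induction m)
    case 0 then show ?case by (simp add: pr_zero_right)
  next
    case (Suc m)
    have "of_int (int (Suc m)) *\<^sub>R x = of_int (int m) *\<^sub>R x + x" by (simp add: algebra_simps)
    then show ?case using Suc pr_add_right[OF zspan_scale[OF assms, of "int m"] assms, of \<mu>]
      by (simp add: algebra_simps)
  qed
  show ?thesis
  proof (cases "n \<ge> 0")
    case True then show ?thesis using nat[of "nat n"] by simp
  next
    case False
    then have "of_int n *\<^sub>R x = - (of_int (int (nat (- n))) *\<^sub>R x)" by simp
    then show ?thesis using nat[of "nat (- n)"] False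
        pr_minus_right[OF zspan_scale[OF assms, of "int (nat (- n))"], of \<mu>] by simp
  qed
qed

lemma pr_refl:
  assumes "\<alpha> \<in> \<Phi>" "\<beta> \<in> \<Phi>" shows "pr \<mu> (refl \<alpha> \<beta>) = pr \<mu> \<beta> - cpair \<alpha> \<beta> * pr \<mu> \<alpha>"
  using assms by (simp add: refl_cpair pr_diff_right pr_scale_right zspan_superset zspan_scale)

lemma pr_minus_root: "\<beta> \<in> \<Phi> \<Longrightarrow> pr \<mu> (- \<beta>) = - pr \<mu> \<beta>"
  by (simp add: pr_minus_right zspan_superset)

lemma coroot_lattice_scale: "\<alpha> \<in> \<Phi> \<Longrightarrow> of_int n *\<^sub>R coroot \<alpha> \<in> Q"
  by (simp add: zspan_scale zspan_superset)

lemma pr_emb_coroot: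
  assumes "\<alpha> \<in> \<Phi>" "\<beta> \<in> \<Phi>" shows "pr (emb (of_int n *\<^sub>R coroot \<alpha>)) \<beta> = n * cpair \<alpha> \<beta>"
proof -
  have "real_of_int (pr (emb (of_int n *\<^sub>R coroot \<alpha>)) \<beta>) = of_int (n * cpair \<alpha> \<beta>)"
    using pr_emb[OF coroot_lattice_scale[OF assms(1)] zspan_superset[OF assms(2)]] of_int_cpair[OF assms] by simp
  then show ?thesis by linarith
qed

lemma pr_xrefl:
  assumes "\<alpha> \<in> \<Phi>" "\<beta> \<in> \<Phi>" shows "pr (xrefl emb pr \<alpha> \<mu>) (refl \<alpha> \<beta>) = pr \<mu> \<beta>"
proof -
  have "cpair \<alpha> (refl \<alpha> \<beta>) = cpair (refl \<alpha> \<alpha>) \<beta>"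
    using cpair_weyl[OF refl_weyl[OF assms(1)], of \<alpha> "refl \<alpha> \<beta>"] by (simp add: refl_refl)
  then have "cpair \<alpha> (refl \<alpha> \<beta>) = - cpair \<alpha> \<beta>" by (simp add: refl_root_self cpair_minus_left assms)
  then show ?thesis unfolding xrefl_def
    by (simp add: pr_diff_left pr_emb_coroot assms refl_root pr_refl cpair_self)
qed

lemma xact_list_diff:
  "set as \<subseteq> \<Phi> \<Longrightarrow> \<exists>c\<in>Q. xact_list emb pr as \<mu> = \<mu> - emb c"
proof (induction as)
  case Nil then show ?case using zspan_zero emb_zero by (intro bexI[of _ 0]) auto
next
  case (Cons a as)
  then obtain c where c: "c \<in> Q" "xact_list emb pr as \<mu> = \<mu> - emb c" by auto
  let ?d = "of_int (pr (xact_list emb pr as \<mu>) a) *\<^sub>R coroot a"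
  have "?d \<in> Q" using coroot_lattice_scale Cons.prems by simp
  then show ?case using c by (intro bexI[of _ "c + ?d"]) (auto simp: xrefl_def emb_add zspan_add)
qed

lemma pr_xact_list:
  "set as \<subseteq> \<Phi> \<Longrightarrow> \<beta> \<in> \<Phi> \<Longrightarrow> pr (xact_list emb pr as \<mu>) (refl_prod as \<beta>) = pr \<mu> \<beta>"
proof (induction as)
  case (Cons a as)
  have "refl_prod as \<in> W" using Cons.prems by (intro weylI) auto
  then show ?case using Cons weyl_root[of "refl_prod as" \<beta>] by (simp add: pr_xrefl)
qed simp

text \<open>Such a vector lies in the span of the roots and is orthogonal to it.\<close>

lemma Q_inner_eq_zero:
  assumes "c \<in> Q" "\<And>\<beta>. \<beta> \<in> \<Phi> \<Longrightarrow> c \<bullet> \<beta> = 0" shows "c = 0"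
proof -
  have "coroot ` \<Phi> \<subseteq> span \<Phi>"
    unfolding coroot_def by (rule image_subsetI, rule span_scale, rule span_base)
  then have "span (coroot ` \<Phi>) \<subseteq> span \<Phi>" by (simp add: span_minimal)
  then have "c \<in> span \<Phi>" using assms(1) zspan_subset_span by blast
  moreover have "span \<Phi> \<subseteq> {x. c \<bullet> x = 0}"
    by (rule span_minimal) (use assms(2) in \<open>auto simp: subspace_def inner_add_right\<close>)
  ultimately show ?thesis by auto
qed

text \<open>Well-definedness of the W-action on \<open>'x\<close>. Acting by a word changes \<mu> by
  an element of the coroot lattice, the pairings of the result with roots depend only on the product
  of the word, and roots separate the coroot lattice.\<close>

lemma xact_list_cong:
  assumes "set as \<subseteq> \<Phi>" "set bs \<subseteq> \<Phi>" "refl_prod as = refl_prod bs"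
  shows "xact_list emb pr as \<mu> = xact_list emb pr bs \<mu>"
proof -
  obtain c where c: "c \<in> Q" "xact_list emb pr as \<mu> = \<mu> - emb c" using xact_list_diff[OF assms(1)] by blast
  obtain d where d: "d \<in> Q" "xact_list emb pr bs \<mu> = \<mu> - emb d" using xact_list_diff[OF assms(2)] by blast
  have "(c - d) \<bullet> \<beta> = 0" if b: "\<beta> \<in> \<Phi>" for \<beta>
  proof -
    have w: "refl_prod as \<in> W" using assms(1) by (intro weylI) auto
    define \<gamma> where "\<gamma> = inv (refl_prod as) \<beta>"
    have g: "\<gamma> \<in> \<Phi>" "refl_prod as \<gamma> = \<beta>" unfolding \<gamma>_def using w inv_weyl weyl_root b weyl_inv_app by auto
    have "pr (\<mu> - emb c) \<beta> = pr (\<mu> - emb d) \<beta>"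
      using pr_xact_list[OF assms(1) g(1), of \<mu>] pr_xact_list[OF assms(2) g(1), of \<mu>]
      unfolding assms(3)[symmetric] g(2) c(2) d(2) by simp
    then have "pr (emb c) \<beta> = pr (emb d) \<beta>" by (simp add: pr_diff_left)
    then show ?thesis using pr_emb[OF c(1) zspan_superset[OF b]] pr_emb[OF d(1) zspan_superset[OF b]]
      by (simp add: inner_diff_left)
  qed
  moreover have "c - d \<in> Q" using zspan_add[OF c(1) zspan_minus[OF d(1)]] by simp
  ultimately have "c - d = 0" using Q_inner_eq_zero by blast
  then show ?thesis using c d by simp
qed

lemma wact_refl_prod:
  assumes "set as \<subseteq> \<Phi>" shows "act (refl_prod as) \<mu> = xact_list emb pr as \<mu>"
  unfolding wact_def
proof (rule the_equality)
  show "\<exists>bs. set bs \<subseteq> \<Phi> \<and> refl_prod as = refl_prod bs \<and> xact_list emb pr as \<mu> = xact_list emb pr bs \<mu>"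
    using assms by blast
next
  fix \<nu> assume "\<exists>bs. set bs \<subseteq> \<Phi> \<and> refl_prod as = refl_prod bs \<and> \<nu> = xact_list emb pr bs \<mu>"
  then show "\<nu> = xact_list emb pr as \<mu>" using xact_list_cong[OF assms] by auto
qed

lemma xact_list_append: "xact_list emb pr (as @ bs) \<mu> = xact_list emb pr as (xact_list emb pr bs \<mu>)"
  by (induction as) auto

lemma act_comp: assumes "u \<in> W" "w \<in> W" shows "act (u \<circ> w) \<mu> = act u (act w \<mu>)"
proof -
  obtain as where as: "set as \<subseteq> \<Phi>" "u = refl_prod as" using assms weyl_refl_prodE by metis
  obtain bs where bs: "set bs \<subseteq> \<Phi>" "w = refl_prod bs" using assms weyl_refl_prodE by metis
  have "act (u \<circ> w) \<mu> = act (refl_prod (as @ bs)) \<mu>" unfolding as bs refl_prod_append ..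
  also have "\<dots> = xact_list emb pr (as @ bs) \<mu>" by (rule wact_refl_prod) (use as bs in auto)
  finally show ?thesis unfolding xact_list_append as(2) bs(2) wact_refl_prod[OF as(1)] wact_refl_prod[OF bs(1)] .
qed

lemma act_id: "act id \<mu> = \<mu>"
  using wact_refl_prod[of "[]" \<mu>] by simp

lemma act_refl: assumes "\<alpha> \<in> \<Phi>" shows "act (refl \<alpha>) \<mu> = \<mu> - emb (of_int (pr \<mu> \<alpha>) *\<^sub>R coroot \<alpha>)"
  using wact_refl_prod[of "[\<alpha>]" \<mu>] assms by (simp add: xrefl_def)

lemma weyl_induct [consumes 1, case_names id refl]:
  assumes "w \<in> W" "R id" "\<And>\<alpha> w. \<alpha> \<in> \<Phi> \<Longrightarrow> w \<in> W \<Longrightarrow> R w \<Longrightarrow> R (refl \<alpha> \<circ> w)"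
  shows "R w"
proof -
  have "set as \<subseteq> \<Phi> \<Longrightarrow> R (refl_prod as)" for as
  proof (induction as)
    case (Cons a as)
    then have "a \<in> \<Phi>" "set as \<subseteq> \<Phi>" by auto
    then show ?case unfolding refl_prod.simps using assms(3) weylI Cons.IH by blast
  qed (use assms(2) in \<open>simp add: id_def\<close>)
  then show ?thesis using assms(1) weyl_refl_prodE by metis
qed

lemma act_add: assumes "w \<in> W" shows "act w (\<mu> + \<nu>) = act w \<mu> + act w \<nu>"
  using assms
proof (induction w rule: weyl_induct)
  case (refl \<alpha> w)
  have "of_int (m + n) *\<^sub>R coroot \<alpha> = of_int m *\<^sub>R coroot \<alpha> + of_int n *\<^sub>R coroot \<alpha>" for m n :: int
    by (simp add: scaleR_add_left)
  then have "emb (of_int (m + n) *\<^sub>R coroot \<alpha>) = emb (of_int m *\<^sub>R coroot \<alpha>) + emb (of_int n *\<^sub>R coroot \<alpha>)" for m n :: int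
    using emb_add coroot_lattice_scale refl.hyps(1) by metis
  then show ?case
    unfolding act_comp[OF refl_weyl[OF refl.hyps(1)] refl.hyps(2)] act_refl[OF refl.hyps(1)]
      refl.IH pr_add_left by simp
qed (simp only: act_id)

lemma act_zero: "w \<in> W \<Longrightarrow> act w 0 = 0"
  using act_add[of w 0 0] by simp

lemma act_minus: "w \<in> W \<Longrightarrow> act w (- \<mu>) = - act w \<mu>"
  using act_add[of w \<mu> "-\<mu>"] act_zero[of w] by (simp add: eq_neg_iff_add_eq_0 add.commute)

lemma act_diff: "w \<in> W \<Longrightarrow> act w (\<mu> - \<nu>) = act w \<mu> - act w \<nu>"
  using act_add[of w \<mu> "-\<nu>"] act_minus[of w \<nu>] by simp

lemma pr_act: assumes "w \<in> W" "\<beta> \<in> \<Phi>" shows "pr (act w \<mu>) (w \<beta>) = pr \<mu> \<beta>"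
proof -
  obtain as where as: "set as \<subseteq> \<Phi>" "w = refl_prod as" using assms weyl_refl_prodE by metis
  then show ?thesis using pr_xact_list[OF as(1) assms(2)] wact_refl_prod[OF as(1)] by simp
qed

lemma pr_act_inv: assumes "w \<in> W" "\<beta> \<in> \<Phi>" shows "pr (act (inv w) \<mu>) \<beta> = pr \<mu> (w \<beta>)"
  using pr_act[OF inv_weyl[OF assms(1)] weyl_root[OF assms], of \<mu>] by (simp add: weyl_inv_app assms)

lemma act_inv_cancel: "w \<in> W \<Longrightarrow> act w (act (inv w) \<mu>) = \<mu>" "w \<in> W \<Longrightarrow> act (inv w) (act w \<mu>) = \<mu>"
  by (simp_all add: act_comp[symmetric] inv_weyl weyl_inv_comp act_id)

lemma weyl_coroot_lattice: assumes "w \<in> W" "c \<in> Q" shows "w c \<in> Q"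
proof -
  obtain F k where F: "finite F" "F \<subseteq> coroot ` \<Phi>" "c = (\<Sum>a\<in>F. of_int (k a) *\<^sub>R a)"
    using assms(2) unfolding zspan_def by blast
  have "w c = (\<Sum>a\<in>F. of_int (k a) *\<^sub>R w a)"
    unfolding F(3) by (simp add: linear_sum[OF linear_weyl[OF assms(1)]] linear_cmul[OF linear_weyl[OF assms(1)]])
  moreover have "of_int (k a) *\<^sub>R w a \<in> Q" if "a \<in> F" for a
  proof -
    obtain \<alpha> where "\<alpha> \<in> \<Phi>" "a = coroot \<alpha>" using F(2) \<open>a \<in> F\<close> by blast
    then show ?thesis using coroot_weyl[OF assms(1), of \<alpha>] coroot_lattice_scale weyl_root[OF assms(1)] by metis
  qed
  moreover have "(\<Sum>a\<in>F. of_int (k a) *\<^sub>R w a) \<in> Q"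
    using F(1) calculation(2)
    by (induction F rule: finite_induct) (simp_all add: zspan_zero zspan_add)
  ultimately show ?thesis by simp
qed

lemma act_emb: assumes "w \<in> W" "c \<in> Q" shows "act w (emb c) = emb (w c)"
  using assms
proof (induction w rule: weyl_induct)
  case (refl \<alpha> w)
  have wc: "w c \<in> Q" using weyl_coroot_lattice refl by blast
  have "of_int (pr (emb (w c)) \<alpha>) *\<^sub>R coroot \<alpha> = (w c \<bullet> \<alpha>) *\<^sub>R coroot \<alpha>"
    using pr_emb[OF wc zspan_superset[OF refl.hyps(1)]] by simp
  also have "\<dots> = (coroot \<alpha> \<bullet> w c) *\<^sub>R \<alpha>" by (simp add: coroot_def inner_commute)
  finally have e: "of_int (pr (emb (w c)) \<alpha>) *\<^sub>R coroot \<alpha> = (coroot \<alpha> \<bullet> w c) *\<^sub>R \<alpha>" .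
  then have "(coroot \<alpha> \<bullet> w c) *\<^sub>R \<alpha> \<in> Q" using coroot_lattice_scale refl.hyps(1) by metis
  then show ?case
    unfolding act_comp[OF refl_weyl[OF refl.hyps(1)] refl.hyps(2)] act_refl[OF refl.hyps(1)]
      refl.IH[OF refl.prems] e by (simp add: refl_coroot emb_diff wc)
qed (simp only: act_id id_apply)

lemma act_emb_coroot:
  assumes "w \<in> W" "\<alpha> \<in> \<Phi>"
  shows "act w (emb (of_int n *\<^sub>R coroot \<alpha>)) = emb (of_int n *\<^sub>R coroot (w \<alpha>))"
  using act_emb[OF assms(1) coroot_lattice_scale[OF assms(2)]]
  by (simp add: coroot_weyl assms linear_cmul[OF linear_weyl])

section \<open>The extended affine Weyl group\<close>

lemma AW_iff: "(w, \<mu>) \<in> AW \<longleftrightarrow> w \<in> W"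
  by (simp add: affW_def)

lemma mul_Pair: "mul (w, \<mu>) (u, \<nu>) = (w \<circ> u, act (inv u) \<mu> + \<nu>)"
  by (simp add: amult_def)

lemma mul_AW: "x \<in> AW \<Longrightarrow> y \<in> AW \<Longrightarrow> mul x y \<in> AW"
  by (cases x; cases y) (simp add: mul_Pair AW_iff comp_weyl)

lemma mul_assoc: "x \<in> AW \<Longrightarrow> y \<in> AW \<Longrightarrow> z \<in> AW \<Longrightarrow> mul (mul x y) z = mul x (mul y z)"
  by (cases x; cases y; cases z)
     (simp add: mul_Pair AW_iff comp_assoc inv_comp_weyl act_comp inv_weyl act_add add.assoc)

lemma mul_one: "mul x (id, 0) = x"
  by (cases x) (simp add: mul_Pair act_id)

lemma one_mul: "x \<in> AW \<Longrightarrow> mul (id, 0) x = x"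
  by (cases x) (simp add: mul_Pair AW_iff act_zero inv_weyl)

lemma ex_inverse: assumes "x \<in> AW" shows "\<exists>y\<in>AW. mul x y = (id, 0) \<and> mul y x = (id, 0)"
proof -
  obtain w \<mu> where x: "x = (w, \<mu>)" "w \<in> W" using assms AW_iff by (cases x) auto
  show ?thesis
    by (rule bexI[of _ "(inv w, - act w \<mu>)"])
       (simp_all add: x mul_Pair AW_iff inv_weyl weyl_inv_comp inv_inv_weyl act_minus act_inv_cancel)
qed

lemma ref_AW: "a \<in> aroots \<Longrightarrow> ref a \<in> AW"
  by (cases a) (simp add: aref_def AW_iff refl_weyl)

lemma ref_minus: "ref (- a) = ref a"
  by (cases a) (simp add: aref_def refl_minus_root coroot_minus)

lemma aact_aroots: "x \<in> AW \<Longrightarrow> a \<in> aroots \<Longrightarrow> aact pr x a \<in> aroots"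
  by (cases x; cases a) (simp add: aact_def AW_iff weyl_root)

lemma aact_mul: "x \<in> AW \<Longrightarrow> y \<in> AW \<Longrightarrow> a \<in> aroots \<Longrightarrow> aact pr (mul x y) a = aact pr x (aact pr y a)"
  by (cases x; cases y; cases a) (simp add: aact_def AW_iff mul_Pair pr_add_left pr_act_inv)

lemma aact_one: "aact pr (id, 0) a = a"
  by (cases a) (simp add: aact_def pr_zero_left)

lemma aact_minus: "x \<in> AW \<Longrightarrow> a \<in> aroots \<Longrightarrow> aact pr x (- a) = - aact pr x a"
  by (cases x; cases a) (simp add: aact_def AW_iff weyl_minus pr_minus_root)

lemma aact_add: "x \<in> AW \<Longrightarrow> a \<in> aroots \<Longrightarrow> b \<in> aroots \<Longrightarrow> aact pr x (a + b) = aact pr x a + aact pr x b"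
  by (cases x; cases a; cases b)
     (simp add: aact_def AW_iff linear_add[OF linear_weyl] pr_add_right zspan_superset)

lemma aact_ref:
  assumes "(\<alpha>, k) \<in> aroots" "(\<beta>, j) \<in> aroots"
  shows "aact pr (ref (\<alpha>, k)) (\<beta>, j) = (\<beta> - of_int (cpair \<alpha> \<beta>) *\<^sub>R \<alpha>, j - cpair \<alpha> \<beta> * k)"
  using assms by (simp add: aact_def aref_def refl_cpair pr_emb_coroot)

lemma aact_ref_self: "a \<in> aroots \<Longrightarrow> aact pr (ref a) a = - a"
  by (cases a) (simp add: aact_ref cpair_self scaleR_2)

text \<open>The conjugation rule \<open>y r_a y^-1 = r_(y a)\<close>, written without
  inverses.\<close>

lemma ref_conj: assumes "y \<in> AW" "a \<in> aroots" shows "mul (ref (aact pr y a)) y = mul y (ref a)"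
proof -
  obtain w \<mu> where y: "y = (w, \<mu>)" "w \<in> W" using assms AW_iff by (cases y) auto
  obtain \<alpha> k where a: "a = (\<alpha>, k)" "\<alpha> \<in> \<Phi>" using assms by auto
  have "act (inv w) (emb (of_int (k - pr \<mu> \<alpha>) *\<^sub>R coroot (w \<alpha>))) = emb (of_int (k - pr \<mu> \<alpha>) *\<^sub>R coroot \<alpha>)"
    using act_emb_coroot[OF inv_weyl[OF y(2)] weyl_root[OF y(2) a(2)], of "k - pr \<mu> \<alpha>"]
    unfolding weyl_inv_app[OF y(2)] .
  also have "\<dots> = emb (of_int k *\<^sub>R coroot \<alpha>) - emb (of_int (pr \<mu> \<alpha>) *\<^sub>R coroot \<alpha>)"
    using emb_diff[OF coroot_lattice_scale[OF a(2)] coroot_lattice_scale[OF a(2)], of k "pr \<mu> \<alpha>"] by (simp add: scaleR_diff_left)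
  finally show ?thesis
    by (simp add: y a aact_def aref_def mul_Pair refl_weyl_conj inv_refl act_refl)
qed

lemma ref_ref: assumes "a \<in> aroots" shows "mul (ref a) (ref a) = (id, 0)"
proof -
  obtain \<alpha> k where a: "a = (\<alpha>, k)" "\<alpha> \<in> \<Phi>" using assms by auto
  have "act (refl \<alpha>) (emb (of_int k *\<^sub>R coroot \<alpha>)) = emb (- (of_int k *\<^sub>R coroot \<alpha>))"
    using act_emb_coroot[OF refl_weyl[OF a(2)] a(2), of k] by (simp add: refl_root_self a coroot_minus)
  then show ?thesis using emb_minus[OF coroot_lattice_scale[OF a(2)], of k]
    by (simp add: a aref_def mul_Pair refl_comp_refl inv_refl)
qed

lemma mul_ref_ref: assumes "x \<in> AW" "a \<in> aroots" shows "mul (mul x (ref a)) (ref a) = x"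
  using mul_assoc[OF assms(1) ref_AW[OF assms(2)] ref_AW[OF assms(2)]] ref_ref[OF assms(2)] mul_one by simp

lemma ref_ref_mul: assumes "x \<in> AW" "a \<in> aroots" shows "mul (ref a) (mul (ref a) x) = x"
  using mul_assoc[OF ref_AW[OF assms(2)] ref_AW[OF assms(2)] assms(1)] ref_ref[OF assms(2)] one_mul[OF assms(1)] by simp

section \<open>Positivity of affine roots as a sign\<close>

definition affM :: real where "affM = 1 + (\<Sum>\<beta>\<in>\<Phi>. \<bar>ht \<beta>\<bar>)"

text \<open>\<open>affM\<close> outweighs the height of every root, so the level decides the sign
  unless it is 0, and then the height does. This is exactly the definition of a positive affine
  root.\<close>

definition aff :: "'a \<times> int \<Rightarrow> real" where "aff a = affM * of_int (snd a) + ht (fst a)"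

lemma ht_less_affM: assumes "\<beta> \<in> \<Phi>" shows "\<bar>ht \<beta>\<bar> < affM"
  using member_le_sum[OF assms, of "\<lambda>\<beta>. \<bar>ht \<beta>\<bar>"] fin_roots unfolding affM_def by simp

lemma affM_pos: "affM > 0"
proof -
  have "(\<Sum>\<beta>\<in>\<Phi>. \<bar>ht \<beta>\<bar>) \<ge> 0" by (rule sum_nonneg) simp
  then show ?thesis unfolding affM_def by linarith
qed

lemma aff_add: "aff (a + b) = aff a + aff b" and aff_minus: "aff (- a) = - aff a"
  by (simp_all add: aff_def ht_add ht_minus algebra_simps)

lemma apos_aroots: "apos a \<Longrightarrow> a \<in> aroots"
  by (cases a) (simp add: pos_aff_def)

lemma aff_sign:
  assumes "a \<in> aroots" shows "apos a \<longleftrightarrow> aff a > 0" "aff a \<noteq> 0"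
proof -
  obtain \<alpha> k where a: "a = (\<alpha>, k)" "\<alpha> \<in> \<Phi>" using assms by auto
  have b: "\<bar>ht \<alpha>\<bar> < affM" using ht_less_affM a by blast
  have nz: "ht \<alpha> \<noteq> 0" using ht_root_nz a by blast
  consider "k \<ge> 1" | "k = 0" | "k \<le> -1" by linarith
  then have "(apos a \<longleftrightarrow> aff a > 0) \<and> aff a \<noteq> 0"
  proof cases
    case 1
    then have "affM * of_int k \<ge> affM * 1" using affM_pos by (intro mult_left_mono) auto
    then show ?thesis using b 1 pind_01[of "-\<alpha>"] by (auto simp: aff_def a pos_aff_def)
  next
    case 2
    then show ?thesis using nz a minus_pos_iff[OF a(2)] pos_root_iff[of \<alpha>]
      by (auto simp: aff_def pos_aff_def posind_def)
  next
    case 3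
    then have "affM * of_int k \<le> affM * (-1)" using affM_pos by (intro mult_left_mono) auto
    then show ?thesis using b 3 pind_01[of "-\<alpha>"] by (auto simp: aff_def a pos_aff_def)
  qed
  then show "apos a \<longleftrightarrow> aff a > 0" "aff a \<noteq> 0" by auto
qed

lemma minus_aroots: "a \<in> aroots \<Longrightarrow> - a \<in> aroots"
  by (cases a) (simp add: minus_root)

lemma apos_minus: "a \<in> aroots \<Longrightarrow> apos (- a) \<longleftrightarrow> \<not> apos a"
  using aff_sign[of a] aff_sign(1)[OF minus_aroots, of a] by (auto simp: aff_minus)

lemma aff_aact_ref:
  assumes "x \<in> AW" "a \<in> aroots" "b \<in> aroots"
  shows "aff (aact pr x (aact pr (ref a) b)) = aff (aact pr x b) - of_int (cpair (fst a) (fst b)) * aff (aact pr x a)"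
proof -
  obtain w \<mu> where x: "x = (w, \<mu>)" "w \<in> W" using assms AW_iff by (cases x) auto
  obtain \<alpha> k where a: "a = (\<alpha>, k)" "\<alpha> \<in> \<Phi>" using assms by auto
  obtain \<beta> j where b: "b = (\<beta>, j)" "\<beta> \<in> \<Phi>" using assms by auto
  have "pr \<mu> (\<beta> - of_int (cpair \<alpha> \<beta>) *\<^sub>R \<alpha>) = pr \<mu> \<beta> - cpair \<alpha> \<beta> * pr \<mu> \<alpha>"
    using pr_refl[OF a(2) b(2)] refl_cpair[OF a(2) b(2)] by simp
  then have "aact pr x (aact pr (ref a) b)
      = (w \<beta> - of_int (cpair \<alpha> \<beta>) *\<^sub>R w \<alpha>, j - cpair \<alpha> \<beta> * k - (pr \<mu> \<beta> - cpair \<alpha> \<beta> * pr \<mu> \<alpha>))"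
    using a(2) b(2) aact_ref[of \<alpha> k \<beta> j] unfolding a(1) b(1)
    by (simp add: aact_def[of _ "(w, \<mu>)"] x(1) linear_diff[OF linear_weyl[OF x(2)]] linear_cmul[OF linear_weyl[OF x(2)]])
  then show ?thesis unfolding a(1) b(1) x(1)
    by (simp add: aff_def aact_def[of _ "(w, \<mu>)"] ht_diff ht_scale algebra_simps)
qed

section \<open>Length\<close>

lemma lx_minus: "x \<in> AW \<Longrightarrow> \<gamma> \<in> \<Phi> \<Longrightarrow> lx x (- \<gamma>) = - lx x \<gamma>"
  by (cases x) (simp add: lxa_def AW_iff weyl_minus weyl_root pr_minus_root pind_minus)

lemma lx_mul: "x \<in> AW \<Longrightarrow> (u, \<nu>) \<in> AW \<Longrightarrow> \<gamma> \<in> \<Phi> \<Longrightarrow> lx (mul x (u, \<nu>)) \<gamma> = lx x (u \<gamma>) + lx (u, \<nu>) \<gamma>"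
  by (cases x) (simp add: lxa_def mul_Pair AW_iff pr_add_left pr_act_inv)

text \<open>Over each \<gamma> the levels that become negative form an integer interval; by
  \<open>pind_minus\<close> its length is \<open>max 0 (lx (w, \<mu>) \<gamma>)\<close>.\<close>

lemma neg_set_eq:
  assumes "w \<in> W"
  shows "{a. apos a \<and> \<not> apos (aact pr (w, \<mu>) a)} = (SIGMA \<gamma>:\<Phi>. {pind (- \<gamma>)..<pind (- w \<gamma>) + pr \<mu> \<gamma>})"
  by (auto simp: pos_aff_def aact_def assms weyl_root)

lemma fin_neg_set: "x \<in> AW \<Longrightarrow> finite {a. apos a \<and> \<not> apos (aact pr x a)}"
  using fin_roots by (cases x) (simp add: AW_iff neg_set_eq)

lemma len_sum: assumes "x \<in> AW" shows "int (len x) = (\<Sum>\<gamma>\<in>\<Phi>. max 0 (lx x \<gamma>))"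
proof -
  obtain w \<mu> where x: "x = (w, \<mu>)" "w \<in> W" using assms AW_iff by (cases x) auto
  have "int (len x) = (\<Sum>\<gamma>\<in>\<Phi>. int (nat (pind (- w \<gamma>) + pr \<mu> \<gamma> - pind (- \<gamma>))))"
    unfolding alen_def x(1) neg_set_eq[OF x(2)] by (simp add: fin_roots)
  also have "\<dots> = (\<Sum>\<gamma>\<in>\<Phi>. max 0 (lx x \<gamma>))"
    by (rule sum.cong) (simp_all add: lxa_def x pind_minus weyl_root)
  finally show ?thesis .
qed

text \<open>The length that \<open>x\<close> would have if \<open>v\<close> were length positive for
  it. Without absolute values it is additive, hence computable along products and paths.\<close>

definition directed_len :: "('a \<Rightarrow> 'a) \<Rightarrow> ('a \<Rightarrow> 'a) \<times> 'x \<Rightarrow> int" where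
  "directed_len v x = (\<Sum>\<beta>\<in>P. lx x (v \<beta>))"

text \<open>Together \<gamma> and -\<gamma> contribute max(0, l) + max(0, -l) = |l|, and the roots
  may be indexed through any \<open>v\<close>.\<close>

lemma len_abs: assumes "x \<in> AW" "v \<in> W" shows "int (len x) = (\<Sum>\<beta>\<in>P. \<bar>lx x (v \<beta>)\<bar>)"
proof -
  have "int (len x) = (\<Sum>\<gamma>\<in>\<Phi>. max 0 (lx x (v \<gamma>)))"
    using len_sum[OF assms(1)] sum_roots_weyl[OF assms(2), of "\<lambda>\<gamma>. max 0 (lx x \<gamma>)"] by simp
  also have "\<dots> = (\<Sum>\<beta>\<in>P. \<bar>lx x (v \<beta>)\<bar>)"
    unfolding sum_roots
    by (rule sum.cong) (simp_all add: weyl_minus assms lx_minus weyl_root pos_is_root)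
  finally show ?thesis .
qed

lemma directed_len_le_len: assumes "x \<in> AW" "v \<in> W" shows "directed_len v x \<le> int (len x)"
  unfolding directed_len_def len_abs[OF assms] by (rule sum_mono) simp

lemma directed_len_eq_len_iff: assumes "x \<in> AW" "v \<in> W" shows "directed_len v x = int (len x) \<longleftrightarrow> v \<in> lp x"
proof -
  have "directed_len v x = int (len x) \<longleftrightarrow> (\<Sum>\<beta>\<in>P. \<bar>lx x (v \<beta>)\<bar> - lx x (v \<beta>)) = 0"
    unfolding directed_len_def len_abs[OF assms] by (auto simp: sum_subtractf)
  also have "\<dots> \<longleftrightarrow> (\<forall>\<beta>\<in>P. \<bar>lx x (v \<beta>)\<bar> - lx x (v \<beta>) = 0)"
    by (rule sum_nonneg_eq_0_iff) (auto simp: fin_pos)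
  also have "\<dots> \<longleftrightarrow> v \<in> lp x" unfolding LP_def using assms by auto
  finally show ?thesis .
qed

lemma lp_weyl: "v \<in> lp x \<Longrightarrow> v \<in> W" by (simp add: LP_def)

text \<open>An injection from the roots made negative by \<open>x r_a\<close> to those made negative
  by \<open>x\<close>, missing \<open>a\<close>: send \<open>b\<close> to \<open>r_a b\<close> if
  that is positive and to \<open>b\<close> otherwise.\<close>

lemma len_ref_less:
  assumes x: "x \<in> AW" and a: "apos a" and n: "\<not> apos (aact pr x a)"
  shows "len (mul x (ref a)) < len x"
proof -
  let ?y = "mul x (ref a)" and ?r = "aact pr (ref a)"
  let ?N = "\<lambda>x. {a. apos a \<and> \<not> apos (aact pr x a)}"
  define f where "f b = (if apos (?r b) then ?r b else b)" for b
  have aR: "a \<in> aroots" using a apos_aroots by blast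
  have rW: "ref a \<in> AW" using ref_AW aR by blast
  have xaR: "aact pr x a \<in> aroots" using aact_aroots x aR by blast
  have rR: "?r b \<in> aroots" if "b \<in> aroots" for b using aact_aroots rW that by blast
  have rr: "?r (?r b) = b" if "b \<in> aroots" for b
    using aact_mul[OF rW rW that] ref_ref[OF aR] aact_one by simp
  have yb: "aact pr ?y b = aact pr x (?r b)" if "b \<in> aroots" for b using aact_mul[OF x rW that] .
  have fa: "aff a > 0" "aff (aact pr x a) < 0" using aff_sign[OF aR] a aff_sign[OF xaR] n by auto
  have sub: "f ` ?N ?y \<subseteq> ?N x - {a}"
  proof
    fix c assume "c \<in> f ` ?N ?y"
    then obtain b where b: "apos b" "\<not> apos (aact pr ?y b)" "c = f b" by blast
    have bR: "b \<in> aroots" using b apos_aroots by blast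
    have nb: "\<not> apos (aact pr x (?r b))" using b yb[OF bR] by simp
    show "c \<in> ?N x - {a}"
    proof (cases "apos (?r b)")
      case True
      moreover have "?r b \<noteq> a"
      proof
        assume "?r b = a"
        then have "b = - a" using rr[OF bR] aact_ref_self[OF aR] by metis
        then show False using b(1) a apos_minus[OF aR] by simp
      qed
      ultimately show ?thesis using b nb by (simp add: f_def)
    next
      case False
      \<comment> \<open>Here \<open>b\<close> is positive and \<open>r_a b\<close> negative, so
        \<open>?n\<close> is positive, and \<open>x b = x (r_a b) + ?n (x a)\<close> is a sum of
        negative terms.\<close>
      let ?n = "real_of_int (cpair (fst a) (fst b))"
      have "aff (?r b) < 0" using False aff_sign[OF rR[OF bR]] by auto
      moreover have "aff (?r b) = aff b - ?n * aff a"
        using aff_aact_ref[of "(id, 0)" a b] aR bR id_weyl by (simp add: aact_one AW_iff)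
      moreover have "aff b > 0" using b aff_sign[OF bR] by simp
      ultimately have "?n * aff a > 0" by linarith
      then have "?n > 0" using fa by (simp add: zero_less_mult_iff)
      moreover have "aff (aact pr x (?r b)) < 0"
        using nb aff_sign[OF aact_aroots[OF x rR[OF bR]]] by auto
      moreover have "aff (aact pr x (?r b)) = aff (aact pr x b) - ?n * aff (aact pr x a)"
        using aff_aact_ref x aR bR by blast
      ultimately have "aff (aact pr x b) < 0" using fa(2) mult_pos_neg[of ?n "aff (aact pr x a)"] by linarith
      then have "\<not> apos (aact pr x b)" using aff_sign[OF aact_aroots[OF x bR]] by simp
      moreover have "b \<noteq> a"
      proof
        assume "b = a"
        then have "aact pr x (?r b) = - aact pr x a" using aact_ref_self[OF aR] aact_minus[OF x aR] by simp
        then show False using nb n apos_minus[OF xaR] by simp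
      qed
      ultimately show ?thesis using b False by (simp add: f_def)
    qed
  qed
  have inj: "inj_on f (?N ?y)"
  proof (rule inj_onI)
    fix b c assume b: "b \<in> ?N ?y" and c: "c \<in> ?N ?y" and e: "f b = f c"
    have R: "b \<in> aroots" "c \<in> aroots" using b c apos_aroots by auto
    \<comment> \<open>In the mixed case \<open>r_a b = c\<close>; but then \<open>r_a c = b\<close>
      is positive, so \<open>c\<close> would have been moved as well.\<close>
    show "b = c"
      using e b c rr[OF R(1)] rr[OF R(2)] unfolding f_def by (metis (no_types, lifting) mem_Collect_eq)
  qed
  have fin: "finite (?N x)" using fin_neg_set x by blast
  have "card (?N ?y) = card (f ` ?N ?y)" using card_image[OF inj] by simp
  also have "\<dots> \<le> card (?N x - {a})" by (rule card_mono) (use fin sub in auto)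
  also have "\<dots> < card (?N x)" by (rule card_Diff1_less) (use fin a n in auto)
  finally show ?thesis unfolding alen_def .
qed

lemma len_ref_greater:
  assumes x: "x \<in> AW" and a: "apos a" and p: "apos (aact pr x a)"
  shows "len x < len (mul x (ref a))"
proof -
  have aR: "a \<in> aroots" using a apos_aroots by blast
  have "aact pr (mul x (ref a)) a = - aact pr x a"
    using aact_mul[OF x ref_AW[OF aR] aR] aact_ref_self[OF aR] aact_minus[OF x aR] by simp
  then have "\<not> apos (aact pr (mul x (ref a)) a)" using p apos_minus[OF aact_aroots[OF x aR]] by simp
  from len_ref_less[OF mul_AW[OF x ref_AW[OF aR]] a this] show ?thesis
    using mul_ref_ref[OF x aR] by simp
qed

text \<open>Of the two affine roots \<plusminus>\<open>a\<close> that define the reflection, the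
  positive one is taken; the length comparison then becomes a sign condition that can be transported
  by conjugation.\<close>

lemma bstep_iff:
  "bstep x y \<longleftrightarrow> x \<in> AW \<and> (\<exists>a. apos a \<and> apos (aact pr x a) \<and> y = mul x (ref a))"
proof
  assume s: "bstep x y"
  then obtain a where a: "a \<in> aroots" "y = mul x (ref a)" "len x < len y" and x: "x \<in> AW"
    unfolding bruhat_step_def by blast
  obtain b where b: "apos b" "y = mul x (ref b)"
    using a apos_minus[OF a(1)] ref_minus[of a] by metis
  have "apos (aact pr x b)" using len_ref_less[OF x b(1)] a(3) b(2) by fastforce
  with b x show "x \<in> AW \<and> (\<exists>a. apos a \<and> apos (aact pr x a) \<and> y = mul x (ref a))" by blast
next
  assume "x \<in> AW \<and> (\<exists>a. apos a \<and> apos (aact pr x a) \<and> y = mul x (ref a))"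
  then show "bstep x y" unfolding bruhat_step_def using len_ref_greater apos_aroots by blast
qed

end

text \<open>Order-theoretic core of the lifting property: \<open>t\<close> is applied along the
  chain until some step is the passage from a point to its \<open>t\<close>-image, and from there
  the original chain is followed.\<close>

lemma rtranclp_lift_right:
  assumes step: "\<And>x y. R x y \<Longrightarrow> R (t x) (t y) \<or> y = t x" and "R\<^sup>*\<^sup>* x y"
  shows "R\<^sup>*\<^sup>* (t x) (t y) \<or> R\<^sup>*\<^sup>* (t x) y"
  using assms(2)
proof (induction rule: converse_rtranclp_induct)
  case (step x z)
  then show ?case using assms(1)[OF step(1)] by (metis converse_rtranclp_into_rtranclp)
qed simp

text \<open>The mirror image: at a step from \<open>z\<close> to \<open>t z\<close>, the involution
  property gives \<open>t (t z) = z\<close>, so the chain that led to \<open>z\<close> already ends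
  at the required point.\<close>

lemma rtranclp_lift_left:
  assumes step: "\<And>x y. R x y \<Longrightarrow> R (t x) (t y) \<or> y = t x"
    and inv: "\<And>x y. R x y \<Longrightarrow> t (t x) = x" and "R\<^sup>*\<^sup>* x y"
  shows "R\<^sup>*\<^sup>* (t x) (t y) \<or> R\<^sup>*\<^sup>* x (t y)"
  using assms(3)
proof (induction rule: rtranclp_induct)
  case (step z y)
  then show ?case using assms(1)[OF step(2)] inv[OF step(2)] by (metis rtranclp.rtrancl_into_rtrancl)
qed simp

context cochar_roots
begin

section \<open>Simple affine roots\<close>

text \<open>Defined by the property that matters, so that no highest roots are needed.\<close>

definition simple_aff :: "'a \<times> int \<Rightarrow> bool" where
  "simple_aff a \<longleftrightarrow> apos a \<and> (\<forall>b. apos b \<longrightarrow> b \<noteq> a \<longrightarrow> apos (aact pr (ref a) b))"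

lemma simple_aff_apos: "simple_aff a \<Longrightarrow> apos a" by (simp add: simple_aff_def)

lemma simple_affD: "simple_aff a \<Longrightarrow> apos b \<Longrightarrow> b \<noteq> a \<Longrightarrow> apos (aact pr (ref a) b)"
  unfolding simple_aff_def by blast

lemma simple_aff_aroots: "simple_aff a \<Longrightarrow> a \<in> aroots" using simple_aff_apos apos_aroots by blast

lemma lx_ref: "\<alpha> \<in> \<Phi> \<Longrightarrow> \<gamma> \<in> \<Phi> \<Longrightarrow> lx (ref (\<alpha>, k)) \<gamma> = k * cpair \<alpha> \<gamma> + pind \<gamma> - pind (refl \<alpha> \<gamma>)"
  by (simp add: lxa_def aref_def pr_emb_coroot)

text \<open>At a higher level, \<open>(\<alpha>, k - 1)\<close> would be a second positive affine
  root made negative by the reflection.\<close>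

lemma simple_aff_level: assumes "simple_aff (\<alpha>, k)" shows "k = pind (- \<alpha>)"
proof (rule ccontr)
  assume ne: "k \<noteq> pind (- \<alpha>)"
  have a: "apos (\<alpha>, k)" "\<alpha> \<in> \<Phi>" using assms simple_aff_apos simple_aff_aroots by auto
  then have k: "k > pind (- \<alpha>)" using ne by (simp add: pos_aff_def order_less_le)
  then have "apos (\<alpha>, k - 1)" using a by (simp add: pos_aff_def)
  then have "apos (aact pr (ref (\<alpha>, k)) (\<alpha>, k - 1))" using assms unfolding simple_aff_def by simp
  moreover have "aact pr (ref (\<alpha>, k)) (\<alpha>, k - 1) = (- \<alpha>, - k - 1)"
    using a(2) by (simp add: aact_ref cpair_self scaleR_2)
  ultimately have "- k - 1 \<ge> pind \<alpha>" by (simp add: pos_aff_def)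
  with k pind_01[of \<alpha>] pind_01[of "-\<alpha>"] show False by linarith
qed

text \<open>The bound is read off at the lowest positive affine root over \<gamma>, which the
  reflection has to keep positive. Used at \<gamma> and -\<gamma> together it becomes an
  equality.\<close>

lemma simple_aff_lx_le:
  assumes "simple_aff (\<alpha>, k)" "\<gamma> \<in> \<Phi>" "\<gamma> \<noteq> \<alpha>" shows "lx (ref (\<alpha>, k)) \<gamma> \<le> 0"
proof -
  have a: "\<alpha> \<in> \<Phi>" using assms simple_aff_aroots by auto
  have "apos (\<gamma>, pind (- \<gamma>))" using assms by (simp add: pos_aff_def)
  then have "apos (aact pr (ref (\<alpha>, k)) (\<gamma>, pind (- \<gamma>)))" using assms unfolding simple_aff_def by simp
  moreover have "aact pr (ref (\<alpha>, k)) (\<gamma>, pind (- \<gamma>)) = (refl \<alpha> \<gamma>, pind (- \<gamma>) - cpair \<alpha> \<gamma> * k)"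
    using a assms(2) by (simp add: aact_ref refl_cpair)
  ultimately have "pind (- \<gamma>) - cpair \<alpha> \<gamma> * k \<ge> pind (- refl \<alpha> \<gamma>)" by (simp add: pos_aff_def)
  then show ?thesis using a assms(2) by (simp add: lx_ref pind_minus refl_root algebra_simps)
qed

lemma simple_aff_lx_zero:
  assumes "simple_aff (\<alpha>, k)" "\<gamma> \<in> \<Phi>" "\<gamma> \<noteq> \<alpha>" "\<gamma> \<noteq> - \<alpha>" shows "lx (ref (\<alpha>, k)) \<gamma> = 0"
proof -
  have "lx (ref (\<alpha>, k)) (- \<gamma>) \<le> 0"
    by (rule simple_aff_lx_le) (use assms minus_root in auto)
  then show ?thesis
    using simple_aff_lx_le[OF assms(1-3)] lx_minus[OF ref_AW[OF simple_aff_aroots[OF assms(1)]] assms(2)] by simp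
qed

lemma simple_aff_lx_self: assumes "simple_aff (\<alpha>, k)" shows "lx (ref (\<alpha>, k)) \<alpha> = 1"
proof -
  have a: "\<alpha> \<in> \<Phi>" using assms simple_aff_aroots by auto
  then show ?thesis using simple_aff_level[OF assms]
    by (simp add: lx_ref cpair_self refl_root_self pind_minus)
qed

lemma simple_aff_lx_ge:
  assumes "simple_aff (\<alpha>, k)" "\<gamma> \<in> \<Phi>" "\<gamma> \<noteq> - \<alpha>" shows "lx (ref (\<alpha>, k)) \<gamma> \<ge> 0"
  using simple_aff_lx_zero[OF assms(1,2)] simple_aff_lx_self[OF assms(1)] assms(3) by (cases "\<gamma> = \<alpha>") auto

lemma simple_aff_lx_le_1:
  assumes "simple_aff (\<alpha>, k)" "\<gamma> \<in> \<Phi>" shows "lx (ref (\<alpha>, k)) \<gamma> \<le> 1"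
  using simple_aff_lx_le[OF assms] simple_aff_lx_self[OF assms(1)] by (cases "\<gamma> = \<alpha>") auto

text \<open>The link to the quantum Bruhat graph: the level of a simple affine root is determined,
  so its finite part carries all the information.\<close>

lemma simple_aff_affine_simple: assumes "simple_aff (\<alpha>, k)" shows "affine_simple \<alpha>"
proof -
  have a: "\<alpha> \<in> \<Phi>" using assms simple_aff_aroots by auto
  show ?thesis unfolding affine_simple_def
    using a simple_aff_lx_zero[OF assms] by (auto simp: lx_ref simple_aff_level[OF assms])
qed

lemma cpair_sym_pos: assumes "\<alpha> \<in> \<Phi>" "\<beta> \<in> \<Phi>" "cpair \<alpha> \<beta> > 0" shows "cpair \<beta> \<alpha> > 0"
proof -
  have nz: "\<alpha> \<bullet> \<alpha> > 0" "\<beta> \<bullet> \<beta> > 0" using assms root_nz inner_gt_zero_iff by blast+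
  have "coroot \<alpha> \<bullet> \<beta> > 0" using assms of_int_cpair by (metis of_int_0_less_iff)
  then have "\<alpha> \<bullet> \<beta> > 0" using nz by (simp add: coroot_def zero_less_mult_iff zero_less_divide_iff)
  then have "coroot \<beta> \<bullet> \<alpha> > 0" using nz by (simp add: coroot_def inner_commute)
  then show ?thesis using assms of_int_cpair by (metis of_int_0_less_iff)
qed

text \<open>Strict Cauchy-Schwarz inequality; proportional roots are excluded by
  reducedness.\<close>

lemma cpair_mult_less_4:
  assumes "\<alpha> \<in> \<Phi>" "\<beta> \<in> \<Phi>" "\<beta> \<noteq> \<alpha>" "\<beta> \<noteq> - \<alpha>" shows "cpair \<alpha> \<beta> * cpair \<beta> \<alpha> < 4"
proof -
  have nz: "\<alpha> \<bullet> \<alpha> > 0" "\<beta> \<bullet> \<beta> > 0" using assms root_nz inner_gt_zero_iff by blast+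
  define t where "t = (\<alpha> \<bullet> \<beta>) / (\<alpha> \<bullet> \<alpha>)"
  have "\<beta> - t *\<^sub>R \<alpha> \<noteq> 0"
  proof
    assume "\<beta> - t *\<^sub>R \<alpha> = 0"
    then have "\<beta> = t *\<^sub>R \<alpha>" by simp
    then show False using root_multiple[OF assms(1), of t] assms by auto
  qed
  then have "0 < (\<beta> - t *\<^sub>R \<alpha>) \<bullet> (\<beta> - t *\<^sub>R \<alpha>)" by simp
  also have "\<dots> = \<beta> \<bullet> \<beta> - (\<alpha> \<bullet> \<beta>) * (\<alpha> \<bullet> \<beta>) / (\<alpha> \<bullet> \<alpha>)"
    using nz unfolding t_def by (simp add: inner_diff_left inner_diff_right inner_commute field_simps)
  finally have "(\<alpha> \<bullet> \<beta>) * (\<alpha> \<bullet> \<beta>) < (\<alpha> \<bullet> \<alpha>) * (\<beta> \<bullet> \<beta>)" using nz by (simp add: field_simps)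
  then have "(coroot \<alpha> \<bullet> \<beta>) * (coroot \<beta> \<bullet> \<alpha>) < 4"
    using nz by (simp add: coroot_def inner_commute field_simps)
  then have "real_of_int (cpair \<alpha> \<beta> * cpair \<beta> \<alpha>) < of_int 4" using assms by (simp add: of_int_cpair)
  then show ?thesis by linarith
qed

text \<open>Among the positive affine roots made negative by \<open>x\<close>, one of least \<open>aff\<close>-value is simple: otherwise
  a rank two computation splits it into two positive affine roots, one of which is again made negative.\<close>

lemma ex_simple_aff_neg:
  assumes x: "x \<in> AW" and b0: "apos b0" "\<not> apos (aact pr x b0)"
  shows "\<exists>a. simple_aff a \<and> \<not> apos (aact pr x a)"
proof -
  let ?N = "{a. apos a \<and> \<not> apos (aact pr x a)}"
  have fin: "finite (aff ` ?N)" using fin_neg_set[OF x] by blast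
  have "Min (aff ` ?N) \<in> aff ` ?N" by (rule Min_in[OF fin]) (use b0 in blast)
  then obtain a where a: "apos a" "\<not> apos (aact pr x a)" and amin: "aff a = Min (aff ` ?N)" by auto
  have aR: "a \<in> aroots" using a apos_aroots by blast
  have low: False if "apos p" "\<not> apos (aact pr x p)" "aff p < aff a" for p
    using that amin Min_le[OF fin, of "aff p"] by auto
  have xa: "aff (aact pr x a) < 0" using a(2) aff_sign[OF aact_aroots[OF x aR]] by auto
  have dec: False if pq: "apos p" "apos q" "p + q = a" for p q
  proof -
    have R: "p \<in> aroots" "q \<in> aroots" using pq apos_aroots by blast+
    have pos: "aff p > 0" "aff q > 0" using pq aff_sign R by blast+
    have s: "aff p + aff q = aff a" using pq(3) aff_add by metis
    have "aff (aact pr x p) + aff (aact pr x q) = aff (aact pr x a)"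
      using aact_add[OF x R] aff_add pq(3) by metis
    then have "aff (aact pr x p) < 0 \<or> aff (aact pr x q) < 0" using xa by linarith
    then have "\<not> apos (aact pr x p) \<or> \<not> apos (aact pr x q)"
      using aff_sign(1)[OF aact_aroots[OF x R(1)]] aff_sign(1)[OF aact_aroots[OF x R(2)]] by linarith
    moreover have "aff p < aff a" "aff q < aff a" using s pos by linarith+
    ultimately show False using low pq by blast
  qed
  have "apos (aact pr (ref a) b)" if b: "apos b" "b \<noteq> a" for b
  proof (rule ccontr)
    assume nb: "\<not> apos (aact pr (ref a) b)"
    have bR: "b \<in> aroots" using b apos_aroots by blast
    obtain \<alpha> k where a': "a = (\<alpha>, k)" "\<alpha> \<in> \<Phi>" using aR by auto
    obtain \<beta> j where b': "b = (\<beta>, j)" "\<beta> \<in> \<Phi>" using bR by auto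
    \<comment> \<open>The root \<open>c\<close> is positive and \<open>b + c = n a\<close>. With
      \<open>m\<close> introduced below, only the rank two possibilities n m < 4 remain.\<close>
    define n where "n = cpair \<alpha> \<beta>"
    define c where "c = - aact pr (ref a) b"
    have rR: "aact pr (ref a) b \<in> aroots" using aact_aroots ref_AW aR bR by blast
    have c: "apos c" unfolding c_def using apos_minus[OF rR] nb by blast
    have cR: "c \<in> aroots" using c apos_aroots by blast
    have c': "c = (of_int n *\<^sub>R \<alpha> - \<beta>, n * k - j)"
      unfolding c_def a'(1) b'(1) using a' b' by (simp add: aact_ref n_def)
    have fpos: "aff a > 0" "aff b > 0" "aff c > 0"       using a b c aff_sign(1)[OF aR] aff_sign(1)[OF bR] aff_sign(1)[OF cR] by simp_all
    have fsum: "aff b + aff c = of_int n * aff a"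
      unfolding c' a' b' aff_def by (simp add: ht_diff ht_scale algebra_simps)
    then have "of_int n * aff a > 0" using fpos by linarith
    then have n: "n > 0" using fpos by (simp add: zero_less_mult_iff)
    \<comment> \<open>Over \<alpha> itself a lower level would contradict the choice of
      \<open>a\<close>: lowering the level also lowers the \<open>aff\<close>-value of the image
      under \<open>x\<close>.\<close>
    have below: False if i: "apos (\<alpha>, i)" "i < k" for i
    proof (rule low[OF i(1)])
      have "affM * of_int (i - k) < 0" using affM_pos i(2) by (simp add: mult_pos_neg)
      then have l: "aff (\<alpha>, i) < aff a" "aff (aact pr x (\<alpha>, i)) < aff (aact pr x a)"
        unfolding a' aff_def aact_def by (auto simp: algebra_simps split: prod.splits)
      then show "aff (\<alpha>, i) < aff a" by blast
      have "(\<alpha>, i) \<in> aroots" using a' by simp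
      then show "\<not> apos (aact pr x (\<alpha>, i))"
        using l(2) xa aff_sign(1)[OF aact_aroots[OF x]] by force
    qed
    show False
    proof (cases "\<beta> = \<alpha>")
      case True
      then have n2: "n = 2" using a' cpair_self n_def by simp
      have "j \<noteq> k" using True a' b' b(2) by simp
      then consider "j < k" | "2 * k - j < k" by linarith
      then show False
      proof cases
        case 1 then show ?thesis using below[of j] b b' True by simp
      next
        case 2
        have "c = (\<alpha>, 2 * k - j)" unfolding c' n2 True by (simp add: scaleR_2)
        then show ?thesis using below[OF _ 2] c by simp
      qed
    next
      case False
      have "\<beta> \<noteq> - \<alpha>"
        using n a' cpair_minus_right[OF a'(2) a'(2)] cpair_self[OF a'(2)] unfolding n_def by auto
      define m where "m = cpair \<beta> \<alpha>"
      have nm: "n * m < 4" unfolding n_def m_def by (rule cpair_mult_less_4) fact+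
      have m: "m > 0" using n cpair_sym_pos a' b' unfolding n_def m_def by blast
      have ex: "apos (p - a)" if p: "apos p" "cpair (fst p) \<alpha> = 1" for p
      proof (rule ccontr)
        assume np: "\<not> apos (p - a)"
        have pR: "p \<in> aroots" using p apos_aroots by blast
        have "\<alpha> - fst p = refl (fst p) \<alpha>" using pR p(2) a' by (auto simp: refl_cpair)
        also have "\<dots> \<in> \<Phi>" using pR a' refl_root by auto
        finally have "a - p \<in> aroots" using a' by (cases p) simp
        then have "apos (a - p)" using np apos_minus[of "a - p"] by simp
        then show False using dec[of p "a - p"] p by simp
      qed
      show False
      proof (cases "n = 1")
        case True
        then have "b + c = a" unfolding a' b' c' by simp
        then show False using dec b c by blast
      next
        case False
        then have n2: "n \<ge> 2" using n by simp
        have m1: "m = 1"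
        proof (rule ccontr)
          assume "m \<noteq> 1"
          then have "m \<ge> 2" using m by simp
          then have "2 * 2 \<le> n * m" using n2 by (intro mult_mono) auto
          then show False using nm by simp
        qed
        \<comment> \<open>The remaining case is m = 1, for \<open>c\<close> as well as for
          \<open>b\<close>. Then \<open>b - a\<close> and \<open>c - a\<close> are positive with sum
          \<open>(n - 2) a\<close>, which forces n = 3 and gives a forbidden splitting of
          \<open>a\<close>.\<close>
        have b1: "apos (b - a)" using ex[OF b(1)] m1 m_def b' by simp
        have "fst c = - refl \<alpha> \<beta>" using c' a' b' by (simp add: refl_cpair n_def)
        then have "cpair (fst c) \<alpha> = - cpair (refl \<alpha> \<beta>) \<alpha>"
          using cpair_minus_left[OF refl_root[OF a'(2) b'(2)] a'(2)] by simp
        also have "cpair (refl \<alpha> \<beta>) \<alpha> = cpair \<beta> (refl \<alpha> \<alpha>)"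
          using cpair_weyl[OF refl_weyl[OF a'(2)], of \<beta> "refl \<alpha> \<alpha>"] by (simp add: refl_refl)
        also have "\<dots> = - m" using a' b' by (simp add: refl_root_self cpair_minus_right m_def)
        finally have c1: "apos (c - a)" using ex[OF c] m1 by simp
        have R: "b - a \<in> aroots" "c - a \<in> aroots" using b1 c1 apos_aroots by blast+
        have "aff (b - a) > 0" "aff (c - a) > 0" using b1 c1 aff_sign(1)[OF R(1)] aff_sign(1)[OF R(2)] by simp_all
        moreover have "aff (b - a) = aff b - aff a" "aff (c - a) = aff c - aff a"
          using aff_add[of "b - a" a] aff_add[of "c - a" a] by auto
        ultimately have "of_int n * aff a > 2 * aff a" using fsum by linarith
        then have "n > 2" using fpos by (simp add: mult_less_cancel_right)
        moreover have "n < 4" using nm m1 by simp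
        ultimately have n3: "n = 3" by linarith
        have e: "of_int 3 *\<^sub>R \<alpha> = 2 *\<^sub>R \<alpha> + \<alpha>" using scaleR_left_distrib[of 2 1 \<alpha>] by simp
        have "\<beta> - \<alpha> + (of_int 3 *\<^sub>R \<alpha> - \<beta> - \<alpha>) = \<alpha>" unfolding e scaleR_2 by simp
        then have "(b - a) + (c - a) = a" unfolding a'(1) b'(1) c' n3 diff_Pair add_Pair by (simp only: prod.inject) simp
        then show False using dec b1 c1 by blast
      qed
    qed
  qed
  then show ?thesis using a unfolding simple_aff_def by blast
qed

section \<open>Bruhat order\<close>

lemma bstep_AW: "bstep x y \<Longrightarrow> x \<in> AW \<and> y \<in> AW"
  unfolding bstep_iff using mul_AW ref_AW apos_aroots by blast

lemma bstep_len: "bstep x y \<Longrightarrow> len x < len y"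
  unfolding bruhat_step_def by blast

lemma ble_refl: "ble x x" by (simp add: bruhat_le_def)

lemma ble_trans: "ble x y \<Longrightarrow> ble y z \<Longrightarrow> ble x z"
  unfolding bruhat_le_def by (rule rtranclp_trans)

lemma bstep_ble: "bstep x y \<Longrightarrow> ble x y" by (simp add: bruhat_le_def r_into_rtranclp)

lemma ble_cases: "ble x y \<Longrightarrow> x = y \<or> len x < len y"
  unfolding bruhat_le_def
proof (induction rule: rtranclp_induct)
  case (step y z) then show ?case using bstep_len[OF step(2)] by auto
qed simp

lemma ble_AW: "ble x y \<Longrightarrow> y \<in> AW \<Longrightarrow> x \<in> AW"
  unfolding bruhat_le_def by (induction rule: converse_rtranclp_induct) (auto dest: bstep_AW)

lemma bstep_up: "x \<in> AW \<Longrightarrow> apos a \<Longrightarrow> apos (aact pr x a) \<Longrightarrow> bstep x (mul x (ref a))"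
  unfolding bstep_iff by blast

lemma bstep_down:
  assumes "x \<in> AW" "apos a" "\<not> apos (aact pr x a)" shows "bstep (mul x (ref a)) x"
proof -
  have aR: "a \<in> aroots" using assms apos_aroots by blast
  have "aact pr (mul x (ref a)) a = - aact pr x a"
    using aact_mul[OF assms(1) ref_AW[OF aR] aR] aact_ref_self[OF aR] aact_minus[OF assms(1) aR] by simp
  then have "apos (aact pr (mul x (ref a)) a)" using assms apos_minus[OF aact_aroots[OF assms(1) aR]] by simp
  then show ?thesis using bstep_up[OF mul_AW[OF assms(1) ref_AW[OF aR]] assms(2)] mul_ref_ref[OF assms(1) aR] by simp
qed

text \<open>Conjugating \<open>r_b\<close> by the simple reflection gives the reflection in the
  image of \<open>b\<close>, which stays positive unless \<open>b = a\<close>; in the exceptional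
  case the step is the multiplication itself.\<close>

lemma bstep_right:
  assumes a: "simple_aff a" and s: "bstep x y"
  shows "bstep (mul x (ref a)) (mul y (ref a)) \<or> y = mul x (ref a)"
proof -
  obtain b where b: "apos b" "apos (aact pr x b)" "y = mul x (ref b)" and x: "x \<in> AW"
    using s unfolding bstep_iff by blast
  have aR: "a \<in> aroots" using a simple_aff_aroots by blast
  have bR: "b \<in> aroots" using b apos_aroots by blast
  note rW = ref_AW[OF aR]
  let ?b = "aact pr (ref a) b"
  show ?thesis
  proof (cases "b = a")
    case True then show ?thesis using b by simp
  next
    case False
    then have pb: "apos ?b" using a b unfolding simple_aff_def by blast
    have cR: "?b \<in> aroots" using pb apos_aroots by blast
    have bb: "aact pr (ref a) ?b = b"
      using aact_mul[OF rW rW bR] ref_ref[OF aR] aact_one by simp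
    have "mul (ref b) (ref a) = mul (ref a) (ref ?b)" using ref_conj[OF rW cR] bb by simp
    then have "mul y (ref a) = mul (mul x (ref a)) (ref ?b)"
      using b(3) mul_assoc[OF x ref_AW[OF bR] rW] mul_assoc[OF x rW ref_AW[OF cR]] by simp
    moreover have "apos (aact pr (mul x (ref a)) ?b)"
      using aact_mul[OF x rW cR] bb b(2) by simp
    ultimately show ?thesis using bstep_up[OF mul_AW[OF x rW] pb] by simp
  qed
qed

text \<open>The reflecting root \<open>b\<close> is kept; what must stay positive is the image
  \<open>x b\<close>, and it does unless it equals \<open>a\<close>.\<close>

lemma bstep_left:
  assumes a: "simple_aff a" and s: "bstep x y"
  shows "bstep (mul (ref a) x) (mul (ref a) y) \<or> y = mul (ref a) x"
proof -
  obtain b where b: "apos b" "apos (aact pr x b)" "y = mul x (ref b)" and x: "x \<in> AW"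
    using s unfolding bstep_iff by blast
  have aR: "a \<in> aroots" using a simple_aff_aroots by blast
  have bR: "b \<in> aroots" using b apos_aroots by blast
  note rW = ref_AW[OF aR]
  show ?thesis
  proof (cases "aact pr x b = a")
    case True then show ?thesis using b ref_conj[OF x bR] by simp
  next
    case False
    then have "apos (aact pr (mul (ref a) x) b)"
      using simple_affD[OF a b(2)] aact_mul[OF rW x bR] by simp
    moreover have "mul (ref a) y = mul (mul (ref a) x) (ref b)"
      using b(3) mul_assoc[OF rW x ref_AW[OF bR]] by simp
    ultimately show ?thesis using bstep_up[OF mul_AW[OF rW x] b(1)] by simp
  qed
qed

lemma ble_right_lift:
  assumes "simple_aff a" "ble x y"
  shows "ble (mul x (ref a)) (mul y (ref a)) \<or> ble (mul x (ref a)) y"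
    and "ble (mul x (ref a)) (mul y (ref a)) \<or> ble x (mul y (ref a))"
proof -
  let ?t = "\<lambda>x. mul x (ref a)"
  have s: "bstep (?t x) (?t y) \<or> y = ?t x" if "bstep x y" for x y
    using bstep_right[OF assms(1) that] .
  have i: "?t (?t x) = x" if "bstep x y" for x y
    using mul_ref_ref bstep_AW[OF that] simple_aff_aroots[OF assms(1)] by blast
  show "ble (?t x) (?t y) \<or> ble (?t x) y"
    using rtranclp_lift_right[of bstep ?t x y] s assms(2) unfolding bruhat_le_def by blast
  show "ble (?t x) (?t y) \<or> ble x (?t y)"
    using rtranclp_lift_left[of bstep ?t x y] s i assms(2) unfolding bruhat_le_def by blast
qed

lemma ble_left_lift:
  assumes "simple_aff a" "ble x y"
  shows "ble (mul (ref a) x) (mul (ref a) y) \<or> ble (mul (ref a) x) y"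
    and "ble (mul (ref a) x) (mul (ref a) y) \<or> ble x (mul (ref a) y)"
proof -
  let ?t = "\<lambda>x. mul (ref a) x"
  have s: "bstep (?t x) (?t y) \<or> y = ?t x" if "bstep x y" for x y
    using bstep_left[OF assms(1) that] .
  have i: "?t (?t x) = x" if "bstep x y" for x y
    using ref_ref_mul bstep_AW[OF that] simple_aff_aroots[OF assms(1)] by blast
  show "ble (?t x) (?t y) \<or> ble (?t x) y"
    using rtranclp_lift_right[of bstep ?t x y] s assms(2) unfolding bruhat_le_def by blast
  show "ble (?t x) (?t y) \<or> ble x (?t y)"
    using rtranclp_lift_left[of bstep ?t x y] s i assms(2) unfolding bruhat_le_def by blast
qed

section \<open>Products of lower sets in the Bruhat order\<close>

definition product_set :: "('a \<Rightarrow> 'a) \<times> 'x \<Rightarrow> ('a \<Rightarrow> 'a) \<times> 'x \<Rightarrow> (('a \<Rightarrow> 'a) \<times> 'x) set" where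
  "product_set x1 x2 = {mul y1 y2 | y1 y2. ble y1 x1 \<and> ble y2 x2}"

lemma product_setI: "ble y1 x1 \<Longrightarrow> ble y2 x2 \<Longrightarrow> mul y1 y2 = z \<Longrightarrow> z \<in> product_set x1 x2"
  unfolding product_set_def by blast

lemma product_setE:
  assumes "z \<in> product_set x1 x2" obtains y1 y2 where "z = mul y1 y2" "ble y1 x1" "ble y2 x2"
  using assms unfolding product_set_def by blast

lemma product_set_mono: "ble y x \<Longrightarrow> product_set y z \<subseteq> product_set x z"
  by (auto elim!: product_setE intro: product_setI ble_trans)

text \<open>A product does not change when the simple reflection is inserted twice between its
  factors. The lifting property says that one of the two factorizations stays below the shifted
  bounds; \<open>X\<close> is the larger of \<open>x1\<close> and \<open>x1\<close> times the
  reflection.\<close>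

lemma product_set_simple:
  assumes a: "simple_aff a" and x1: "x1 \<in> AW" and x2: "x2 \<in> AW"
    and up2: "ble x2 (mul (ref a) x2)"
    and X: "(ble x1 (mul x1 (ref a)) \<and> X = mul x1 (ref a)) \<or> (ble (mul x1 (ref a)) x1 \<and> X = x1)"
  shows "product_set x1 (mul (ref a) x2) = product_set X x2"
proof -
  have aR: "a \<in> aroots" using a simple_aff_aroots by blast
  note rW = ref_AW[OF aR]
  have leX: "ble x1 X" "ble (mul x1 (ref a)) X" using X ble_refl[of x1] ble_refl[of "mul x1 (ref a)"] by auto
  have swap: "mul (mul y1 (ref a)) (mul (ref a) y2) = mul y1 y2" if "y1 \<in> AW" "y2 \<in> AW" for y1 y2
    using mul_assoc[OF that(1) rW mul_AW[OF rW that(2)]] ref_ref_mul[OF that(2) aR] by simp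
  show ?thesis
  proof (intro equalityI subsetI)
    fix z assume "z \<in> product_set x1 (mul (ref a) x2)"
    then obtain y1 y2 where y: "z = mul y1 y2" "ble y1 x1" "ble y2 (mul (ref a) x2)"
      by (rule product_setE)
    have yW: "y1 \<in> AW" "y2 \<in> AW" using ble_AW[OF y(2) x1] ble_AW[OF y(3) mul_AW[OF rW x2]] .
    from ble_left_lift(2)[OF a y(3)] ref_ref_mul[OF x2 aR]
    consider "ble (mul (ref a) y2) x2" | "ble y2 x2" by auto
    then show "z \<in> product_set X x2"
    proof cases
      case 1
      have "ble (mul y1 (ref a)) X" using ble_right_lift(1)[OF a y(2)] leX ble_trans by blast
      then show ?thesis using product_setI[OF _ 1] swap[OF yW] y(1) by simp
    next
      case 2
      then show ?thesis using product_setI[OF ble_trans[OF y(2) leX(1)] 2] y(1) by simp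
    qed
  next
    fix z assume "z \<in> product_set X x2"
    then obtain y1 y2 where y: "z = mul y1 y2" "ble y1 X" "ble y2 x2"
      by (rule product_setE)
    have XW: "X \<in> AW" using X x1 mul_AW[OF x1 rW] by blast
    have yW: "y1 \<in> AW" "y2 \<in> AW" using ble_AW[OF y(2) XW] ble_AW[OF y(3) x2] .
    have y2: "ble y2 (mul (ref a) x2)" using y(3) up2 ble_trans by blast
    have sy2: "ble (mul (ref a) y2) (mul (ref a) x2)"
      using ble_left_lift(1)[OF a y(3)] up2 ble_trans by blast
    have "ble y1 x1 \<or> ble (mul y1 (ref a)) x1"
    proof (cases "X = x1")
      case False
      then have "X = mul x1 (ref a)" using X by blast
      then show ?thesis using ble_right_lift(2)[OF a y(2)] mul_ref_ref[OF x1 aR] by auto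
    qed (use y in simp)
    then show "z \<in> product_set x1 (mul (ref a) x2)"
    proof
      assume "ble y1 x1" then show ?thesis using product_setI[OF _ y2] y(1) by simp
    next
      assume "ble (mul y1 (ref a)) x1"
      then show ?thesis using product_setI[OF _ sy2] swap[OF yW] y(1) by simp
    qed
  qed
qed

text \<open>The level is the lowest positive one over \<alpha>; for a simple affine root it is the
  level of that root.\<close>

lemma right_apos_iff:
  assumes "x \<in> AW" "\<alpha> \<in> \<Phi>" shows "apos (aact pr x (\<alpha>, pind (- \<alpha>))) \<longleftrightarrow> lx x \<alpha> \<le> 0"
  using assms by (cases x) (auto simp: AW_iff pos_aff_def aact_def lxa_def weyl_root pind_minus)

lemma left_ref_cases:
  assumes a: "simple_aff (\<alpha>, k)" and w: "w \<in> W"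
  shows "lx (w, \<mu>) (inv w \<alpha>) \<ge> 0 \<Longrightarrow> bstep (w, \<mu>) (mul (ref (\<alpha>, k)) (w, \<mu>))"
    and "lx (w, \<mu>) (inv w \<alpha>) < 0 \<Longrightarrow> bstep (mul (ref (\<alpha>, k)) (w, \<mu>)) (w, \<mu>)"
proof -
  let ?t = "inv w \<alpha>" and ?x = "(w, \<mu>)"
  \<comment> \<open>The preimage of the simple root under \<open>?x\<close>, so that left
    multiplication becomes right multiplication by \<open>ref b\<close>.\<close>
  define b where "b = (?t, k + pr \<mu> ?t)"
  have aR: "\<alpha> \<in> \<Phi>" using a simple_aff_aroots by auto
  have tR: "?t \<in> \<Phi>" using weyl_root inv_weyl w aR by blast
  have bR: "b \<in> aroots" using tR by (simp add: b_def)
  have x: "?x \<in> AW" using w by (simp add: AW_iff)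
  have xb: "aact pr ?x b = (\<alpha>, k)" by (simp add: aact_def b_def weyl_inv_app w)
  have eq: "mul (ref (\<alpha>, k)) ?x = mul ?x (ref b)" using ref_conj[OF x bR] xb by simp
  have ap: "apos (\<alpha>, k)" using a simple_aff_apos by blast
  have bpos: "apos b \<longleftrightarrow> lx ?x ?t \<ge> 0"
    using tR aR simple_aff_level[OF a] by (auto simp: b_def pos_aff_def lxa_def weyl_inv_app w pind_minus)
  show "lx ?x ?t \<ge> 0 \<Longrightarrow> bstep ?x (mul (ref (\<alpha>, k)) ?x)"
    unfolding eq using bstep_up[OF x] bpos xb ap by simp
  show "bstep (mul (ref (\<alpha>, k)) ?x) ?x" if "lx ?x ?t < 0"
  proof -
    have nb: "apos (- b)" using bpos that apos_minus[OF bR] by simp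
    have "\<not> apos (aact pr ?x (- b))"
      using aact_minus[OF x bR] xb ap apos_minus[of "(\<alpha>, k)"] aR by simp
    from bstep_down[OF x nb this] show ?thesis unfolding eq ref_minus .
  qed
qed


section \<open>Length positive elements\<close>

text \<open>The pairing of \<mu> with 2\<rho>.\<close>

definition rho_pair :: "'x \<Rightarrow> int" where "rho_pair \<mu> = (\<Sum>\<beta>\<in>P. pr \<mu> \<beta>)"

lemma rho_pair_add: "rho_pair (\<mu> + \<nu>) = rho_pair \<mu> + rho_pair \<nu>"
  by (simp add: rho_pair_def pr_add_left sum.distrib)

lemma rho_pair_diff: "rho_pair (\<mu> - \<nu>) = rho_pair \<mu> - rho_pair \<nu>"
  by (simp add: rho_pair_def pr_diff_left sum_subtractf)

lemma rho_pair_emb_coroot: "\<alpha> \<in> \<Phi> \<Longrightarrow> rho_pair (emb (of_int n *\<^sub>R coroot \<alpha>)) = n * rho_height \<alpha>"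
  unfolding rho_pair_def rho_height_def sum_distrib_left by (rule sum.cong) (simp_all add: pr_emb_coroot pos_is_root)

text \<open>A translation part plus a difference of two finite lengths: along products and paths
  these differences telescope.\<close>

lemma directed_len_formula:
  assumes "w \<in> W" "v \<in> W"
  shows "directed_len v (w, \<mu>) = rho_pair (act (inv v) \<mu>) - inversions v + inversions (w \<circ> v)"
proof -
  have "directed_len v (w, \<mu>) = (\<Sum>\<beta>\<in>P. pr (act (inv v) \<mu>) \<beta> - (1 - pind (v \<beta>)) + (1 - pind ((w \<circ> v) \<beta>)))"
    unfolding directed_len_def by (rule sum.cong) (simp_all add: lxa_def pr_act_inv assms pos_is_root)
  then show ?thesis unfolding rho_pair_def inversions_def by (simp only: sum.distrib sum_subtractf)
qed

text \<open>The effect of replacing \<open>v\<close> by \<open>v \<circ> refl \<beta>\<close> on the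
  directed length. When \<ell>(x, v\<beta>) vanishes, only the excesses at \<open>v\<close> and at
  \<open>w \<circ> v\<close> matter.\<close>

lemma directed_len_refl:
  assumes w: "w \<in> W" and v: "v \<in> W" and b: "\<beta> \<in> P"
  shows "directed_len (v \<circ> refl \<beta>) (w, \<mu>) = directed_len v (w, \<mu>) - rho_height \<beta> * lx (w, \<mu>) (v \<beta>) - edge_excess v \<beta> + edge_excess (w \<circ> v) \<beta>"
proof -
  have bR: "\<beta> \<in> \<Phi>" using b pos_is_root by blast
  have vb: "v \<circ> refl \<beta> \<in> W" using v bR refl_weyl comp_weyl by blast
  have vR: "v \<beta> \<in> \<Phi>" "w (v \<beta>) \<in> \<Phi>" using v w bR weyl_root by auto
  have "rho_pair (act (inv (v \<circ> refl \<beta>)) \<mu>) = (\<Sum>\<gamma>\<in>P. pr \<mu> (v \<gamma>) - cpair \<beta> \<gamma> * pr \<mu> (v \<beta>))"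
    unfolding rho_pair_def
  proof (rule sum.cong)
    fix \<gamma> assume "\<gamma> \<in> P"
    then have g: "\<gamma> \<in> \<Phi>" using pos_is_root by blast
    have "pr (act (inv (v \<circ> refl \<beta>)) \<mu>) \<gamma> = pr \<mu> (v (refl \<beta> \<gamma>))"
      using pr_act_inv[OF vb g] by simp
    also have "v (refl \<beta> \<gamma>) = refl (v \<beta>) (v \<gamma>)" using refl_weyl_app[OF v] by simp
    finally show "pr (act (inv (v \<circ> refl \<beta>)) \<mu>) \<gamma> = pr \<mu> (v \<gamma>) - cpair \<beta> \<gamma> * pr \<mu> (v \<beta>)"
      using pr_refl[OF vR(1) weyl_root[OF v g]] cpair_weyl[OF v] by (simp only:)
  qed simp
  also have "\<dots> = rho_pair (act (inv v) \<mu>) - rho_height \<beta> * pr \<mu> (v \<beta>)"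
    unfolding rho_pair_def rho_height_def sum_distrib_right sum_subtractf
    by (simp add: pr_act_inv v pos_is_root)
  finally have 1: "rho_pair (act (inv (v \<circ> refl \<beta>)) \<mu>) = rho_pair (act (inv v) \<mu>) - rho_height \<beta> * pr \<mu> (v \<beta>)" .
  have 2: "edge_excess v \<beta> = inversions (v \<circ> refl \<beta>) - inversions v + (1 - pind (v \<beta>)) * rho_height \<beta>"
    unfolding edge_excess_def by (simp add: pind_minus vR)
  have 3: "edge_excess (w \<circ> v) \<beta> = inversions (w \<circ> (v \<circ> refl \<beta>)) - inversions (w \<circ> v) + (1 - pind (w (v \<beta>))) * rho_height \<beta>"
    unfolding edge_excess_def comp_assoc by (simp add: pind_minus vR)
  show ?thesis unfolding directed_len_formula[OF w vb] directed_len_formula[OF w v] 1 2 3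
    by (simp add: lxa_def algebra_simps)
qed

text \<open>Going forth and back along \<beta>, the inversions cancel, and exactly one of the two
  weight terms is present.\<close>

lemma edge_excess_comp_refl:
  assumes "u \<in> W" "\<beta> \<in> P" shows "edge_excess (u \<circ> refl \<beta>) \<beta> = rho_height \<beta> - edge_excess u \<beta>"
proof -
  have bR: "\<beta> \<in> \<Phi>" using assms pos_is_root by blast
  then have "u \<beta> \<in> \<Phi>" using weyl_root assms by blast
  moreover have "u \<circ> refl \<beta> \<circ> refl \<beta> = u" by (simp add: comp_assoc refl_comp_refl)
  ultimately show ?thesis unfolding edge_excess_def
    by (simp add: refl_root_self bR weyl_minus assms pind_minus algebra_simps)
qed

text \<open>The directed length does not drop, and it already had the largest possible value, so the
  new element attains it too.\<close>

lemma lp_step: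
  assumes "w \<in> W" "v \<in> lp (w, \<mu>)" "\<beta> \<in> P" "lx (w, \<mu>) (v \<beta>) = 0" "edge_excess v \<beta> \<le> edge_excess (w \<circ> v) \<beta>"
  shows "v \<circ> refl \<beta> \<in> lp (w, \<mu>)"
proof -
  have v: "v \<in> W" using assms lp_weyl by blast
  have x: "(w, \<mu>) \<in> AW" using assms AW_iff by blast
  have vb: "v \<circ> refl \<beta> \<in> W" using v assms(3) pos_is_root refl_weyl comp_weyl by blast
  have "directed_len v (w, \<mu>) = int (len (w, \<mu>))" using directed_len_eq_len_iff[OF x v] assms(2) by blast
  then have "directed_len (v \<circ> refl \<beta>) (w, \<mu>) \<ge> int (len (w, \<mu>))"
    using directed_len_refl[OF assms(1) v assms(3), of \<mu>] assms(4,5) by simp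
  then have "directed_len (v \<circ> refl \<beta>) (w, \<mu>) = int (len (w, \<mu>))" using directed_len_le_len[OF x vb] by linarith
  then show ?thesis using directed_len_eq_len_iff[OF x vb] by blast
qed

lemma lp_edge_source:
  assumes "w \<in> W" "v \<in> lp (w, \<mu>)" "\<beta> \<in> P" "lx (w, \<mu>) (v \<beta>) = 0" "edge_excess v \<beta> = 1"
  shows "v \<circ> refl \<beta> \<in> lp (w, \<mu>)"
  using lp_step[OF assms(1-4)] edge_excess_ge_1[OF comp_weyl[OF assms(1) lp_weyl[OF assms(2)]] assms(3)] assms(5)
  by simp

text \<open>An edge into \<open>w \<circ> v\<close> means that the excess at
  \<open>w \<circ> v\<close> is \<open>rho_height \<beta> - 1\<close>. Since the reverse excess is
  at least 1, no excess along \<beta> is larger, in particular not the one at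
  \<open>v\<close>.\<close>

lemma lp_edge_target:
  assumes "w \<in> W" "v \<in> lp (w, \<mu>)" "\<beta> \<in> P" "lx (w, \<mu>) (v \<beta>) = 0" "edge_excess (w \<circ> v \<circ> refl \<beta>) \<beta> = 1"
  shows "v \<circ> refl \<beta> \<in> lp (w, \<mu>)"
proof -
  have v: "v \<in> W" using assms lp_weyl by blast
  have vb: "v \<circ> refl \<beta> \<in> W" using v assms(3) pos_is_root refl_weyl comp_weyl by blast
  have "edge_excess (w \<circ> v) \<beta> = rho_height \<beta> - 1"
    using edge_excess_comp_refl[OF comp_weyl[OF assms(1) v] assms(3)] assms(5) by simp
  moreover have "edge_excess v \<beta> \<le> rho_height \<beta> - 1"
    using edge_excess_comp_refl[OF v assms(3)] edge_excess_ge_1[OF vb assms(3)] by simp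
  ultimately show ?thesis using lp_step[OF assms(1-4)] by simp
qed

lemma lpI: "v \<in> W \<Longrightarrow> (\<And>\<beta>. \<beta> \<in> P \<Longrightarrow> lx x (v \<beta>) \<ge> 0) \<Longrightarrow> v \<in> lp x"
  by (simp add: LP_def)

lemma lpD: "v \<in> lp x \<Longrightarrow> \<beta> \<in> P \<Longrightarrow> lx x (v \<beta>) \<ge> 0"
  by (simp add: LP_def)

lemma lp_apply_nonneg:
  assumes "v \<in> lp x" "inv v \<gamma> \<in> P" shows "lx x \<gamma> \<ge> 0"
  using lpD[OF assms] weyl_inv_app[OF lp_weyl[OF assms(1)]] by simp

lemma lp_apply_nonpos:
  assumes "x \<in> AW" "v \<in> lp x" "\<gamma> \<in> \<Phi>" "inv v \<gamma> \<notin> P" shows "lx x \<gamma> \<le> 0"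
proof -
  have v: "v \<in> W" using assms lp_weyl by blast
  have "inv v \<gamma> \<in> \<Phi>" using v assms inv_weyl weyl_root by blast
  then have "inv v (- \<gamma>) \<in> P" using assms(4) minus_pos_iff weyl_minus[OF inv_weyl[OF v]] by simp
  then show ?thesis using lp_apply_nonneg[OF assms(2), of "- \<gamma>"] lx_minus[OF assms(1,3)] by simp
qed

text \<open>The functional \<ell>(r_a, -) is negative only at -\<alpha>, and no positive \<beta> is
  sent there by \<open>w \<circ> v\<close> when the preimage of \<alpha> is positive.\<close>

lemma lp_left_ref:
  assumes a: "simple_aff (\<alpha>, k)" and w: "w \<in> W" and v: "v \<in> lp (w, \<mu>)" and p: "inv (w \<circ> v) \<alpha> \<in> P"
  shows "v \<in> lp (mul (ref (\<alpha>, k)) (w, \<mu>))"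
proof (rule lpI)
  show vW: "v \<in> W" using v lp_weyl by blast
  have aR: "\<alpha> \<in> \<Phi>" using a simple_aff_aroots by auto
  have wv: "w \<circ> v \<in> W" using w vW comp_weyl by blast
  fix \<beta> assume b: "\<beta> \<in> P"
  have vb: "v \<beta> \<in> \<Phi>" "w (v \<beta>) \<in> \<Phi>" using b pos_is_root weyl_root vW w by auto
  have "w (v \<beta>) \<noteq> - \<alpha>"
  proof
    assume "w (v \<beta>) = - \<alpha>"
    then have "inv (w \<circ> v) (- \<alpha>) = \<beta>" using weyl_inv_app[OF wv, of \<beta>] by simp
    then have "\<beta> = - inv (w \<circ> v) \<alpha>" using weyl_minus[OF inv_weyl[OF wv]] by simp
    then show False using b p minus_pos_iff pos_is_root by blast
  qed
  then have "lx (ref (\<alpha>, k)) (w (v \<beta>)) \<ge> 0" using simple_aff_lx_ge[OF a vb(2)] by blast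
  then show "lx (mul (ref (\<alpha>, k)) (w, \<mu>)) (v \<beta>) \<ge> 0"
    using lx_mul[of "ref (\<alpha>, k)" w \<mu> "v \<beta>"] ref_AW[of "(\<alpha>, k)"] aR w vb(1) lpD[OF v b]
    by (simp add: AW_iff)
qed

lemma lx_mul_ref:
  assumes "x \<in> AW" "\<alpha> \<in> \<Phi>" "\<gamma> \<in> \<Phi>"
  shows "lx (mul x (ref (\<alpha>, k))) \<gamma> = lx x (refl \<alpha> \<gamma>) + lx (ref (\<alpha>, k)) \<gamma>"
  using lx_mul[OF assms(1) _ assms(3), of "refl \<alpha>"] ref_AW[of "(\<alpha>, k)"] assms by (simp add: aref_def)

lemma lx_mul_ref_self:
  assumes "x \<in> AW" "simple_aff (\<alpha>, k)" shows "lx (mul x (ref (\<alpha>, k))) \<alpha> = 1 - lx x \<alpha>"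
proof -
  have aR: "\<alpha> \<in> \<Phi>" using assms simple_aff_aroots by auto
  then show ?thesis using assms
    by (simp add: lx_mul_ref simple_aff_lx_self refl_root_self lx_minus)
qed

text \<open>At \<alpha> the functional of the longer element is at least 1. This makes
  \<open>inv v \<alpha>\<close> positive and pays for the only place where removing the reflection
  can lower the functional.\<close>

lemma lp_right_ref:
  assumes a: "simple_aff (\<alpha>, k)" and x: "x \<in> AW" and le: "lx x \<alpha> \<le> 0"
    and v: "v \<in> lp (mul x (ref (\<alpha>, k)))"
  shows "refl \<alpha> \<circ> v \<in> lp x" "inv v \<alpha> \<in> P"
proof -
  have aR: "\<alpha> \<in> \<Phi>" using a simple_aff_aroots by auto
  have xs: "mul x (ref (\<alpha>, k)) \<in> AW" using mul_AW x ref_AW aR by simp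
  have vW: "v \<in> W" using v lp_weyl by blast
  have pos: "lx (mul x (ref (\<alpha>, k))) \<alpha> \<ge> 1" using lx_mul_ref_self[OF x a] le by simp
  show "inv v \<alpha> \<in> P" using lp_apply_nonpos[OF xs v aR] pos by force
  show "refl \<alpha> \<circ> v \<in> lp x"
  proof (rule lpI)
    show "refl \<alpha> \<circ> v \<in> W" using comp_weyl refl_weyl aR vW by blast
    fix \<beta> assume b: "\<beta> \<in> P"
    have vb: "v \<beta> \<in> \<Phi>" using b pos_is_root weyl_root vW by blast
    have e: "lx x (refl \<alpha> (v \<beta>)) = lx (mul x (ref (\<alpha>, k))) (v \<beta>) - lx (ref (\<alpha>, k)) (v \<beta>)"
      using lx_mul_ref[OF x aR vb, of k] by simp
    show "lx x ((refl \<alpha> \<circ> v) \<beta>) \<ge> 0"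
    proof (cases "v \<beta> = \<alpha>")
      case True then show ?thesis using e pos simple_aff_lx_self[OF a] by simp
    next
      case False then show ?thesis using e simple_aff_lx_le[OF a vb] lpD[OF v b] by simp
    qed
  qed
qed

text \<open>Needed because the induction replaces the left factor. If \<open>inv v \<alpha>\<close>
  is negative, \<open>refl \<alpha> \<circ> v\<close> works. Otherwise \<ell>(x, \<alpha>) = 0, and
  moving \<open>v\<close> along the edge to \<open>refl \<alpha> \<circ> v\<close> first leads back
  to the negative case.\<close>

lemma lp_right_ref_nonempty:
  assumes a: "simple_aff (\<alpha>, k)" and x: "x \<in> AW" and le: "lx x \<alpha> \<le> 0" and v: "v \<in> lp x"
  shows "lp (mul x (ref (\<alpha>, k))) \<noteq> {}"
proof -
  have aR: "\<alpha> \<in> \<Phi>" using a simple_aff_aroots by auto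
  have neg: "refl \<alpha> \<circ> v \<in> lp (mul x (ref (\<alpha>, k)))" if v: "v \<in> lp x" "inv v \<alpha> \<notin> P" for v
  proof (rule lpI)
    have vW: "v \<in> W" using v lp_weyl by blast
    then show "refl \<alpha> \<circ> v \<in> W" using comp_weyl refl_weyl aR by blast
    fix \<beta> assume b: "\<beta> \<in> P"
    have vb: "v \<beta> \<in> \<Phi>" "refl \<alpha> (v \<beta>) \<in> \<Phi>" using b pos_is_root weyl_root refl_root aR vW by auto
    have "refl \<alpha> (v \<beta>) \<noteq> - \<alpha>"
    proof
      assume "refl \<alpha> (v \<beta>) = - \<alpha>"
      then have "v \<beta> = refl \<alpha> (- \<alpha>)" by (metis refl_refl)
      also have "\<dots> = \<alpha>" using weyl_minus[OF refl_weyl[OF aR], of \<alpha>] refl_root_self[OF aR] by simp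
      finally have "inv v \<alpha> = \<beta>" using weyl_inv_app[OF vW, of \<beta>] by simp
      then show False using v(2) b by simp
    qed
    then have "lx (ref (\<alpha>, k)) (refl \<alpha> (v \<beta>)) \<ge> 0" using simple_aff_lx_ge[OF a vb(2)] by blast
    then show "lx (mul x (ref (\<alpha>, k))) ((refl \<alpha> \<circ> v) \<beta>) \<ge> 0"
      using lx_mul_ref[OF x aR vb(2), of k] lpD[OF v(1) b] by (simp add: refl_refl)
  qed
  show ?thesis
  proof (cases "inv v \<alpha> \<in> P")
    case False then show ?thesis using neg[OF v] by blast
  next
    case True
    obtain w \<mu> where xe: "x = (w, \<mu>)" "w \<in> W" using x AW_iff by (cases x) auto
    have vW: "v \<in> W" using v lp_weyl by blast
    have "lx x \<alpha> = 0" using le lp_apply_nonneg[OF v True] by simp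
    then have "v \<circ> refl (inv v \<alpha>) \<in> lp x"
      using lp_edge_source[OF xe(2), of v \<mu> "inv v \<alpha>"] v True affine_simple_edge[OF simple_aff_affine_simple[OF a] vW True]
      unfolding xe(1) by (simp add: weyl_inv_app vW)
    then have s: "refl \<alpha> \<circ> v \<in> lp x" using refl_comp_weyl[OF vW] by simp
    have "inv (refl \<alpha> \<circ> v) \<alpha> = - inv v \<alpha>"
      using inv_comp_weyl[OF refl_weyl[OF aR] vW] weyl_minus[OF inv_weyl[OF vW]]
      by (simp add: inv_refl refl_root_self aR)
    then have "inv (refl \<alpha> \<circ> v) \<alpha> \<notin> P" using True minus_pos_iff pos_is_root by metis
    then show ?thesis using neg[OF s] by blast
  qed
qed

text \<open>In a length positive direction \<open>v\<close>, the reflection contributes at most 1,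
  and only at \<open>inv v \<alpha>\<close>.\<close>

lemma len_mul_ref_le:
  assumes a: "simple_aff (\<alpha>, k)" and x: "x \<in> AW" and v: "v \<in> lp (mul x (ref (\<alpha>, k)))"
  shows "len (mul x (ref (\<alpha>, k))) \<le> len x + 1"
proof -
  let ?y = "mul x (ref (\<alpha>, k))"
  have aR: "\<alpha> \<in> \<Phi>" using a simple_aff_aroots by auto
  have y: "?y \<in> AW" using mul_AW x ref_AW aR by simp
  have vW: "v \<in> W" using v lp_weyl by blast
  have sv: "refl \<alpha> \<circ> v \<in> W" using comp_weyl refl_weyl aR vW by blast
  have "int (len ?y) = directed_len v ?y" using directed_len_eq_len_iff[OF y vW] v by simp
  also have "\<dots> = directed_len (refl \<alpha> \<circ> v) x + (\<Sum>\<beta>\<in>P. lx (ref (\<alpha>, k)) (v \<beta>))"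
    unfolding directed_len_def sum.distrib[symmetric]
    by (rule sum.cong) (simp_all add: lx_mul_ref x aR weyl_root vW pos_is_root)
  also have "(\<Sum>\<beta>\<in>P. lx (ref (\<alpha>, k)) (v \<beta>)) \<le> (\<Sum>\<beta>\<in>P. if \<beta> = inv v \<alpha> then 1 else 0)"
  proof (rule sum_mono)
    fix \<beta> assume "\<beta> \<in> P"
    then have vb: "v \<beta> \<in> \<Phi>" using pos_is_root weyl_root vW by blast
    show "lx (ref (\<alpha>, k)) (v \<beta>) \<le> (if \<beta> = inv v \<alpha> then 1 else 0)"
      using simple_aff_lx_le_1[OF a vb] simple_aff_lx_le[OF a vb] weyl_inv_app[OF vW] by metis
  qed
  also have "\<dots> \<le> 1" using fin_pos by simp
  finally show ?thesis using directed_len_le_len[OF x sv] by linarith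
qed

section \<open>The Demazure product\<close>

definition greatest :: "('a \<Rightarrow> 'a) \<times> 'x \<Rightarrow> (('a \<Rightarrow> 'a) \<times> 'x) set \<Rightarrow> bool" where
  "greatest m S \<longleftrightarrow> m \<in> S \<and> (\<forall>y\<in>S. ble y m)"

text \<open>The induction ends at elements of length 0, which need not be trivial. They permute the
  positive affine roots, so right multiplication by them preserves Bruhat steps; \<ell>(x2, -) is
  odd and nonpositive, hence zero.\<close>

lemma len_zero_case:
  assumes x1: "x1 \<in> AW" and x2: "x2 \<in> AW" and z: "len x2 = 0"
  shows "greatest (mul x1 x2) (product_set x1 x2)" "len (mul x1 x2) = len x1"
    "\<And>\<gamma>. \<gamma> \<in> \<Phi> \<Longrightarrow> lx x2 \<gamma> = 0"
proof -
  have pos: "apos (aact pr x2 b)" if "apos b" for b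
  proof -
    have "{a. apos a \<and> \<not> apos (aact pr x2 a)} = {}"
      using z fin_neg_set[OF x2] unfolding alen_def by (simp only: card_eq_0_iff) blast
    then show ?thesis using that by blast
  qed
  have le: "lx x2 \<gamma> \<le> 0" if "\<gamma> \<in> \<Phi>" for \<gamma>
  proof -
    have "(\<Sum>\<gamma>\<in>\<Phi>. max 0 (lx x2 \<gamma>)) = 0" using len_sum[OF x2] z by simp
    then have "max 0 (lx x2 \<gamma>) = 0" using sum_nonneg_eq_0_iff[OF fin_roots, of "\<lambda>\<gamma>. max 0 (lx x2 \<gamma>)"] that by simp
    then show ?thesis by simp
  qed
  show lz: "lx x2 \<gamma> = 0" if "\<gamma> \<in> \<Phi>" for \<gamma>
    using le[OF that] le[OF minus_root[OF that]] lx_minus[OF x2 that] by simp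
  obtain w2 \<mu>2 where x2e: "x2 = (w2, \<mu>2)" "w2 \<in> W" using x2 AW_iff by (cases x2) auto
  have "int (len (mul x1 x2)) = (\<Sum>\<gamma>\<in>\<Phi>. max 0 (lx x1 (w2 \<gamma>)))"
    unfolding len_sum[OF mul_AW[OF x1 x2]]
    by (rule sum.cong) (use lz lx_mul[OF x1] x2 x2e in auto)
  then show "len (mul x1 x2) = len x1"
    using sum_roots_weyl[OF x2e(2), of "\<lambda>\<gamma>. max 0 (lx x1 \<gamma>)"] len_sum[OF x1] by simp
  have step: "bstep (mul y x2) (mul y' x2)" if s: "bstep y y'" for y y'
  proof -
    obtain a where a: "apos a" "apos (aact pr y a)" "y' = mul y (ref a)" and y: "y \<in> AW"
      using s unfolding bstep_iff by blast
    have aR: "a \<in> aroots" using a apos_aroots by blast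
    obtain x' where x': "x' \<in> AW" "mul x2 x' = (id, 0)" using ex_inverse[OF x2] by blast
    define b where "b = aact pr x' a"
    have bR: "b \<in> aroots" unfolding b_def using aact_aroots x' aR by blast
    have xb: "aact pr x2 b = a" unfolding b_def using aact_mul[OF x2 x'(1) aR] x'(2) aact_one by simp
    have bp: "apos b"
    proof (rule ccontr)
      assume "\<not> apos b"
      then have "apos (- b)" using apos_minus[OF bR] by simp
      then have "apos (aact pr x2 (- b))" using pos by blast
      then have "apos (- a)" using aact_minus[OF x2 bR] xb by simp
      then show False using apos_minus[OF aR] a by simp
    qed
    have "mul (ref a) x2 = mul x2 (ref b)" using ref_conj[OF x2 bR] xb by simp
    then have "mul y' x2 = mul (mul y x2) (ref b)"
      using a(3) mul_assoc[OF y ref_AW[OF aR] x2] mul_assoc[OF y x2 ref_AW[OF bR]] by simp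
    moreover have "aact pr (mul y x2) b = aact pr y a" using aact_mul[OF y x2 bR] xb by simp
    ultimately show ?thesis using bstep_up[OF mul_AW[OF y x2] bp] a by simp
  qed
  have mono: "ble (mul y x2) (mul y' x2)" if "ble y y'" for y y'
    using that unfolding bruhat_le_def
  proof (induction rule: rtranclp_induct)
    case (step u v) then show ?case using \<open>\<And>y y'. bstep y y' \<Longrightarrow> bstep (mul y x2) (mul y' x2)\<close>[OF step(2)] by simp
  qed simp
  have "y2 = x2" if "ble y2 x2" for y2 using ble_cases[OF that] z by simp
  then show "greatest (mul x1 x2) (product_set x1 x2)"
    unfolding greatest_def product_set_def using mono ble_refl by blast
qed

text \<open>Here \<open>v\<close> itself need not be length positive for the new element. But
  \<ell>(x, -) vanishes at the critical root, and the reflected vertex has an edge to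
  \<open>w \<circ> v\<close>, so \<open>v\<close> may be replaced by
  \<open>v \<circ> refl \<eta>\<close>, which \<open>lp_left_ref\<close> accepts; the end point
  \<open>w \<circ> v\<close> of a path is unchanged.\<close>

lemma lp_transfer:
  assumes a: "simple_aff (\<alpha>, k)" and w: "w \<in> W" and ge: "lx (w, \<mu>) (inv w \<alpha>) \<ge> 0"
    and v: "v \<in> lp (w, \<mu>)" and neg: "inv (w \<circ> v) \<alpha> \<notin> P"
  obtains v' where "v' \<in> lp (mul (ref (\<alpha>, k)) (w, \<mu>))" "refl \<alpha> \<circ> w \<circ> v' = w \<circ> v"
proof -
  have aR: "\<alpha> \<in> \<Phi>" using a simple_aff_aroots by auto
  have vW: "v \<in> W" using v lp_weyl by blast
  have wv: "w \<circ> v \<in> W" using w vW comp_weyl by blast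
  have x: "(w, \<mu>) \<in> AW" using w AW_iff by blast
  let ?t = "inv w \<alpha>"
  define \<eta> where "\<eta> = - inv (w \<circ> v) \<alpha>"
  have nR: "inv (w \<circ> v) \<alpha> \<in> \<Phi>" using inv_weyl[OF wv] weyl_root aR by blast
  have eta: "\<eta> \<in> P" unfolding \<eta>_def using neg nR minus_pos_iff by blast
  have tR: "?t \<in> \<Phi>" using inv_weyl w weyl_root aR by blast
  have it: "inv v ?t = - \<eta>" unfolding \<eta>_def using inv_comp_weyl[OF w vW] by simp
  then have "inv v ?t \<notin> P" using eta minus_pos_iff pos_is_root by metis
  then have "lx (w, \<mu>) ?t = 0" using lp_apply_nonpos[OF x v tR] ge by simp
  moreover have ve: "v \<eta> = - ?t"
    using it weyl_inv_app(2)[OF vW, of ?t] weyl_minus[OF vW, of \<eta>] by (metis minus_minus)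
  ultimately have z: "lx (w, \<mu>) (v \<eta>) = 0" using lx_minus[OF x tR] by simp
  have wve: "w (v \<eta>) = - \<alpha>" unfolding ve using weyl_minus[OF w] weyl_inv_app[OF w] by simp
  let ?u = "w \<circ> v \<circ> refl \<eta>"
  have uW: "?u \<in> W" using comp_weyl[OF wv refl_weyl[OF pos_is_root[OF eta]]] .
  have "?u \<eta> = \<alpha>" using wve refl_root_self[OF pos_is_root[OF eta]] weyl_minus[OF vW] weyl_minus[OF w] by simp
  then have iu: "inv ?u \<alpha> = \<eta>" using weyl_inv_app[OF uW] by metis
  have "edge_excess ?u \<eta> = 1" using affine_simple_edge[OF simple_aff_affine_simple[OF a] uW] iu eta by simp
  from lp_edge_target[OF w v eta z this] have l: "v \<circ> refl \<eta> \<in> lp (w, \<mu>)" .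
  have "inv (w \<circ> (v \<circ> refl \<eta>)) \<alpha> \<in> P" using iu eta by (simp add: comp_assoc)
  from lp_left_ref[OF a w l this] have 1: "v \<circ> refl \<eta> \<in> lp (mul (ref (\<alpha>, k)) (w, \<mu>))" .
  have "refl \<alpha> \<circ> ?u = ?u \<circ> refl \<eta>" using refl_comp_weyl[OF uW, of \<alpha>] iu by simp
  then have "refl \<alpha> \<circ> w \<circ> (v \<circ> refl \<eta>) = w \<circ> v"
    by (simp only: comp_assoc refl_comp_refl comp_id)
  with 1 that show ?thesis by blast
qed

text \<open>The bookkeeping of the bound: removing a left descent shortens \<open>x2\<close> by at
  least 1. If the descent lengthens \<open>x1\<close>, that unit pays for it and the path must not
  grow, which is what \<open>affine_simple_path\<close> provides. If \<open>x1\<close> is unchanged,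
  the unit allows the path one more edge.\<close>

lemma greatest_exists:
  assumes "x1 \<in> AW" "x2 \<in> AW" "lp x1 \<noteq> {}"
  shows "\<exists>m v1 v2 as. greatest m (product_set x1 x2) \<and> v1 \<in> lp x1 \<and> v2 \<in> lp x2 \<and>
     qb_path \<Phi> \<Delta> v1 as (fst x2 \<circ> v2) \<and> int (len m) \<le> int (len x1) + int (len x2) - int (length as)"
  using assms
proof (induction "len x2" arbitrary: x1 x2 rule: less_induct)
  case less
  note x1 = less.prems(1) and x2 = less.prems(2)
  show ?case
  proof (cases "len x2 = 0")
    case True
    obtain v1 where v1: "v1 \<in> lp x1" using less.prems(3) by blast
    have v1W: "v1 \<in> W" using v1 lp_weyl by blast
    obtain w2 \<mu>2 where x2e: "x2 = (w2, \<mu>2)" "w2 \<in> W" using x2 AW_iff by (cases x2) auto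
    have v2W: "inv w2 \<circ> v1 \<in> W" using comp_weyl inv_weyl x2e v1W by blast
    have "inv w2 \<circ> v1 \<in> lp x2"
      by (rule lpI[OF v2W]) (use len_zero_case(3)[OF x1 x2 True] weyl_root[OF v2W] pos_is_root in simp)
    moreover have "qb_path \<Phi> \<Delta> v1 [] (fst x2 \<circ> (inv w2 \<circ> v1))"
      using weyl_inv_comp[OF x2e(2)] by (simp add: x2e comp_assoc[symmetric])
    moreover have "int (len (mul x1 x2)) \<le> int (len x1) + int (len x2) - int (length ([] :: 'a list))"
      using len_zero_case(2)[OF x1 x2 True] by simp
    ultimately show ?thesis using len_zero_case(1)[OF x1 x2 True] v1 by blast
  next
    case False
    obtain b where b: "apos b" "\<not> apos (aact pr x2 b)"
      using False unfolding alen_def by (metis (mono_tags, lifting) Collect_empty_eq card.empty)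
    have bR: "b \<in> aroots" using b apos_aroots by blast
    \<comment> \<open>The inverse of \<open>x2\<close>. It sends the positive root
      \<open>- x2 b\<close> to \<open>- b\<close>, hence makes some simple affine root negative, and
      that root is a left descent of \<open>x2\<close>.\<close>
    obtain x' where x': "x' \<in> AW" "mul x' x2 = (id, 0)" "mul x2 x' = (id, 0)" using ex_inverse[OF x2] by blast
    have cR: "aact pr x2 b \<in> aroots" using aact_aroots x2 bR by blast
    have "aact pr x' (- aact pr x2 b) = - b"
      using aact_minus[OF x'(1) cR] aact_mul[OF x'(1) x2 bR] x'(2) aact_one by simp
    moreover have "\<not> apos (- b)" using b apos_minus[OF bR] by blast
    moreover have "apos (- aact pr x2 b)" using b apos_minus[OF cR] by blast
    ultimately obtain a where a: "simple_aff a" "\<not> apos (aact pr x' a)"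
      using ex_simple_aff_neg[OF x'(1)] by metis
    obtain \<alpha> k where ae: "a = (\<alpha>, k)" "\<alpha> \<in> \<Phi>" using simple_aff_aroots[OF a(1)] by auto
    have aR: "a \<in> aroots" using ae by simp
    have sa: "simple_aff (\<alpha>, k)" using a ae by simp
    note rW = ref_AW[OF aR]
    define x3 where "x3 = mul (ref a) x2"
    have x3: "x3 \<in> AW" unfolding x3_def using mul_AW rW x2 by blast
    have x23: "x2 = mul (ref a) x3" unfolding x3_def using ref_ref_mul[OF x2 aR] by simp
    obtain w2 \<mu>2 where x2e: "x2 = (w2, \<mu>2)" "w2 \<in> W" using x2 AW_iff by (cases x2) auto
    have x3e0: "x3 = (refl \<alpha> \<circ> w2, snd x3)" unfolding x3_def x2e ae by (simp add: aref_def mul_Pair)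
    define w3 \<mu>3 where "w3 = refl \<alpha> \<circ> w2" and "\<mu>3 = snd x3"
    have x3e: "x3 = (w3, \<mu>3)" using x3e0 w3_def \<mu>3_def by simp
    have w3: "w3 \<in> W" using x3 x3e AW_iff by simp
    have w23: "w2 = refl \<alpha> \<circ> w3" unfolding w3_def by (simp add: comp_assoc[symmetric] refl_comp_refl)
    have step: "bstep x3 x2"
    proof -
      have "lx x2 (inv w2 \<alpha>) < 0"
      proof (rule ccontr)
        assume "\<not> ?thesis"
        then have s: "bstep x2 x3" using left_ref_cases(1)[OF sa x2e(2), of \<mu>2] unfolding x3_def ae x2e by simp
        then obtain c where c: "apos c" "apos (aact pr x2 c)" "x3 = mul x2 (ref c)" unfolding bstep_iff by blast
        define d where "d = aact pr x' a"
        have dR: "d \<in> aroots" unfolding d_def using aact_aroots x' aR by blast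
        have xd: "aact pr x2 d = a" unfolding d_def using aact_mul[OF x2 x'(1) aR] x'(3) aact_one by simp
        have nd: "apos (- d)" using a(2) apos_minus[OF dR] d_def by simp
        have "\<not> apos (aact pr x2 (- d))"
          using aact_minus[OF x2 dR] xd apos_minus[OF aR] simple_aff_apos[OF a(1)] by simp
        then have "len (mul x2 (ref (- d))) < len x2" using len_ref_less[OF x2 nd] by blast
        moreover have "mul x2 (ref (- d)) = x3" unfolding ref_minus x3_def using ref_conj[OF x2 dR] xd by simp
        ultimately show False using bstep_len[OF s] by simp
      qed
      then show ?thesis using left_ref_cases(2)[OF sa x2e(2), of \<mu>2] unfolding x3_def ae x2e by simp
    qed
    have l3: "len x3 < len x2" using bstep_len step by blast
    have ge3: "lx (w3, \<mu>3) (inv w3 \<alpha>) \<ge> 0"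
    proof (rule ccontr)
      assume "\<not> ?thesis"
      then have "bstep x2 x3" using left_ref_cases(2)[OF sa w3, of \<mu>3] x23 ae x3e by simp
      then show False using bstep_len l3 by fastforce
    qed
    have x2e3: "x2 = mul (ref (\<alpha>, k)) (w3, \<mu>3)" using x23 ae x3e by simp
    have up: "ble x3 (mul (ref a) x3)" using bstep_ble[OF step] x23 by simp
    have apr: "apos (aact pr x1 a) \<longleftrightarrow> lx x1 \<alpha> \<le> 0"
      using right_apos_iff[OF x1 ae(2)] simple_aff_level[OF sa] ae by simp
    have ap: "apos a" using a simple_aff_apos by blast
    \<comment> \<open>Either \<open>v\<close> is kept and the end point of the path moves by the
      reflection, or \<open>v\<close> is changed and the end point stays.\<close>
    have tr: "\<exists>v2. v2 \<in> lp x2 \<and> ((inv (w3 \<circ> v) \<alpha> \<in> P \<and> w2 \<circ> v2 = refl \<alpha> \<circ> (w3 \<circ> v)) \<or> (inv (w3 \<circ> v) \<alpha> \<notin> P \<and> w2 \<circ> v2 = w3 \<circ> v))"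
      if v: "v \<in> lp x3" for v
    proof (cases "inv (w3 \<circ> v) \<alpha> \<in> P")
      case True
      then have "v \<in> lp x2" using lp_left_ref[OF sa w3 _ True] v x2e3 x3e by simp
      then show ?thesis using True w23 by (metis comp_assoc)
    next
      case F: False
      obtain v' where "v' \<in> lp (mul (ref (\<alpha>, k)) (w3, \<mu>3))" "refl \<alpha> \<circ> w3 \<circ> v' = w3 \<circ> v"
        using lp_transfer[OF sa w3 ge3 _ F] v x3e by blast
      then show ?thesis using F x2e3 w23 by metis
    qed
    show ?thesis
    proof (cases "lx x1 \<alpha> \<le> 0")
      case True
      let ?X = "mul x1 (ref a)"
      have X: "?X \<in> AW" using mul_AW x1 rW by blast
      have S: "product_set x1 x2 = product_set ?X x3" unfolding x23
        by (rule product_set_simple[OF a(1) x1 x3 up]) (use bstep_ble[OF bstep_up[OF x1 ap]] apr True in blast)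
      have ne: "lp ?X \<noteq> {}" using lp_right_ref_nonempty[OF sa x1 True] less.prems(3) ae by blast
      obtain m v1 v as where m: "greatest m (product_set ?X x3)" "v1 \<in> lp ?X" "v \<in> lp x3"
        "qb_path \<Phi> \<Delta> v1 as (w3 \<circ> v)" "int (len m) \<le> int (len ?X) + int (len x3) - int (length as)"
        using less.hyps[OF l3 X x3 ne] x3e by auto
      have v1: "refl \<alpha> \<circ> v1 \<in> lp x1" "inv v1 \<alpha> \<in> P" using lp_right_ref[OF sa x1 True] m(2) ae by blast+
      have v1W: "v1 \<in> W" using m lp_weyl by blast
      obtain v2 where v2: "v2 \<in> lp x2" "(inv (w3 \<circ> v) \<alpha> \<in> P \<and> w2 \<circ> v2 = refl \<alpha> \<circ> (w3 \<circ> v)) \<or> (inv (w3 \<circ> v) \<alpha> \<notin> P \<and> w2 \<circ> v2 = w3 \<circ> v)"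
        using tr[OF m(3)] by blast
      obtain bs where bs: "qb_path \<Phi> \<Delta> (refl \<alpha> \<circ> v1) bs (w2 \<circ> v2)" "length bs \<le> length as"
        using affine_simple_path[OF simple_aff_affine_simple[OF sa] v1W v1(2) m(4)] v2(2) by (metis less_imp_le)
      have "len ?X \<le> len x1 + 1" using len_mul_ref_le[OF sa x1] m(2) ae by simp
      then have "int (len m) \<le> int (len x1) + int (len x2) - int (length bs)"
        using m(5) l3 bs(2) by linarith
      then show ?thesis using m(1) v1(1) v2(1) bs(1) S x2e(1) by (metis fst_conv)
    next
      case F: False
      have S: "product_set x1 x2 = product_set x1 x3" unfolding x23
        by (rule product_set_simple[OF a(1) x1 x3 up]) (use bstep_ble[OF bstep_down[OF x1 ap]] apr F in blast)
      obtain m v1 v as where m: "greatest m (product_set x1 x3)" "v1 \<in> lp x1" "v \<in> lp x3"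
        "qb_path \<Phi> \<Delta> v1 as (w3 \<circ> v)" "int (len m) \<le> int (len x1) + int (len x3) - int (length as)"
        using less.hyps[OF l3 x1 x3 less.prems(3)] x3e by auto
      have v1W: "v1 \<in> W" and vW: "v \<in> W" using m lp_weyl by blast+
      have uW: "w3 \<circ> v \<in> W" using w3 vW comp_weyl by blast
      obtain v2 where v2: "v2 \<in> lp x2" "(inv (w3 \<circ> v) \<alpha> \<in> P \<and> w2 \<circ> v2 = refl \<alpha> \<circ> (w3 \<circ> v)) \<or> (inv (w3 \<circ> v) \<alpha> \<notin> P \<and> w2 \<circ> v2 = w3 \<circ> v)"
        using tr[OF m(3)] by blast
      have "\<exists>bs. qb_path \<Phi> \<Delta> v1 bs (w2 \<circ> v2) \<and> length bs \<le> Suc (length as)"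
        using v2(2)
      proof
        assume h: "inv (w3 \<circ> v) \<alpha> \<in> P \<and> w2 \<circ> v2 = refl \<alpha> \<circ> (w3 \<circ> v)"
        have "qb_path \<Phi> \<Delta> v1 (as @ [inv (w3 \<circ> v) \<alpha>]) (w2 \<circ> v2)"
          using qb_path_snoc_affine_simple[OF simple_aff_affine_simple[OF sa] v1W m(4)] h by simp
        then show ?thesis by (intro exI[of _ "as @ [inv (w3 \<circ> v) \<alpha>]"]) simp
      next
        assume "inv (w3 \<circ> v) \<alpha> \<notin> P \<and> w2 \<circ> v2 = w3 \<circ> v"
        then show ?thesis using m(4) by (intro exI[of _ as]) simp
      qed
      then obtain bs where bs: "qb_path \<Phi> \<Delta> v1 bs (w2 \<circ> v2)" "length bs \<le> Suc (length as)" by blast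
      have "int (len m) \<le> int (len x1) + int (len x2) - int (length bs)"
        using m(5) l3 bs(2) by linarith
      then show ?thesis using m(1,2) v2(1) bs(1) S x2e(1) by (metis fst_conv)
    qed
  qed
qed


section \<open>Weights of paths and the explicit product element\<close>

lemma qb_path_length:
  assumes "u \<in> W" "qb_path \<Phi> \<Delta> u as u'"
  shows "qb_pathwt \<Phi> \<Delta> u as \<in> Q"
    and "int (length as) = inversions u' - inversions u + rho_pair (emb (qb_pathwt \<Phi> \<Delta> u as))"
proof -
  have "qb_pathwt \<Phi> \<Delta> u as \<in> Q \<and> int (length as) = inversions u' - inversions u + rho_pair (emb (qb_pathwt \<Phi> \<Delta> u as))"
    using assms
  proof (induction as arbitrary: u)
    case Nil
    then show ?case by (simp add: zspan_zero emb_zero rho_pair_def pr_zero_left)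
  next
    case (Cons \<beta> as)
    have e: "\<beta> \<in> P" "edge_excess u \<beta> = 1" "qb_path \<Phi> \<Delta> (u \<circ> refl \<beta>) as u'"
      using qb_path_Cons_iff Cons.prems by blast+
    have bR: "\<beta> \<in> \<Phi>" using e pos_is_root by blast
    have u: "u \<circ> refl \<beta> \<in> W" using comp_weyl Cons.prems refl_weyl bR by blast
    note IH = Cons.IH[OF u e(3)]
    let ?c = "of_int (pind (- u \<beta>)) *\<^sub>R coroot \<beta>"
    have c: "?c \<in> Q" using coroot_lattice_scale bR by blast
    have w: "qb_pathwt \<Phi> \<Delta> u (\<beta> # as) = ?c + qb_pathwt \<Phi> \<Delta> (u \<circ> refl \<beta>) as"
      using qb_pathwt_Cons[OF Cons.prems(1) e(1,2)] .
    have "rho_pair (emb (qb_pathwt \<Phi> \<Delta> u (\<beta> # as))) = pind (- u \<beta>) * rho_height \<beta> + rho_pair (emb (qb_pathwt \<Phi> \<Delta> (u \<circ> refl \<beta>) as))"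
      unfolding w emb_add[OF c conjunct1[OF IH]] by (simp only: rho_pair_add rho_pair_emb_coroot[OF bR])
    \<comment> \<open>An edge has excess 1; summed along the path these equations telescope.\<close>
    moreover have "1 = inversions (u \<circ> refl \<beta>) - inversions u + pind (- u \<beta>) * rho_height \<beta>"
      using e(2) unfolding edge_excess_def by simp
    moreover have "int (length (\<beta> # as)) = 1 + int (length as)" by simp
    ultimately have "int (length (\<beta> # as)) = inversions u' - inversions u + rho_pair (emb (qb_pathwt \<Phi> \<Delta> u (\<beta> # as)))"
      using IH by linarith
    moreover have "qb_pathwt \<Phi> \<Delta> u (\<beta> # as) \<in> Q" unfolding w using IH c zspan_add by blast
    ultimately show ?case by blast
  qed
  then show "qb_pathwt \<Phi> \<Delta> u as \<in> Q"
    "int (length as) = inversions u' - inversions u + rho_pair (emb (qb_pathwt \<Phi> \<Delta> u as))" by blast+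
qed

text \<open>The product \<open>x1 \<cdot> v1 \<epsilon>^(-\<nu>) (w2 v2)^-1 \<cdot> x2\<close>
  written out as a pair; the finite part \<open>w2\<close> cancels and is not an argument.\<close>

definition candidate :: "('a \<Rightarrow> 'a) \<times> 'x \<Rightarrow> 'x \<Rightarrow> ('a \<Rightarrow> 'a) \<Rightarrow> ('a \<Rightarrow> 'a) \<Rightarrow> 'x \<Rightarrow> ('a \<Rightarrow> 'a) \<times> 'x" where
  "candidate x1 \<mu>2 v1 v2 \<nu> = (fst x1 \<circ> v1 \<circ> inv v2, act (v2 \<circ> inv v1) (snd x1) + \<mu>2 - act v2 \<nu>)"

lemma candidate_AW: "x1 \<in> AW \<Longrightarrow> v1 \<in> W \<Longrightarrow> v2 \<in> W \<Longrightarrow> candidate x1 \<mu>2 v1 v2 \<nu> \<in> AW"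
  by (cases x1) (simp add: candidate_def AW_iff comp_weyl inv_weyl)

text \<open>The two length formulas for \<open>x1\<close> and \<open>x2\<close> differ from that of
  the candidate by the lengths of \<open>v1\<close> and \<open>w2 \<circ> v2\<close> and the pairing
  of the weight with 2\<rho>, which \<open>qb_path_length\<close> combines to the number of edges.
  Any path is allowed here, not only a shortest one.\<close>

lemma directed_len_candidate:
  assumes x1: "(w1, \<mu>1) \<in> AW" and w2: "w2 \<in> W" and v1: "v1 \<in> lp (w1, \<mu>1)" and v2: "v2 \<in> lp (w2, \<mu>2)"
    and p: "qb_path \<Phi> \<Delta> v1 as (w2 \<circ> v2)"
  shows "directed_len v2 (candidate (w1, \<mu>1) \<mu>2 v1 v2 (emb (qb_pathwt \<Phi> \<Delta> v1 as)))
    = int (len (w1, \<mu>1)) + int (len (w2, \<mu>2)) - int (length as)"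
proof -
  have W: "w1 \<in> W" "v1 \<in> W" "v2 \<in> W" using x1 v1 v2 lp_weyl AW_iff by auto
  let ?c = "emb (qb_pathwt \<Phi> \<Delta> v1 as)"
  have x2: "(w2, \<mu>2) \<in> AW" using w2 AW_iff by blast
  have "act (inv v2) (act (v2 \<circ> inv v1) \<mu>1 + \<mu>2 - act v2 ?c) = act (inv v1) \<mu>1 + act (inv v2) \<mu>2 - ?c"
    using W by (simp only: act_add act_diff inv_weyl act_comp act_inv_cancel)
  moreover have "w1 \<circ> v1 \<circ> inv v2 \<circ> v2 = w1 \<circ> v1" using weyl_inv_comp[OF W(3)] by (simp only: comp_assoc comp_id)
  ultimately have "directed_len v2 (candidate (w1, \<mu>1) \<mu>2 v1 v2 ?c)
      = rho_pair (act (inv v1) \<mu>1) + rho_pair (act (inv v2) \<mu>2) - rho_pair ?c - inversions v2 + inversions (w1 \<circ> v1)"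
    unfolding candidate_def fst_conv snd_conv
    using directed_len_formula[of "w1 \<circ> v1 \<circ> inv v2" v2 "act (v2 \<circ> inv v1) \<mu>1 + \<mu>2 - act v2 ?c"]
    by (simp only: W comp_weyl inv_weyl rho_pair_add rho_pair_diff)
  moreover have "int (len (w1, \<mu>1)) = rho_pair (act (inv v1) \<mu>1) - inversions v1 + inversions (w1 \<circ> v1)"
    using directed_len_eq_len_iff[OF x1 W(2)] v1 directed_len_formula[OF W(1,2), of \<mu>1] by simp
  moreover have "int (len (w2, \<mu>2)) = rho_pair (act (inv v2) \<mu>2) - inversions v2 + inversions (w2 \<circ> v2)"
    using directed_len_eq_len_iff[OF x2 W(3)] v2 directed_len_formula[OF w2 W(3), of \<mu>2] by simp
  ultimately show ?thesis using qb_path_length(2)[OF W(2) p] by linarith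
qed

lemma candidate_in_product_set:
  assumes "x1 \<in> AW" "w2 \<in> W" "v1 \<in> lp x1" "v2 \<in> lp (w2, \<mu>2)" "qb_path \<Phi> \<Delta> v1 as (w2 \<circ> v2)"
    and "\<And>v1' v2' as'. v1' \<in> lp x1 \<Longrightarrow> v2' \<in> lp (w2, \<mu>2) \<Longrightarrow> qb_path \<Phi> \<Delta> v1' as' (w2 \<circ> v2') \<Longrightarrow> length as \<le> length as'"
  shows "candidate x1 \<mu>2 v1 v2 (emb (qb_pathwt \<Phi> \<Delta> v1 as)) \<in> product_set x1 (w2, \<mu>2)"
  using assms
proof (induction "length as" arbitrary: x1 v1 v2 as rule: less_induct)
  case less
  note x1 = less.prems(1) and w2 = less.prems(2) and v1 = less.prems(3) and v2 = less.prems(4)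
    and p = less.prems(5) and min = less.prems(6)
  obtain w1 \<mu>1 where x1e: "x1 = (w1, \<mu>1)" "w1 \<in> W" using x1 AW_iff by (cases x1) auto
  have W: "v1 \<in> W" "v2 \<in> W" using v1 v2 lp_weyl by auto
  have x2: "(w2, \<mu>2) \<in> AW" using w2 AW_iff by blast
  show ?case
  proof (cases as)
    case Nil
    then have v1e: "v1 = w2 \<circ> v2" using p by simp
    have "w1 \<circ> v1 \<circ> inv v2 = w1 \<circ> w2" unfolding v1e using weyl_inv_comp[OF W(2)] by (simp only: comp_assoc comp_id)
    moreover have "v2 \<circ> inv v1 = inv w2"
      unfolding v1e inv_comp_weyl[OF w2 W(2)] using weyl_inv_comp[OF W(2)]
      by (simp only: comp_assoc[symmetric] id_comp)
    ultimately have "candidate x1 \<mu>2 v1 v2 (emb (qb_pathwt \<Phi> \<Delta> v1 as)) = mul x1 (w2, \<mu>2)"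
      unfolding candidate_def x1e fst_conv snd_conv Nil mul_Pair qb_pathwt.simps(1) emb_zero
      by (simp only: act_zero W(2)) simp
    then show ?thesis using product_setI[OF ble_refl ble_refl] by metis
  next
    case (Cons \<beta> as')
    have e: "\<beta> \<in> P" "edge_excess v1 \<beta> = 1" "qb_path \<Phi> \<Delta> (v1 \<circ> refl \<beta>) as' (w2 \<circ> v2)"
      using p qb_path_Cons_iff[OF W(1)] unfolding Cons by blast+
    have bR: "\<beta> \<in> \<Phi>" using e pos_is_root by blast
    \<comment> \<open>The level \<open>?k\<close> is the lowest positive one over \<open>?g\<close>,
      and it is 1 exactly on quantum edges, so the translation part of the reflection carries the
      weight of the edge.\<close>
    let ?g = "v1 \<beta>" and ?k = "pind (- v1 \<beta>)" and ?u = "v1 \<circ> refl \<beta>"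
    have gR: "?g \<in> \<Phi>" using weyl_root W bR by blast
    have uW: "?u \<in> W" using comp_weyl W refl_weyl bR by blast
    \<comment> \<open>If it vanished, the edge would stay inside LP(x1), and the rest of the path
      would be a shorter competitor.\<close>
    have "lx x1 ?g \<noteq> 0"
    proof
      assume "lx x1 ?g = 0"
      then have "?u \<in> lp x1" using lp_edge_source[OF x1e(2)] v1 e x1e(1) by simp
      from min[OF this v2 e(3)] show False using Cons by simp
    qed
    moreover have "lx x1 ?g \<ge> 0" using lpD[OF v1 e(1)] .
    ultimately have "lx x1 ?g > 0" by simp
    then have na: "\<not> apos (aact pr x1 (?g, ?k))" using right_apos_iff[OF x1 gR] by simp
    have ap: "apos (?g, ?k)" using gR by (simp add: pos_aff_def)
    define y where "y = mul x1 (ref (?g, ?k))"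
    have yx: "bstep y x1" unfolding y_def using bstep_down[OF x1 ap na] .
    have y: "y \<in> AW" using yx bstep_AW by blast
    have ly: "len y < len x1" using yx bstep_len by blast
    define wy \<mu>y where "wy = w1 \<circ> refl ?g" and "\<mu>y = act (refl ?g) \<mu>1 + emb (of_int ?k *\<^sub>R coroot ?g)"
    have ye: "y = (wy, \<mu>y)"
      unfolding y_def x1e wy_def \<mu>y_def aref_def by (simp only: prod.case mul_Pair inv_refl)
    have wyW: "wy \<in> W" using y ye AW_iff by simp
    have iu: "inv ?u = refl \<beta> \<circ> inv v1" using inv_comp_weyl[OF W(1) refl_weyl[OF bR]] inv_refl by metis
    have "refl \<beta> \<circ> inv v1 = inv v1 \<circ> refl ?g"
      using refl_weyl_conj[OF inv_weyl[OF W(1)], of ?g] weyl_inv_app(1)[OF W(1)] by simp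
    then have "inv ?u \<circ> refl ?g = inv v1" unfolding iu by (simp only: comp_assoc refl_comp_refl comp_id)
    then have i1: "act (inv ?u) (act (refl ?g) \<mu>1) = act (inv v1) \<mu>1"
      using act_comp[OF inv_weyl[OF uW] refl_weyl[OF gR]] by metis
    have "inv ?u ?g = - \<beta>" unfolding iu using weyl_inv_app(1)[OF W(1)] refl_root_self[OF bR] by simp
    then have i2: "act (inv ?u) (emb (of_int ?k *\<^sub>R coroot ?g)) = - emb (of_int ?k *\<^sub>R coroot \<beta>)"
      using act_emb_coroot[OF inv_weyl[OF uW] gR, of ?k] emb_minus[OF coroot_lattice_scale[OF bR, of ?k]]
      by (simp add: coroot_minus)
    have iact: "act (inv ?u) \<mu>y = act (inv v1) \<mu>1 - emb (of_int ?k *\<^sub>R coroot \<beta>)"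
      unfolding \<mu>y_def act_add[OF inv_weyl[OF uW]] i1 i2 by simp
    have "refl ?g \<circ> v1 \<circ> refl \<beta> = v1"
      using refl_weyl_conj[OF W(1), of \<beta>] by (metis comp_assoc refl_comp_refl comp_id)
    then have wyu: "wy \<circ> ?u = w1 \<circ> v1" unfolding wy_def by (metis comp_assoc)
    have "directed_len ?u y = rho_pair (act (inv v1) \<mu>1) - ?k * rho_height \<beta> - inversions ?u + inversions (w1 \<circ> v1)"
      unfolding ye directed_len_formula[OF wyW uW] iact wyu rho_pair_diff rho_pair_emb_coroot[OF bR] ..
    moreover have "int (len x1) = rho_pair (act (inv v1) \<mu>1) - inversions v1 + inversions (w1 \<circ> v1)"
      using directed_len_eq_len_iff[OF x1 W(1)] v1 directed_len_formula[OF x1e(2) W(1), of \<mu>1] x1e by simp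
    moreover have "inversions ?u - inversions v1 + ?k * rho_height \<beta> = 1" using e(2) unfolding edge_excess_def .
    ultimately have "directed_len ?u y = int (len x1) - 1" by linarith
    \<comment> \<open>The directed length bounds \<open>len y\<close> from below, the Bruhat step
      from above, by the same number.\<close>
    then have "directed_len ?u y = int (len y)" and ly1: "int (len y) = int (len x1) - 1"
      using directed_len_le_len[OF y uW] ly by linarith+
    then have ulp: "?u \<in> lp y" using directed_len_eq_len_iff[OF y uW] by blast
    have ymin: "length as' \<le> length bs" if b: "v1' \<in> lp y" "v2' \<in> lp (w2, \<mu>2)" "qb_path \<Phi> \<Delta> v1' bs (w2 \<circ> v2')" for v1' v2' bs
    proof (rule ccontr)
      assume neg: "\<not> length as' \<le> length bs"
      let ?R = "\<lambda>n. \<exists>v1' v2' bs. v1' \<in> lp y \<and> v2' \<in> lp (w2, \<mu>2) \<and> qb_path \<Phi> \<Delta> v1' bs (w2 \<circ> v2') \<and> length bs = n"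
      \<comment> \<open>The induction hypothesis speaks of minimal paths only, so the competitor is
        replaced by a shortest one for \<open>y\<close>.\<close>
      define n where "n = (LEAST n. ?R n)"
      have R: "?R (length bs)" using b by blast
      have "?R n" unfolding n_def using LeastI[of ?R, OF R] .
      then obtain u1 u2 cs where c: "u1 \<in> lp y" "u2 \<in> lp (w2, \<mu>2)" "qb_path \<Phi> \<Delta> u1 cs (w2 \<circ> u2)" "length cs = n"
        by blast
      have nle: "n \<le> length bs" unfolding n_def using Least_le[of ?R, OF R] .
      have cmin: "length cs \<le> length ds" if "v1' \<in> lp y" "v2' \<in> lp (w2, \<mu>2)" "qb_path \<Phi> \<Delta> v1' ds (w2 \<circ> v2')" for v1' v2' ds
      proof -
        have "?R (length ds)" using that by blast
        then show ?thesis unfolding c(4) n_def by (rule Least_le)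
      qed
      have "length cs < length as" using nle neg Cons c(4) by simp
      let ?z = "candidate y \<mu>2 u1 u2 (emb (qb_pathwt \<Phi> \<Delta> u1 cs))"
      have "?z \<in> product_set y (w2, \<mu>2)"
        by (rule less.hyps[OF \<open>length cs < length as\<close> y w2 c(1-3)]) (use cmin in blast)
      then have zS: "?z \<in> product_set x1 (w2, \<mu>2)" using product_set_mono[OF bstep_ble[OF yx]] by blast
      have uW2: "u1 \<in> W" "u2 \<in> W" using c lp_weyl by blast+
      have "directed_len u2 ?z = int (len y) + int (len (w2, \<mu>2)) - int (length cs)"
        unfolding ye by (rule directed_len_candidate) (use c w2 y ye in simp_all)
      then have zl: "int (len ?z) \<ge> int (len x1) - 1 + int (len (w2, \<mu>2)) - int (length cs)"
        using directed_len_le_len[OF candidate_AW[OF y uW2] uW2(2), of \<mu>2 "emb (qb_pathwt \<Phi> \<Delta> u1 cs)"] ly1 by linarith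
      have "lp x1 \<noteq> {}" using v1 by blast
      then obtain m t1 t2 ts where m: "greatest m (product_set x1 (w2, \<mu>2))" "t1 \<in> lp x1" "t2 \<in> lp (w2, \<mu>2)"
        "qb_path \<Phi> \<Delta> t1 ts (w2 \<circ> t2)" "int (len m) \<le> int (len x1) + int (len (w2, \<mu>2)) - int (length ts)"
        using greatest_exists[OF x1 x2] unfolding fst_conv by blast
      have "ble ?z m" using m(1) zS unfolding greatest_def by blast
      then have "len ?z \<le> len m" using ble_cases by fastforce
      moreover have "length as \<le> length ts" using min m by blast
      ultimately have "int (length as) \<le> int (length cs) + 1" using zl m(5) by linarith
      then show False using neg nle Cons c(4) by simp
    qed
    have "candidate y \<mu>2 ?u v2 (emb (qb_pathwt \<Phi> \<Delta> ?u as')) \<in> product_set y (w2, \<mu>2)"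
      by (rule less.hyps[OF _ y w2 ulp v2 e(3)]) (use ymin Cons in auto)
    \<comment> \<open>The reflection that turns \<open>x1\<close> into \<open>y\<close> is undone by
      dropping the edge: its finite part cancels against that of \<open>?u\<close>, its translation
      part against the weight of the edge.\<close>
    moreover have "candidate y \<mu>2 ?u v2 (emb (qb_pathwt \<Phi> \<Delta> ?u as')) = candidate x1 \<mu>2 v1 v2 (emb (qb_pathwt \<Phi> \<Delta> v1 as))"
    proof -
      have "wy \<circ> ?u \<circ> inv v2 = w1 \<circ> v1 \<circ> inv v2" unfolding wyu ..
      moreover have "act (v2 \<circ> inv ?u) \<mu>y = act (v2 \<circ> inv v1) \<mu>1 - act v2 (emb (of_int ?k *\<^sub>R coroot \<beta>))"
        unfolding act_comp[OF W(2) inv_weyl[OF uW]] iact act_diff[OF W(2)] act_comp[OF W(2) inv_weyl[OF W(1)]] ..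
      moreover have "act v2 (emb (qb_pathwt \<Phi> \<Delta> v1 as)) = act v2 (emb (of_int ?k *\<^sub>R coroot \<beta>)) + act v2 (emb (qb_pathwt \<Phi> \<Delta> ?u as'))"
        unfolding Cons qb_pathwt_Cons[OF W(1) e(1,2)]
          emb_add[OF coroot_lattice_scale[OF bR] qb_path_length(1)[OF uW e(3)]] act_add[OF W(2)] ..
      ultimately show ?thesis unfolding candidate_def ye x1e fst_conv snd_conv by simp
    qed
    ultimately show ?thesis using product_set_mono[OF bstep_ble[OF yx]] by auto
  qed
qed

section \<open>The formula for the Demazure product\<close>

lemma qb_dist_path:
  assumes "u \<in> W" "u' \<in> W" shows "\<exists>as. qb_path \<Phi> \<Delta> u as u' \<and> length as = qb_dist \<Phi> \<Delta> u u'"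
proof -
  let ?R = "\<lambda>n. \<exists>as. qb_path \<Phi> \<Delta> u as u' \<and> length as = n"
  obtain as where "qb_path \<Phi> \<Delta> u as u'" using qb_path_exists[OF assms] by blast
  then have "?R (length as)" by blast
  then show ?thesis unfolding qb_dist_def by (rule LeastI)
qed

lemma qb_dist_le: "qb_path \<Phi> \<Delta> u as u' \<Longrightarrow> qb_dist \<Phi> \<Delta> u u' \<le> length as"
  unfolding qb_dist_def by (rule Least_le) blast

text \<open>A greatest element is the only maximal one, antisymmetry coming from the strict growth
  of the length.\<close>

lemma demazure_greatest:
  assumes "greatest m (product_set x1 x2)" shows "demazure \<Phi> \<Delta> emb pr x1 x2 = m"
proof -
  have g: "m \<in> product_set x1 x2" "\<And>y. y \<in> product_set x1 x2 \<Longrightarrow> ble y m" using assms unfolding greatest_def by blast+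
  have "(THE z. z \<in> product_set x1 x2 \<and> (\<forall>y\<in>product_set x1 x2. ble z y \<longrightarrow> y = z)) = m"
  proof (rule the_equality)
    show "m \<in> product_set x1 x2 \<and> (\<forall>y\<in>product_set x1 x2. ble m y \<longrightarrow> y = m)"
      using g ble_cases by (metis less_asym)
  next
    fix z assume "z \<in> product_set x1 x2 \<and> (\<forall>y\<in>product_set x1 x2. ble z y \<longrightarrow> y = z)"
    then show "z = m" using g by blast
  qed
  then show ?thesis unfolding demazure_def product_set_def Let_def .
qed

theorem demazure_formula:
  assumes w1: "w1 \<in> W" and w2: "w2 \<in> W" and v1: "v1 \<in> lp (w1, \<mu>1)" and v2: "v2 \<in> lp (w2, \<mu>2)"
    and min: "\<forall>v1'\<in>lp (w1, \<mu>1). \<forall>v2'\<in>lp (w2, \<mu>2).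
      qb_dist \<Phi> \<Delta> v1 (w2 \<circ> v2) \<le> qb_dist \<Phi> \<Delta> v1' (w2 \<circ> v2')"
  defines "z \<equiv> candidate (w1, \<mu>1) \<mu>2 v1 v2 (qb_wt \<Phi> \<Delta> emb v1 (w2 \<circ> v2))"
  shows "demazure \<Phi> \<Delta> emb pr (w1, \<mu>1) (w2, \<mu>2) = z"
    and "int (len z) = int (len (w1, \<mu>1)) + int (len (w2, \<mu>2)) - int (qb_dist \<Phi> \<Delta> v1 (w2 \<circ> v2))"
    and "v2 \<in> lp z"
proof -
  let ?x1 = "(w1, \<mu>1)" and ?x2 = "(w2, \<mu>2)" and ?d = "qb_dist \<Phi> \<Delta> v1 (w2 \<circ> v2)"
  have x1: "?x1 \<in> AW" and x2: "?x2 \<in> AW" using w1 w2 AW_iff by blast+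
  have W: "v1 \<in> W" "v2 \<in> W" using v1 v2 lp_weyl by blast+
  have dle: "?d \<le> length as'" if "v1' \<in> lp ?x1" "v2' \<in> lp ?x2" "qb_path \<Phi> \<Delta> v1' as' (w2 \<circ> v2')" for v1' v2' as'
    using min that qb_dist_le[OF that(3)] by (meson order_trans)
  have "lp ?x1 \<noteq> {}" using v1 by blast
  then obtain m t1 t2 ts where m: "greatest m (product_set ?x1 ?x2)" "t1 \<in> lp ?x1" "t2 \<in> lp ?x2"
    "qb_path \<Phi> \<Delta> t1 ts (w2 \<circ> t2)" "int (len m) \<le> int (len ?x1) + int (len ?x2) - int (length ts)"
    using greatest_exists[OF x1 x2] unfolding fst_conv by blast
  let ?zp = "\<lambda>as. candidate ?x1 \<mu>2 v1 v2 (emb (qb_pathwt \<Phi> \<Delta> v1 as))"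
  \<comment> \<open>Squeeze: the candidate lies below \<open>m\<close>, its length is at least the
    claimed number, and that of \<open>m\<close> is at most this number. Equality with the directed
    length then gives \<open>v2\<close> in LP.\<close>
  have main: "?zp as = m \<and> int (len (?zp as)) = int (len ?x1) + int (len ?x2) - int ?d \<and> v2 \<in> lp (?zp as)"
    if as: "qb_path \<Phi> \<Delta> v1 as (w2 \<circ> v2)" "length as = ?d" for as
  proof -
    have "?zp as \<in> product_set ?x1 ?x2"
      by (rule candidate_in_product_set[OF x1 w2 v1 v2 as(1)]) (use dle as(2) in simp)
    then have "ble (?zp as) m" using m(1) unfolding greatest_def by blast
    then have c: "?zp as = m \<or> len (?zp as) < len m" by (rule ble_cases)
    have zW: "?zp as \<in> AW" using candidate_AW[OF x1 W] .
    have L: "directed_len v2 (?zp as) = int (len ?x1) + int (len ?x2) - int ?d"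
      using directed_len_candidate[OF x1 w2 v1 v2 as(1)] as(2) by simp
    have "directed_len v2 (?zp as) \<le> int (len (?zp as))" using directed_len_le_len[OF zW W(2)] .
    moreover have "?d \<le> length ts" using dle m by blast
    ultimately have zm: "?zp as = m" and "int (len (?zp as)) = int (len ?x1) + int (len ?x2) - int ?d"
      using c L m(5) by force+
    then show ?thesis using L directed_len_eq_len_iff[OF zW W(2)] by simp
  qed
  obtain as where as: "qb_path \<Phi> \<Delta> v1 as (w2 \<circ> v2)" "length as = ?d"
    using qb_dist_path[OF W(1) comp_weyl[OF w2 W(2)]] by blast
  have wt: "qb_wt \<Phi> \<Delta> emb v1 (w2 \<circ> v2) = emb (qb_pathwt \<Phi> \<Delta> v1 as)"
    unfolding qb_wt_def
  proof (rule the_equality)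
    show "\<exists>bs. qb_path \<Phi> \<Delta> v1 bs (w2 \<circ> v2) \<and> length bs = ?d \<and> emb (qb_pathwt \<Phi> \<Delta> v1 as) = emb (qb_pathwt \<Phi> \<Delta> v1 bs)"
      using as by blast
  next
    fix \<nu> assume "\<exists>bs. qb_path \<Phi> \<Delta> v1 bs (w2 \<circ> v2) \<and> length bs = ?d \<and> \<nu> = emb (qb_pathwt \<Phi> \<Delta> v1 bs)"
    then obtain bs where bs: "qb_path \<Phi> \<Delta> v1 bs (w2 \<circ> v2)" "length bs = ?d" "\<nu> = emb (qb_pathwt \<Phi> \<Delta> v1 bs)" by blast
    \<comment> \<open>Both candidates are the greatest element \<open>m\<close>, and they differ
      only in the weight, which \<open>act v2\<close> transports injectively.\<close>
    have "?zp bs = ?zp as" using main[OF as] main[OF bs(1,2)] by metis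
    then have "act v2 \<nu> = act v2 (emb (qb_pathwt \<Phi> \<Delta> v1 as))" unfolding candidate_def bs(3) by simp
    then show "\<nu> = emb (qb_pathwt \<Phi> \<Delta> v1 as)" by (metis act_inv_cancel(2)[OF W(2)])
  qed
  have z: "z = ?zp as" unfolding z_def wt ..
  show "demazure \<Phi> \<Delta> emb pr ?x1 ?x2 = z" using demazure_greatest[OF m(1)] main[OF as] z by simp
  show "int (len z) = int (len ?x1) + int (len ?x2) - int ?d" "v2 \<in> lp z" unfolding z using main[OF as] by blast+
qed

end

theorem theorem5p8:
  fixes \<Phi> \<Delta> :: "'a::euclidean_space set"
    and emb :: "'a \<Rightarrow> 'x::ab_group_add" and pr :: "'x \<Rightarrow> 'a \<Rightarrow> int"
    and w1 w2 v1 v2 :: "'a \<Rightarrow> 'a" and \<mu>1 \<mu>2 :: 'x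
  assumes "root_system \<Phi>" and "root_basis \<Phi> \<Delta>" and "cochar_data \<Phi> emb pr"
    and "w1 \<in> weyl \<Phi>" and "w2 \<in> weyl \<Phi>"
    and "v1 \<in> LP \<Phi> \<Delta> pr (w1, \<mu>1)" and "v2 \<in> LP \<Phi> \<Delta> pr (w2, \<mu>2)"
    and "\<forall>v1'\<in>LP \<Phi> \<Delta> pr (w1, \<mu>1). \<forall>v2'\<in>LP \<Phi> \<Delta> pr (w2, \<mu>2).
           qb_dist \<Phi> \<Delta> v1 (w2 \<circ> v2) \<le> qb_dist \<Phi> \<Delta> v1' (w2 \<circ> v2')"
  shows "demazure \<Phi> \<Delta> emb pr (w1, \<mu>1) (w2, \<mu>2) =
           (w1 \<circ> v1 \<circ> inv v2,
            wact \<Phi> emb pr (v2 \<circ> inv v1) \<mu>1 + \<mu>2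
              - wact \<Phi> emb pr v2 (qb_wt \<Phi> \<Delta> emb v1 (w2 \<circ> v2)))
         \<and> int (alen \<Phi> \<Delta> pr (demazure \<Phi> \<Delta> emb pr (w1, \<mu>1) (w2, \<mu>2))) =
           int (alen \<Phi> \<Delta> pr (w1, \<mu>1)) + int (alen \<Phi> \<Delta> pr (w2, \<mu>2))
           - int (qb_dist \<Phi> \<Delta> v1 (w2 \<circ> v2))
         \<and> v2 \<in> LP \<Phi> \<Delta> pr (demazure \<Phi> \<Delta> emb pr (w1, \<mu>1) (w2, \<mu>2))"
proof -
  interpret cochar_roots \<Phi> \<Delta> emb pr
    by unfold_locales (fact assms(1-3))+
  note f = demazure_formula[OF assms(4-8)]
  show ?thesis
    unfolding f(1) using f(2,3) unfolding candidate_def fst_conv snd_conv by blast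
qed

end
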